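(* Let $F$ be a field, let $n\geq 1$, and let $\Gamma\leq \operatorname{GL}_n(F)$ be a finitely generated infinite subgroup. Then $$\kappa_{\mathrm u}(\Gamma)=0.$$
   Context: For a finitely generated group $\Gamma$ and a finite set $S\subseteq\Gamma$, the Kazhdan constant of $\Gamma$ relative to $S$ is $$\kappa(\Gamma,S)=\inf_{\substack{\pi:\Gamma\to\mathcal U(\mathcal H)\\ \mathcal H^\Gamma=\{0\}}}\ \inf_{\substack{\xi\in\mathcal H\\ \|\xi\|=1}}\ \max_{s\in S}\|\pi(s)\xi-\xi\|,$$ where the first infimum is over all unitary representations $\pi$ of $\Gamma$ on Hilbert spaces $\mathcal H$ with no nonzero $\Gamma$-invariant vector ($\mathcal U(\mathcal H)$ is the unitary group of $\mathcal H$, and $\mathcal H^\Gamma$ is the subspace of $\Gamma$-invariant vectors). The uniform Kazhdan constant of $\Gamma$ is $$\kappa_{\mathrm u}(\Gamma)=\inf_{\substack{S\subseteq\Gamma\text{ finite}\\ \langle S\rangle=\Gamma}}\kappa(\Gamma,S),$$ the infimum over all finite generating sets $S$ of $\Gamma$, with no bound on their cardinalities. *)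

theory Defs
  imports
    "HOL-Analysis.Abstract_Metric_Spaces"
    "HOL-Library.Extended_Nonnegative_Real"
    "HOL-Algebra.Bij"
    "HOL-Algebra.Generated_Groups"
    "HOL-Algebra.Algebraic_Closure_Type"
    "Jordan_Normal_Form.Matrix"
begin

text \<open>
  Complex Hilbert spaces are structures on a carrier set, so that a single formula can range over
  Hilbert spaces of all dimensions. As usual for HOL-Algebra modules, the fields \<open>mult\<close> and
  \<open>one\<close> inherited from rings play no role. The inner product is linear in its first argument.
\<close>

record 'h hilbert = "(complex, 'h) module" +
  inprod :: "'h \<Rightarrow> 'h \<Rightarrow> complex"

definition hnorm :: "('h, 'b) hilbert_scheme \<Rightarrow> 'h \<Rightarrow> real" where
  "hnorm H x = sqrt (Re (inprod H x x))"

locale hilbert_space = module "ring_of_type_algebra :: complex ring" H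
  for H :: "('h, 'b) hilbert_scheme" (structure) +
  assumes inprod_add_left:
      "\<lbrakk>x \<in> carrier H; y \<in> carrier H; z \<in> carrier H\<rbrakk>
        \<Longrightarrow> inprod H (x \<oplus> y) z = inprod H x z + inprod H y z"
    and inprod_smult_left:
      "\<lbrakk>x \<in> carrier H; y \<in> carrier H\<rbrakk> \<Longrightarrow> inprod H (c \<odot> x) y = c * inprod H x y"
    and inprod_cnj: "\<lbrakk>x \<in> carrier H; y \<in> carrier H\<rbrakk> \<Longrightarrow> inprod H y x = cnj (inprod H x y)"
    and inprod_nonneg: "x \<in> carrier H \<Longrightarrow> 0 \<le> Re (inprod H x x)"
    and inprod_definite: "\<lbrakk>x \<in> carrier H; inprod H x x = 0\<rbrakk> \<Longrightarrow> x = \<zero>"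
    and complete: "Metric_space.mcomplete (carrier H) (\<lambda>x y. hnorm H (x \<ominus> y))"

text \<open>
  The unitary group \<open>U(H)\<close>, as a subgroup of the group of all bijections of the carrier.
\<close>

definition unitary_group :: "('h, 'b) hilbert_scheme \<Rightarrow> ('h \<Rightarrow> 'h) monoid" where
  "unitary_group H = (BijGroup (carrier H))
    \<lparr>carrier := {T \<in> Bij (carrier H).
      (\<forall>x\<in>carrier H. \<forall>y\<in>carrier H. T (x \<oplus>\<^bsub>H\<^esub> y) = T x \<oplus>\<^bsub>H\<^esub> T y) \<and>
      (\<forall>c. \<forall>x\<in>carrier H. T (c \<odot>\<^bsub>H\<^esub> x) = c \<odot>\<^bsub>H\<^esub> T x) \<and>
      (\<forall>x\<in>carrier H. \<forall>y\<in>carrier H. inprod H (T x) (T y) = inprod H x y)}\<rparr>"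

definition unitary_rep ::
  "('g, 'a) monoid_scheme \<Rightarrow> ('h, 'b) hilbert_scheme \<Rightarrow> ('g \<Rightarrow> 'h \<Rightarrow> 'h) \<Rightarrow> bool" where
  "unitary_rep G H \<pi> \<longleftrightarrow> hilbert_space H \<and> \<pi> \<in> hom G (unitary_group H)"

definition invariant_vectors ::
  "('g, 'a) monoid_scheme \<Rightarrow> ('h, 'b) hilbert_scheme \<Rightarrow> ('g \<Rightarrow> 'h \<Rightarrow> 'h) \<Rightarrow> 'h set" where
  "invariant_vectors G H \<pi> = {x \<in> carrier H. \<forall>g\<in>carrier G. \<pi> g x = x}"

text \<open>
  A HOL formula cannot quantify over all types, so the Kazhdan constant takes the type of the
  underlying sets of the Hilbert spaces as an argument. If \<open>G\<close> is countable, the value does not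
  depend on this type as soon as \<open>nat \<Rightarrow> complex\<close> embeds into it: restricting to the closed span
  of the orbit of a vector one may assume that the Hilbert space is separable.

  The values are in \<open>ennreal\<close>, so that an infimum over the empty set is \<open>\<infinity>\<close>, and
  the supremum over a finite set is its maximum (0 for the empty set).
\<close>

definition kazhdan_const ::
  "'h itself \<Rightarrow> ('g, 'a) monoid_scheme \<Rightarrow> 'g set \<Rightarrow> ennreal" where
  "kazhdan_const TYPE('h) G S =
    (INF (H, \<pi>) \<in> {(H :: 'h hilbert, \<pi>). unitary_rep G H \<pi> \<and> invariant_vectors G H \<pi> = {\<zero>\<^bsub>H\<^esub>}}.
      INF \<xi> \<in> {\<xi> \<in> carrier H. hnorm H \<xi> = 1}.
        SUP s \<in> S. ennreal (hnorm H (\<pi> s \<xi> \<ominus>\<^bsub>H\<^esub> \<xi>)))"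

definition finite_generating_sets :: "('g, 'a) monoid_scheme \<Rightarrow> 'g set set" where
  "finite_generating_sets G = {S. finite S \<and> S \<subseteq> carrier G \<and> generate G S = carrier G}"

definition finitely_generated :: "('g, 'a) monoid_scheme \<Rightarrow> bool" where
  "finitely_generated G \<longleftrightarrow> finite_generating_sets G \<noteq> {}"

definition uniform_kazhdan_const ::
  "'h itself \<Rightarrow> ('g, 'a) monoid_scheme \<Rightarrow> ennreal" where
  "uniform_kazhdan_const TYPE('h) G =
    (INF S \<in> finite_generating_sets G. kazhdan_const TYPE('h) G S)"

definition GL :: "'f itself \<Rightarrow> nat \<Rightarrow> 'f::field mat monoid" where
  "GL TYPE('f) n = units_of (ring_mat TYPE('f) n ())"

lemma group_GL: "group (GL TYPE('f::field) n)"
  unfolding GL_def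
  by (intro monoid.units_group ring.is_monoid ring_mat)

lemma group_unitary_group:
  fixes H (structure)
  assumes "hilbert_space H"
  shows "group (unitary_group H)"
proof -
  interpret hilbert_space H by fact
  let ?B = "BijGroup (carrier H)"
  let ?U = "carrier (unitary_group H)"
  have inB: "T \<in> carrier ?B" if "T \<in> ?U" for T
    using that by (simp add: unitary_group_def BijGroup_def)
  have app: "T x \<in> carrier H" if "T \<in> Bij (carrier H)" "x \<in> carrier H" for T x
    using that by (auto simp: Bij_def bij_betw_def)
  have "subgroup ?U ?B"
  proof (rule group.subgroupI[OF group_BijGroup])
    show "?U \<subseteq> carrier ?B" using inB by blast
    have "(\<lambda>x\<in>carrier H. x) \<in> ?U"
      by (auto simp: unitary_group_def id_Bij ring_of_type_algebra_def intro!: smult_closed)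
    then show "?U \<noteq> {}" by blast
  next
    fix T assume T: "T \<in> ?U"
    then have TB: "T \<in> Bij (carrier H)"
      and add: "\<And>x y. x \<in> carrier H \<Longrightarrow> y \<in> carrier H \<Longrightarrow> T (x \<oplus> y) = T x \<oplus> T y"
      and smult: "\<And>c x. x \<in> carrier H \<Longrightarrow> T (c \<odot> x) = c \<odot> T x"
      and inprod: "\<And>x y. x \<in> carrier H \<Longrightarrow> y \<in> carrier H \<Longrightarrow> inprod H (T x) (T y) = inprod H x y"
      by (auto simp: unitary_group_def)
    define R where "R = restrict (inv_into (carrier H) T) (carrier H)"
    have RB: "R \<in> Bij (carrier H)"
      unfolding R_def by (rule restrict_inv_into_Bij[OF TB])
    have inj: "inj_on T (carrier H)" and surj: "T ` carrier H = carrier H"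
      using TB by (auto simp: Bij_def bij_betw_def)
    have R: "R x \<in> carrier H" "T (R x) = x" if "x \<in> carrier H" for x
      using that surj unfolding R_def
      by (auto simp: inv_into_into f_inv_into_f)
    have eqI: "u = v" if "u \<in> carrier H" "v \<in> carrier H" "T u = T v" for u v
      using inj that by (auto dest: inj_onD)
    have sc: "c \<odot> x \<in> carrier H" if "x \<in> carrier H" for c x
      by (rule smult_closed) (use that in \<open>auto simp: ring_of_type_algebra_def\<close>)
    have "R \<in> ?U"
      unfolding unitary_group_def
    proof (simp, intro conjI ballI allI RB)
      fix x y assume xy: "x \<in> carrier H" "y \<in> carrier H"
      show "R (x \<oplus> y) = R x \<oplus> R y"
        by (rule eqI) (use xy R add in auto)
      show "inprod H (R x) (R y) = inprod H x y"
        using inprod[of "R x" "R y"] R xy by simp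
    next
      fix c x assume x: "x \<in> carrier H"
      show "R (c \<odot> x) = c \<odot> R x"
        by (rule eqI) (use x R smult sc in auto)
    qed
    then show "inv\<^bsub>?B\<^esub> T \<in> ?U"
      by (simp add: inv_BijGroup[OF TB] R_def)
  next
    fix T T' assume T: "T \<in> ?U" "T' \<in> ?U"
    then have B: "T \<in> Bij (carrier H)" "T' \<in> Bij (carrier H)"
      by (auto simp: unitary_group_def)
    have sc: "c \<odot> x \<in> carrier H" if "x \<in> carrier H" for c x
      by (rule smult_closed) (use that in \<open>auto simp: ring_of_type_algebra_def\<close>)
    have "compose (carrier H) T T' \<in> ?U"
      using T B app[OF B(1)] app[OF B(2)] sc compose_Bij[OF B]
      by (auto simp: unitary_group_def compose_def)
    then show "T \<otimes>\<^bsub>?B\<^esub> T' \<in> ?U"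
      using B by (simp add: BijGroup_def)
  qed
  then have "group (?B\<lparr>carrier := ?U\<rparr>)"
    by (rule group.subgroup_imp_group[OF group_BijGroup])
  then show ?thesis by (simp add: unitary_group_def)
qed

end

theory Submission
  imports
    Defs
    "HOL-Algebra.Sylow"
    "HOL-Algebra.Group_Action"
    "HOL-Library.Function_Algebras"
begin

text \<open>
  If \<open>H\<^sub>1, \<dots>, H\<^sub>k\<close> are proper finite-index subgroups of \<open>\<Gamma>\<close> and every \<open>s \<in> S\<close> lies in all but at most
  one of them, then in the sum of the representations on \<open>\<ell>\<^sup>2\<^sub>0(\<Gamma> / H\<^sub>i)\<close> the normalised sum of the
  centred indicators of the base points is moved by at most \<open>2 / \<surd>k\<close> by every \<open>s \<in> S\<close>.
  Such \<open>S\<close> and \<open>H\<^sub>i\<close> arise inductively. Given a finite-index normal subgroup \<open>K\<close>, suppose that there is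
  a proper finite-index subgroup \<open>H\<close> with \<open>H K = \<Gamma>\<close>; then each generator \<open>s = h x\<close> can be replaced by
  \<open>h \<in> H\<close> and \<open>x \<in> K\<close>. By Sylow theory in a finite quotient of \<open>\<Gamma>\<close> (the Frattini argument, or a
  complement of a normal abelian Sylow subgroup), \<open>H\<close> exists as soon as some prime that does not
  divide \<open>[\<Gamma> : K]\<close> divides \<open>[K : M]\<close> for a finite-index normal subgroup \<open>M \<subseteq> K\<close> of \<open>\<Gamma>\<close>.

  Such primes come from congruence quotients of a finitely generated ring that contains the matrix
  entries. In characteristic zero, congruence subgroups modulo a prime number \<open>l\<close> are residually
  \<open>l\<close>-groups. In characteristic \<open>p\<close>, if some eigenvalue \<open>x\<close> is not a root of unity, one reduces modulo
  an ideal in which \<open>x\<close> acquires order \<open>l\<close>. Otherwise a congruence subgroup is unipotent, hence a finitely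
  generated linear \<open>p\<close>-torsion group; it is finite by a Kolchin-type argument, so \<open>\<Gamma>\<close> is finite.
\<close>

section \<open>Finite groups\<close>

text \<open>When \<Gamma> has property (T), every single generating set has a positive constant, so
  smallness can only come from varying \<open>S\<close>, with no bound on its size. The obstacle is
  the supplement \<open>H\<close>: in a finite quotient where the image of \<open>K\<close> lies in
  the Frattini subgroup, no proper \<open>H\<close> satisfies H K = \<Gamma>, as can happen along
  the powers of one prime. A prime that is new for \<open>K\<close> prevents this, because a Sylow
  subgroup of \<open>K\<close> for that prime is then a Sylow subgroup of the whole quotient. Among
  the quotients that show the prime, the one of least index in \<open>K\<close> is used; this forces
  a normal Sylow subgroup to be abelian. The constant 2/sqrt k has a simple origin: each
  \<open>s\<close> moves only one of \<open>k\<close> orthogonal blocks of squared norm 1/k, and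
  moves it by at most twice its norm. The rings come with a choice of filtrations in which a
  prescribed nonzero element is a unit. This keeps a coordinate of an eigenvector, or of a basis
  vector, nonzero after reduction to a finite quotient.\<close>

lemma (in group) inv_mult_cancel:
  assumes "x \<in> carrier G" "y \<in> carrier G"
  shows "inv x \<otimes> (x \<otimes> y) = y" "x \<otimes> (inv x \<otimes> y) = y"
  using assms by (simp_all add: m_assoc[symmetric])

lemmas (in group) word_simps = m_assoc inv_mult_group inv_mult_cancel

text \<open>An orbit that contains a non-fixed point has size dividing \<open>p ^ a\<close> and
  larger than 1, hence divisible by \<open>p\<close>. The points outside the fixed set therefore
  number a multiple of \<open>p\<close>.\<close>

lemma fixed_points_cong:
  fixes G (structure)
  assumes G: "group G" and p: "prime p" and ord: "Coset.order G = p ^ a" and E: "finite E"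
    and act: "group_action G E \<phi>"
  shows "p dvd card E \<longleftrightarrow> p dvd card {x \<in> E. \<forall>g\<in>carrier G. \<phi> g x = x}"
proof -
  interpret group_action G E \<phi> by fact
  let ?F = "{x \<in> E. \<forall>g\<in>carrier G. \<phi> g x = x}"
  let ?N = "{B \<in> orbits G E \<phi>. \<not> B \<subseteq> ?F}"
  have part: "\<Union>(orbits G E \<phi>) = E" "\<And>A C. A \<in> orbits G E \<phi> \<Longrightarrow> C \<in> orbits G E \<phi> \<Longrightarrow> A \<noteq> C \<Longrightarrow> A \<inter> C = {}"
    using partition.partition_coverture[OF orbit_partition] partition.disjoint_union[OF orbit_partition]
    by blast+
  have orb_sub: "B \<subseteq> E" if "B \<in> orbits G E \<phi>" for B using part that by blast
  have memF: "orbit G \<phi> x \<subseteq> ?F" if x: "x \<in> ?F" for x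
    using x by (auto simp: orbit_def)
  have selfo: "x \<in> orbit G \<phi> x" if "x \<in> E" for x using orbit_refl that by blast
  have un: "E - ?F = \<Union>?N"
  proof
    show "E - ?F \<subseteq> \<Union>?N"
    proof
      fix x assume x: "x \<in> E - ?F"
      then have "orbit G \<phi> x \<in> ?N" using selfo[of x] by (auto simp: orbits_def)
      then show "x \<in> \<Union>?N" using selfo[of x] x by blast
    qed
    show "\<Union>?N \<subseteq> E - ?F"
    proof
      fix y assume "y \<in> \<Union>?N"
      then obtain B where B: "B \<in> orbits G E \<phi>" "\<not> B \<subseteq> ?F" "y \<in> B" by blast
      have yE: "y \<in> E" using orb_sub B by blast
      have "B = orbit G \<phi> y"
      proof (rule ccontr)
        assume "B \<noteq> orbit G \<phi> y"
        moreover have "orbit G \<phi> y \<in> orbits G E \<phi>" using yE by (auto simp: orbits_def)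
        ultimately have "B \<inter> orbit G \<phi> y = {}" using part B by blast
        then show False using selfo[OF yE] B by blast
      qed
      then have "y \<notin> ?F" using memF[of y] B(2) by blast
      then show "y \<in> E - ?F" using yE by blast
    qed
  qed
  have dv: "p dvd card B" if B: "B \<in> ?N" for B
  proof -
    obtain x where x: "x \<in> E" "B = orbit G \<phi> x" using B by (auto simp: orbits_def)
    have "card B dvd p ^ a" using orbit_stabilizer_theorem[OF x(1)] x ord by (metis dvd_triv_left)
    then obtain b where b: "card B = p ^ b" using p by (metis divides_primepow_nat)
    have "b \<noteq> 0"
    proof
      assume "b = 0"
      then have "card B = 1" using b by simp
      then have "B = {x}" using selfo[OF x(1)] x(2) by (metis card_1_singletonE singletonD)
      then have "x \<in> ?F" using x by (auto simp: orbit_def)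
      then show False using B \<open>B = {x}\<close> by blast
    qed
    then show ?thesis using b by (simp add: dvd_power)
  qed
  have "p dvd card (\<Union>?N)"
  proof (subst card_Union_disjoint)
    show "pairwise disjnt ?N" using part(2) by (auto simp: pairwise_def disjnt_def)
    show "\<And>A. A \<in> ?N \<Longrightarrow> finite A" using orb_sub E finite_subset by blast
    show "p dvd sum card ?N" by (rule dvd_sum) (use dv in blast)
  qed
  then have d: "p dvd card (E - ?F)" using un by simp
  have "?F \<subseteq> E" by blast
  then have "card (E - ?F) = card E - card ?F" "card ?F \<le> card E"
    using E card_Diff_subset[of ?F E] card_mono[of E ?F] finite_subset[of ?F E] by blast+
  then have "card E = card ?F + card (E - ?F)" by linarith
  moreover have "p dvd card ?F + card (E - ?F) \<longleftrightarrow> p dvd card ?F" by (rule dvd_add_left_iff[OF d])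
  ultimately show ?thesis by (simp only:)
qed

text \<open>\<open>BijGroup E\<close> consists of extensional functions, hence the restriction of
  \<open>f g\<close> to \<open>E\<close> in the conclusion.\<close>

lemma group_actionI:
  fixes G (structure)
  assumes "group G"
    and "\<And>g x. g \<in> carrier G \<Longrightarrow> x \<in> E \<Longrightarrow> f g x \<in> E"
    and "\<And>g h x. g \<in> carrier G \<Longrightarrow> h \<in> carrier G \<Longrightarrow> x \<in> E \<Longrightarrow> f (g \<otimes> h) x = f g (f h x)"
    and "\<And>x. x \<in> E \<Longrightarrow> f \<one> x = x"
  shows "group_action G E (\<lambda>g. \<lambda>x\<in>E. f g x)"
proof -
  interpret group G by fact
  have inv: "f (inv g) (f g x) = x" "f g (f (inv g) x) = x" if "g \<in> carrier G" "x \<in> E" for g x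
    using assms(3)[of "inv g" g x] assms(3)[of g "inv g" x] assms(4) that by auto
  have bij: "(\<lambda>x\<in>E. f g x) \<in> Bij E" if g: "g \<in> carrier G" for g
  proof -
    have "bij_betw (f g) E E"
      by (rule bij_betw_byWitness[where f' = "f (inv g)"]) (use inv assms(2) g in auto)
    then show ?thesis by (auto simp: Bij_def intro: bij_betw_cong[THEN iffD1])
  qed
  show ?thesis
    unfolding group_action_def group_hom_def group_hom_axioms_def
  proof (intro conjI assms(1) group_BijGroup homI)
    show "\<And>g. g \<in> carrier G \<Longrightarrow> (\<lambda>x\<in>E. f g x) \<in> carrier (BijGroup E)"
      using bij by (simp add: BijGroup_def)
    show "\<And>g h. g \<in> carrier G \<Longrightarrow> h \<in> carrier G \<Longrightarrow> (\<lambda>x\<in>E. f (g \<otimes> h) x) = (\<lambda>x\<in>E. f g x) \<otimes>\<^bsub>BijGroup E\<^esub> (\<lambda>x\<in>E. f h x)"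
      using bij assms(2,3) by (auto simp: BijGroup_def compose_def fun_eq_iff)
  qed
qed

lemma fixed_points_cong':
  fixes G (structure)
  assumes G: "group G" and p: "prime p" and ord: "Coset.order G = p ^ a" and E: "finite E"
    and cl: "\<And>g x. g \<in> carrier G \<Longrightarrow> x \<in> E \<Longrightarrow> f g x \<in> E"
    and mu: "\<And>g h x. g \<in> carrier G \<Longrightarrow> h \<in> carrier G \<Longrightarrow> x \<in> E \<Longrightarrow> f (g \<otimes> h) x = f g (f h x)"
    and on: "\<And>x. x \<in> E \<Longrightarrow> f \<one> x = x"
  shows "p dvd card E \<longleftrightarrow> p dvd card {x \<in> E. \<forall>g\<in>carrier G. f g x = x}"
proof -
  have "{x \<in> E. \<forall>g\<in>carrier G. (\<lambda>x\<in>E. f g x) x = x} = {x \<in> E. \<forall>g\<in>carrier G. f g x = x}" by auto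
  then show ?thesis
    using fixed_points_cong[OF G p ord E group_actionI[OF G cl mu on]] by simp
qed

text \<open>A nontrivial element of a Sylow \<open>q\<close>-subgroup has an order that divides a
  power of \<open>q\<close> and a power of \<open>p\<close>, so no prime other than \<open>p\<close>
  divides the group order.\<close>

lemma (in group) order_prime_powerI:
  assumes fin: "finite (carrier G)" and p: "prime p"
    and tors: "\<And>g. g \<in> carrier G \<Longrightarrow> \<exists>b. g [^] (p ^ b) = \<one>"
  shows "\<exists>a. Coset.order G = p ^ a"
proof -
  have "Coset.order G > 0" using fin order_gt_0_iff_finite by blast
  have uniq: "q = p" if q: "prime q" "q dvd Coset.order G" for q
  proof -
    have nz: "Coset.order G \<noteq> 0" using \<open>Coset.order G > 0\<close> by simp
    have "q ^ multiplicity q (Coset.order G) dvd Coset.order G" by (rule multiplicity_dvd)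
    then obtain m where m: "Coset.order G = q ^ multiplicity q (Coset.order G) * m" by (rule dvdE)
    obtain H where H: "subgroup H G" "card H = q ^ multiplicity q (Coset.order G)"
      using sylow_thm[OF q(1) is_group m fin] by blast
    have "multiplicity q (Coset.order G) > 0" using q nz
      by (simp add: prime_multiplicity_gt_zero_iff)
    then have "card H > 1" using H(2) q(1) by (metis one_less_power prime_gt_1_nat)
    then have "\<not> H \<subseteq> {\<one>}" using card_mono[of "{\<one>}" H] by auto
    then obtain h where h: "h \<in> H" "h \<noteq> \<one>" by blast
    have hc: "h \<in> carrier G" by (rule subgroup.mem_carrier[OF H(1) h(1)])
    have grpH: "group (G\<lparr>carrier := H\<rparr>)" using H(1) subgroup.subgroup_is_group is_group by blast
    have "h [^]\<^bsub>G\<lparr>carrier := H\<rparr>\<^esub> Coset.order (G\<lparr>carrier := H\<rparr>) = \<one>"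
      using group.pow_order_eq_1[OF grpH, of h] h by simp
    then have "h [^] (card H) = \<one>" by (simp add: Coset.order_def nat_pow_def)
    then have 1: "ord h dvd q ^ multiplicity q (Coset.order G)" using pow_eq_id[OF hc] H by simp
    obtain b where "h [^] (p ^ b) = \<one>" using tors hc by blast
    then have 2: "ord h dvd p ^ b" using pow_eq_id[OF hc] by simp
    show "q = p"
    proof (rule ccontr)
      assume "q \<noteq> p"
      then have "coprime (q ^ multiplicity q (Coset.order G)) (p ^ b)"
        using q p by (simp add: primes_coprime)
      then have "is_unit (ord h)" using 1 2 by (rule coprime_common_divisor)
      then have "ord h = 1" by simp
      then show False using h hc ord_eq_1 by blast
    qed
  qed
  obtain k m where m: "Coset.order G = p ^ k * m" "\<not> p dvd m"
  proof (rule multiplicity_decompose'[of "Coset.order G" p])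
    show "Coset.order G \<noteq> 0" using \<open>Coset.order G > 0\<close> by simp
    show "\<not> is_unit p" using p by auto
  qed
  have "m = 1"
  proof (rule ccontr)
    assume "m \<noteq> 1"
    then obtain q where q: "prime q" "q dvd m" using prime_factor_nat by blast
    then have "q dvd Coset.order G" by (subst m(1)) simp
    then show False using uniq q m(2) by blast
  qed
  then show ?thesis using m(1) by auto
qed


text \<open>\<open>Q\<close> acts on the right cosets of \<open>P\<close> by right multiplication
  with inverses. Their number \<open>m\<close> is prime to \<open>p\<close>, so some coset P x is
  fixed, and this means that x Q x^-1 is contained in \<open>P\<close>.\<close>

lemma (in group) sylow_conjugate:
  assumes fin: "finite (carrier G)" and p: "prime p"
    and P: "subgroup P G" "card P = p ^ a" and Q: "subgroup Q G" "card Q = p ^ a"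
    and ord: "Coset.order G = p ^ a * m" and m: "\<not> p dvd m"
  shows "\<exists>k\<in>carrier G. Q = (\<lambda>x. k \<otimes> x \<otimes> inv k) ` P"
proof -
  have PG: "P \<subseteq> carrier G" and QG: "Q \<subseteq> carrier G" using P Q subgroup.subset by auto
  let ?E = "rcosets P"
  let ?f = "\<lambda>g C. C #> inv g"
  have finE: "finite ?E" using fin by (simp add: RCOSETS_def)
  have "card ?E * p ^ a = p ^ a * m" using lagrange[OF P(1)] ord P by simp
  then have "card ?E = m" using p by (simp add: prime_gt_0_nat)
  then have nd: "\<not> p dvd card ?E" using m by simp
  have gQ: "group (G\<lparr>carrier := Q\<rparr>)" using Q subgroup.subgroup_is_group is_group by blast
  have sub: "C \<subseteq> carrier G" if "C \<in> ?E" for C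
    using that rcosets_part_G[OF P(1)] by blast
  have "p dvd card ?E \<longleftrightarrow> p dvd card {C \<in> ?E. \<forall>g\<in>carrier (G\<lparr>carrier := Q\<rparr>). ?f g C = C}"
  proof (rule fixed_points_cong'[OF gQ p _ finE])
    show "Coset.order (G\<lparr>carrier := Q\<rparr>) = p ^ a" using Q by (simp add: Coset.order_def)
  next
    fix g C assume g: "g \<in> carrier (G\<lparr>carrier := Q\<rparr>)" and C: "C \<in> ?E"
    then obtain x where x: "x \<in> carrier G" "C = P #> x" by (auto simp: RCOSETS_def)
    show "C #> inv g \<in> ?E" using x g QG PG rcosetsI[OF PG, of "x \<otimes> inv g"] by (auto simp: coset_mult_assoc)
  next
    fix g h C assume "g \<in> carrier (G\<lparr>carrier := Q\<rparr>)" "h \<in> carrier (G\<lparr>carrier := Q\<rparr>)" and C: "C \<in> ?E"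
    then have "g \<in> carrier G" "h \<in> carrier G" using QG by auto
    then show "C #> inv (g \<otimes>\<^bsub>G\<lparr>carrier := Q\<rparr>\<^esub> h) = C #> inv h #> inv g"
      using sub[OF C] by (simp add: coset_mult_assoc inv_mult_group)
  next
    fix C assume C: "C \<in> ?E"
    then show "C #> inv \<one>\<^bsub>G\<lparr>carrier := Q\<rparr>\<^esub> = C" using sub by simp
  qed
  then have "\<not> p dvd card {C \<in> ?E. \<forall>g\<in>Q. ?f g C = C}" using nd by simp
  then have "{C \<in> ?E. \<forall>g\<in>Q. ?f g C = C} \<noteq> {}" by fastforce
  then obtain x where x: "x \<in> carrier G" "\<And>g. g \<in> Q \<Longrightarrow> P #> x #> inv g = P #> x"
    by (auto simp: RCOSETS_def)
  have sub2: "Q \<subseteq> (\<lambda>y. inv x \<otimes> y \<otimes> inv (inv x)) ` P"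
  proof
    fix g assume g: "g \<in> Q"
    then have gc: "g \<in> carrier G" using QG by blast
    have "P #> x = P #> x #> g"
    proof -
      have "P #> x #> inv g #> g = P #> x"
        using x(1) gc PG by (simp add: coset_mult_assoc m_assoc)
      then show ?thesis using x(2)[OF g] by simp
    qed
    moreover have "x \<otimes> g \<in> P #> x #> g"
      using rcosI[OF rcos_self[OF x(1) P(1)] r_coset_subset_G[OF PG x(1)] gc] .
    ultimately have "x \<otimes> g \<in> P #> x" by simp
    then obtain y where y: "y \<in> P" "x \<otimes> g = y \<otimes> x" by (auto simp: r_coset_def)
    then have "g = inv x \<otimes> y \<otimes> inv (inv x)"
    proof -
      have "inv x \<otimes> (x \<otimes> g) = inv x \<otimes> (y \<otimes> x)" using y by simp
      moreover have "y \<in> carrier G" using y PG by blast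
      ultimately show ?thesis using x(1) gc by (simp add: word_simps)
    qed
    then show "g \<in> (\<lambda>y. inv x \<otimes> y \<otimes> inv (inv x)) ` P" using y by blast
  qed
  have finP: "finite P" using fin PG finite_subset by blast
  have "card ((\<lambda>y. inv x \<otimes> y \<otimes> inv (inv x)) ` P) \<le> card Q"
    using card_image_le[OF finP] P Q by metis
  then have "Q = (\<lambda>y. inv x \<otimes> y \<otimes> inv (inv x)) ` P"
    using card_seteq[OF _ sub2] finP by blast
  then show ?thesis using x(1) inv_closed by blast
qed

text \<open>When \<open>P\<close> acts on itself by conjugation, the fixed points are the central
  elements. Their number is divisible by \<open>p\<close>, and \<one> is one of them.\<close>

lemma (in group) pgroup_center_nontrivial:
  assumes P: "subgroup P G" "card P = p ^ a" "a > 0" and p: "prime p"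
  shows "\<exists>z\<in>P. z \<noteq> \<one> \<and> (\<forall>g\<in>P. g \<otimes> z = z \<otimes> g)"
proof -
  have PG: "P \<subseteq> carrier G" using P subgroup.subset by auto
  have finP: "finite P" using P p by (metis card.infinite not_prime_0 power_eq_0_iff)
  have gP: "group (G\<lparr>carrier := P\<rparr>)" using P subgroup.subgroup_is_group is_group by blast
  have "p dvd card P \<longleftrightarrow> p dvd card {z \<in> P. \<forall>g\<in>carrier (G\<lparr>carrier := P\<rparr>). g \<otimes> z \<otimes> inv g = z}"
  proof (rule fixed_points_cong'[OF gP p _ finP])
    show "Coset.order (G\<lparr>carrier := P\<rparr>) = p ^ a" using P by (simp add: Coset.order_def)
    show "\<And>g x. g \<in> carrier (G\<lparr>carrier := P\<rparr>) \<Longrightarrow> x \<in> P \<Longrightarrow> g \<otimes> x \<otimes> inv g \<in> P"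
      using P by (simp add: subgroup.m_closed subgroup.m_inv_closed)
    show "\<And>g h x. g \<in> carrier (G\<lparr>carrier := P\<rparr>) \<Longrightarrow> h \<in> carrier (G\<lparr>carrier := P\<rparr>) \<Longrightarrow> x \<in> P \<Longrightarrow>
       g \<otimes>\<^bsub>G\<lparr>carrier := P\<rparr>\<^esub> h \<otimes> x \<otimes> inv (g \<otimes>\<^bsub>G\<lparr>carrier := P\<rparr>\<^esub> h) = g \<otimes> (h \<otimes> x \<otimes> inv h) \<otimes> inv g"
      using PG by (simp add: inv_mult_group m_assoc subset_iff)
    show "\<And>x. x \<in> P \<Longrightarrow> \<one>\<^bsub>G\<lparr>carrier := P\<rparr>\<^esub> \<otimes> x \<otimes> inv \<one>\<^bsub>G\<lparr>carrier := P\<rparr>\<^esub> = x"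
      using PG by (simp add: subset_iff)
  qed
  moreover have "p dvd card P" using P by (simp add: dvd_power)
  ultimately have d: "p dvd card {z \<in> P. \<forall>g\<in>P. g \<otimes> z \<otimes> inv g = z}" (is "p dvd card ?Z") by simp
  have one: "\<one> \<in> ?Z" using P(1) PG by (auto simp: subgroup.one_closed)
  have "card ?Z \<noteq> 1" using d p by (metis nat_dvd_1_iff_1 not_prime_1)
  moreover have "card ?Z = 1" if "?Z \<subseteq> {\<one>}"
  proof -
    have "?Z = {\<one>}" using that one by blast
    then show ?thesis by (simp only: card_1_singleton_iff) auto
  qed
  ultimately obtain z where z: "z \<in> P" "z \<noteq> \<one>" "\<And>g. g \<in> P \<Longrightarrow> g \<otimes> z \<otimes> inv g = z" by blast
  have "g \<otimes> z = z \<otimes> g" if "g \<in> P" for g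
  proof -
    have c: "g \<in> carrier G" "z \<in> carrier G" using z(1) that PG by auto
    have "g \<otimes> z \<otimes> inv g \<otimes> g = z \<otimes> g" using z(3)[OF that] by simp
    then show ?thesis using c by (simp add: m_assoc)
  qed
  then show ?thesis using z by blast
qed


text \<open>
  The transfer cocycle: for a transversal \<open>T\<close> of the abelian normal subgroup \<open>P\<close>,
  \<open>\<theta>(g) = \<Prod>t\<in>T. g t \<sigma>(g t)\<^sup>-\<^sup>1\<close> is a crossed homomorphism into \<open>P\<close> that restricts to the
  \<open>card T\<close>-th power map on \<open>P\<close>; its kernel is the complement.
\<close>

lemma (in group) abelian_normal_complement:
  assumes fin: "finite (carrier G)" and N: "P \<lhd> G"
    and ab: "\<And>x y. x \<in> P \<Longrightarrow> y \<in> P \<Longrightarrow> x \<otimes> y = y \<otimes> x"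
    and ord: "Coset.order G = card P * r" and cop: "coprime (card P) r" and nt: "P \<noteq> {\<one>}"
  shows "\<exists>H. subgroup H G \<and> H \<noteq> carrier G \<and> H <#> P = carrier G"
proof -
  interpret P: normal P G by fact
  have PG: "P \<subseteq> carrier G" by (rule P.subset)
  have finP: "finite P" using fin PG finite_subset by blast
  have mem: "x \<in> carrier G" if "x \<in> P" for x using that PG by blast
  define A where "A = G\<lparr>carrier := P\<rparr>"
  have grpA: "group A" unfolding A_def by (rule P.subgroup_is_group[OF is_group])
  interpret A: comm_group A
    by (rule group.group_comm_groupI[OF grpA]) (simp add: A_def ab)
  have Asimps [simp]: "carrier A = P" "x \<otimes>\<^bsub>A\<^esub> y = x \<otimes> y" "\<one>\<^bsub>A\<^esub> = \<one>" for x y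
    by (simp_all add: A_def)
  \<comment> \<open>The chosen representative depends only on the coset, not on \<open>g\<close>, so
    equal cosets have equal representatives.\<close>
  define \<sigma> where "\<sigma> g = (SOME x. x \<in> P #> g)" for g
  have \<sigma>_mem: "\<sigma> g \<in> P #> g" if "g \<in> carrier G" for g
    unfolding \<sigma>_def by (rule someI[of _ g]) (rule rcos_self[OF that P.subgroup_axioms])
  have \<sigma>c: "\<sigma> g \<in> carrier G" if "g \<in> carrier G" for g
    using \<sigma>_mem[OF that] r_coset_subset_G[OF PG that] by blast
  have \<sigma>_eq: "\<sigma> g = \<sigma> h" if "P #> g = P #> h" for g h using that by (simp add: \<sigma>_def)
  have cos\<sigma>: "P #> \<sigma> g = P #> g" if "g \<in> carrier G" for g
    using repr_independence[OF \<sigma>_mem[OF that] that P.subgroup_axioms] by simp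
  have shift: "P #> (g \<otimes> t) = g <# (P #> t)" if g: "g \<in> carrier G" and t: "t \<in> carrier G" for g t
  proof -
    have "P #> (g \<otimes> t) = (P #> g) #> t" by (rule coset_mult_assoc[OF PG g t, symmetric])
    also have "P #> g = g <# P" using P.coset_eq g by simp
    also have "(g <# P) #> t = g <# (P #> t)" by (rule coset_assoc[OF g t PG, symmetric])
    finally show ?thesis .
  qed
  define T where "T = \<sigma> ` carrier G"
  have TG: "T \<subseteq> carrier G" using \<sigma>c by (auto simp: T_def)
  have finT: "finite T" using fin by (simp add: T_def)
  have Tfix: "\<sigma> t = t" if "t \<in> T" for t
    using that by (auto simp: T_def intro!: \<sigma>_eq cos\<sigma>)
  have Tc: "t \<in> carrier G" if "t \<in> T" for t using TG that by blast
  have cardT: "card T = r"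
  proof -
    have "bij_betw (\<lambda>t. P #> t) T (rcosets P)"
    proof (rule bij_betwI')
      show "\<And>x y. x \<in> T \<Longrightarrow> y \<in> T \<Longrightarrow> (P #> x = P #> y) = (x = y)"
        using \<sigma>_eq Tfix by metis
      show "\<And>x. x \<in> T \<Longrightarrow> P #> x \<in> rcosets P" using Tc PG by (auto intro: rcosetsI)
      fix y assume "y \<in> rcosets P"
      then obtain g where g: "g \<in> carrier G" "y = P #> g" by (auto simp: RCOSETS_def)
      then have "\<sigma> g \<in> T" "y = P #> \<sigma> g" using cos\<sigma> by (auto simp: T_def)
      then show "\<exists>x\<in>T. y = P #> x" by blast
    qed
    then have "card T = card (rcosets P)" by (rule bij_betw_same_card)
    moreover have "card (rcosets P) * card P = card P * r"
      using lagrange[OF P.subgroup_axioms] ord by simp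
    moreover have "card P > 0" using finP P.one_closed card_gt_0_iff by blast
    ultimately show ?thesis by simp
  qed
  define c where "c g t = g \<otimes> t \<otimes> inv (\<sigma> (g \<otimes> t))" for g t
  have cP: "c g t \<in> P" if g: "g \<in> carrier G" and t: "t \<in> carrier G" for g t
  proof -
    have gt: "g \<otimes> t \<in> carrier G" using g t by simp
    obtain x where x: "x \<in> P" "\<sigma> (g \<otimes> t) = x \<otimes> (g \<otimes> t)"
      using \<sigma>_mem[OF gt] by (auto simp: r_coset_def)
    have "c g t = inv x"
      unfolding c_def x(2) using mem[OF x(1)] gt g t by (simp add: word_simps)
    then show ?thesis using x(1) by simp
  qed
  define \<theta> where "\<theta> g = finprod A (c g) T" for g
  have \<theta>P: "\<theta> g \<in> P" if "g \<in> carrier G" for g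
    unfolding \<theta>_def using A.finprod_closed[of "c g" T] cP that Tc by (auto simp: Pi_def)
  have conjP: "g \<otimes> x \<otimes> inv g \<in> P" if "g \<in> carrier G" "x \<in> P" for g x
    using P.inv_op_closed2 that by blast
  have conj_prod: "g \<otimes> finprod A f S \<otimes> inv g = finprod A (\<lambda>t. g \<otimes> f t \<otimes> inv g) S"
    if "g \<in> carrier G" "finite S" "f \<in> S \<rightarrow> P" for g f S
    using that(2,3)
  proof (induction S rule: finite_induct)
    case empty then show ?case using that(1) by simp
  next
    case (insert s S)
    have f: "f s \<in> P" "f \<in> S \<rightarrow> P" using insert.prems by auto
    have fp: "finprod A f S \<in> P" using A.finprod_closed[of f S] f by simp
    have "g \<otimes> finprod A f (insert s S) \<otimes> inv g = g \<otimes> (f s \<otimes> finprod A f S) \<otimes> inv g"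
      using insert.hyps f by simp
    also have "\<dots> = (g \<otimes> f s \<otimes> inv g) \<otimes> (g \<otimes> finprod A f S \<otimes> inv g)"
      using that(1) mem[OF f(1)] mem[OF fp] by (simp add: word_simps)
    also have "\<dots> = finprod A (\<lambda>t. g \<otimes> f t \<otimes> inv g) (insert s S)"
      using insert conjP[OF that(1)] f by (auto simp: Pi_def)
    finally show ?case .
  qed
  have cocycle: "\<theta> (g \<otimes> h) = (g \<otimes> \<theta> h \<otimes> inv g) \<otimes> \<theta> g" if g: "g \<in> carrier G" and h: "h \<in> carrier G" for g h
  proof -
    \<comment> \<open>Left multiplication by \<open>h\<close> permutes the cosets of the normal
      subgroup \<open>P\<close>, so \<open>?\<rho>\<close> permutes the transversal and the product
      over \<open>T\<close> can be reindexed.\<close>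
    let ?\<rho> = "\<lambda>t. \<sigma> (h \<otimes> t)"
    have inj: "inj_on ?\<rho> T"
    proof (rule inj_onI)
      fix s t assume st: "s \<in> T" "t \<in> T" and eq: "\<sigma> (h \<otimes> s) = \<sigma> (h \<otimes> t)"
      have "P #> (h \<otimes> s) = P #> (h \<otimes> t)" using cos\<sigma>[of "h \<otimes> s"] cos\<sigma>[of "h \<otimes> t"] eq h st Tc by simp
      then have "h <# (P #> s) = h <# (P #> t)"
        using shift h st Tc by simp
      then have "inv h <# (h <# (P #> s)) = inv h <# (h <# (P #> t))" by simp
      then have "P #> s = P #> t"
        using h st Tc by (simp add: lcos_m_assoc r_coset_subset_G PG lcos_mult_one)
      then show "s = t" using \<sigma>_eq Tfix st by metis
    qed
    have img: "?\<rho> ` T = T"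
    proof (rule card_subset_eq[OF finT])
      show "?\<rho> ` T \<subseteq> T" using h Tc by (auto simp: T_def)
      show "card (?\<rho> ` T) = card T" by (rule card_image[OF inj])
    qed
    have "\<theta> (g \<otimes> h) = finprod A (\<lambda>t. (g \<otimes> c h t \<otimes> inv g) \<otimes>\<^bsub>A\<^esub> c g (?\<rho> t)) T"
      unfolding \<theta>_def
    proof (rule A.finprod_cong')
      show "(\<lambda>t. (g \<otimes> c h t \<otimes> inv g) \<otimes>\<^bsub>A\<^esub> c g (?\<rho> t)) \<in> T \<rightarrow> carrier A"
        using conjP[OF g cP[OF h]] cP[OF g] Tc h \<sigma>c by simp
      fix t assume t: "t \<in> T"
      have tc: "t \<in> carrier G" "\<sigma> (h \<otimes> t) \<in> carrier G" using Tc[OF t] h \<sigma>c by auto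
      have e: "P #> (g \<otimes> \<sigma> (h \<otimes> t)) = P #> (g \<otimes> h \<otimes> t)"
      proof -
        have "P #> (g \<otimes> \<sigma> (h \<otimes> t)) = g <# (P #> (h \<otimes> t))"
          using shift[OF g tc(2)] cos\<sigma>[of "h \<otimes> t"] h tc by simp
        also have "\<dots> = P #> (g \<otimes> h \<otimes> t)" using shift[of g "h \<otimes> t"] tc g h by (simp add: m_assoc)
        finally show ?thesis .
      qed
      have "\<sigma> (g \<otimes> \<sigma> (h \<otimes> t)) = \<sigma> (g \<otimes> h \<otimes> t)" by (rule \<sigma>_eq[OF e])
      then show "c (g \<otimes> h) t = (g \<otimes> c h t \<otimes> inv g) \<otimes>\<^bsub>A\<^esub> c g (?\<rho> t)"
        using tc g h \<sigma>c by (simp add: c_def word_simps)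
    qed simp
    also have "\<dots> = finprod A (\<lambda>t. g \<otimes> c h t \<otimes> inv g) T \<otimes>\<^bsub>A\<^esub> finprod A (\<lambda>t. c g (?\<rho> t)) T"
      by (rule A.finprod_multf) (use conjP[OF g cP[OF h]] cP[OF g] Tc h \<sigma>c in auto)
    also have "finprod A (\<lambda>t. c g (?\<rho> t)) T = finprod A (c g) (?\<rho> ` T)"
      by (rule A.finprod_reindex[symmetric]) (use inj img cP[OF g] Tc in auto)
    also have "\<dots> = \<theta> g" by (simp add: img \<theta>_def)
    also have "finprod A (\<lambda>t. g \<otimes> c h t \<otimes> inv g) T = g \<otimes> \<theta> h \<otimes> inv g"
      unfolding \<theta>_def by (rule conj_prod[symmetric]) (use g finT cP[OF h] Tc in auto)
    finally show ?thesis by simp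
  qed
  have powA: "x [^]\<^bsub>A\<^esub> n = x [^] (n::nat)" for x n
    by (simp add: A_def nat_pow_def)
  have \<theta>pow: "\<theta> x = x [^] r" if x: "x \<in> P" for x
  proof -
    have "finprod A (c x) T = finprod A (\<lambda>t. x) T"
    proof (rule A.finprod_cong')
      show "(\<lambda>t. x) \<in> T \<rightarrow> carrier A" using x by simp
      fix t assume t: "t \<in> T"
      have "P #> (x \<otimes> t) = P #> t"
        using coset_mult_assoc[OF PG mem[OF x] Tc[OF t]] coset_join2[OF mem[OF x] P.subgroup_axioms x] by simp
      then have "\<sigma> (x \<otimes> t) = t" using \<sigma>_eq Tfix[OF t] by metis
      then show "c x t = x" using mem[OF x] Tc[OF t] by (simp add: c_def m_assoc)
    qed simp
    also have "\<dots> = x [^]\<^bsub>A\<^esub> card T" by (rule A.finprod_const) (use x in simp)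
    finally show ?thesis by (simp add: \<theta>_def cardT powA)
  qed
  define H where "H = {g \<in> carrier G. \<theta> g = \<one>}"
  have \<theta>1: "\<theta> \<one> = \<one>" using \<theta>pow[OF P.one_closed] by simp
  have sub: "subgroup H G"
  proof (rule subgroupI)
    show "H \<subseteq> carrier G" "H \<noteq> {}" using \<theta>1 by (auto simp: H_def)
    show "\<And>a. a \<in> H \<Longrightarrow> inv a \<in> H"
    proof -
      fix a assume a: "a \<in> H"
      then have ac: "a \<in> carrier G" "\<theta> a = \<one>" by (auto simp: H_def)
      have "a \<otimes> \<theta> (inv a) \<otimes> inv a = \<one>"
        using cocycle[OF ac(1) inv_closed[OF ac(1)]] ac \<theta>1 mem[OF \<theta>P[OF inv_closed[OF ac(1)]]] by simp
      then have "inv a \<otimes> (a \<otimes> \<theta> (inv a) \<otimes> inv a) \<otimes> a = \<one>" using ac by simp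
      then have "\<theta> (inv a) = \<one>"
        using ac mem[OF \<theta>P[OF inv_closed[OF ac(1)]]] by (simp add: word_simps)
      then show "inv a \<in> H" using ac by (simp add: H_def)
    qed
    show "\<And>a b. a \<in> H \<Longrightarrow> b \<in> H \<Longrightarrow> a \<otimes> b \<in> H"
      using cocycle by (auto simp: H_def)
  qed
  have cardpow: "x [^] card P = \<one>" if "x \<in> P" for x
  proof -
    have "x [^]\<^bsub>A\<^esub> Coset.order A = \<one>\<^bsub>A\<^esub>" by (rule A.pow_order_eq_1) (use that in simp)
    then show ?thesis by (simp add: powA Coset.order_def)
  qed
  have "H \<noteq> carrier G"
  proof
    assume H: "H = carrier G"
    \<comment> \<open>On \<open>P\<close> the map \<theta> is the \<open>r\<close>-th power, which
      sends only \<one> to \<one> because \<open>r\<close> is prime to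
      \<open>card P\<close>.\<close>
    obtain x where x: "x \<in> P" "x \<noteq> \<one>" using nt P.one_closed by blast
    have "x \<in> H" using H mem[OF x(1)] by simp
    then have "x [^] r = \<one>" using \<theta>pow[OF x(1)] by (simp add: H_def)
    then have "ord x dvd r" using pow_eq_id[OF mem[OF x(1)]] by blast
    moreover have "ord x dvd card P" using pow_eq_id[OF mem[OF x(1)]] cardpow[OF x(1)] by blast
    ultimately have "is_unit (ord x)" using cop coprime_common_divisor by blast
    then have "ord x = 1" by simp
    then show False using ord_eq_1[OF mem[OF x(1)]] x(2) by blast
  qed
  moreover have "H <#> P = carrier G"
  proof
    show "H <#> P \<subseteq> carrier G" using sub PG by (intro set_mult_closed) (auto dest: subgroup.subset)
    show "carrier G \<subseteq> H <#> P"
    proof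
      fix g assume g: "g \<in> carrier G"
      have cardP: "card P > 0" using finP P.one_closed card_gt_0_iff by blast
      have "r \<noteq> 0" using ord fin order_gt_0_iff_finite by (metis mult_0_right less_irrefl)
      \<comment> \<open>\<open>s\<close> inverts \<open>r\<close> modulo \<open>card P\<close>, so
        \<open>?y\<close> is an \<open>r\<close>-th root of \<theta>(g^-1) in \<open>P\<close>.
        Correcting g^-1 by the inverse of \<open>?y\<close> on the left puts it into the kernel;
        starting from g^-1 leaves the factor from \<open>P\<close> on the right of
        \<open>g\<close>.\<close>
      then obtain s v where s: "r * s = card P * v + 1"
        using bezout_nat[of r "card P"] cop by (metis coprime_iff_gcd_eq_1 gcd.commute)
      let ?y = "\<theta> (inv g) [^] s"
      have ig: "inv g \<in> carrier G" using g by simp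
      have yP: "?y \<in> P" using \<theta>P[OF ig] A.nat_pow_closed[of "\<theta> (inv g)" s] by (simp add: powA)
      have yc: "?y \<in> carrier G" by (rule mem[OF yP])
      have "?y [^] r = \<theta> (inv g)"
      proof -
        have tc: "\<theta> (inv g) \<in> carrier G" by (rule mem[OF \<theta>P[OF ig]])
        have "?y [^] r = \<theta> (inv g) [^] (r * s)" using tc by (simp add: nat_pow_pow mult.commute)
        also have "\<dots> = (\<theta> (inv g) [^] card P) [^] v \<otimes> \<theta> (inv g)"
          unfolding s using tc by (simp add: nat_pow_pow)
        also have "\<dots> = \<theta> (inv g)" using cardpow[OF \<theta>P[OF ig]] tc by simp
        finally show ?thesis .
      qed
      moreover have "inv ?y \<in> P" using yP by simp
      moreover have "\<theta> (inv ?y) = inv (?y [^] r)"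
        using \<theta>pow[OF \<open>inv ?y \<in> P\<close>] yc by (simp add: nat_pow_inv)
      ultimately have ty: "\<theta> (inv ?y) = inv (\<theta> (inv g))" by simp
      have "\<theta> (inv ?y \<otimes> inv g) = (inv ?y \<otimes> \<theta> (inv g) \<otimes> inv (inv ?y)) \<otimes> \<theta> (inv ?y)"
        by (rule cocycle) (use yc ig in auto)
      also have "inv ?y \<otimes> \<theta> (inv g) \<otimes> inv (inv ?y) = \<theta> (inv g)"
        using ab[OF \<open>inv ?y \<in> P\<close> \<theta>P[OF ig]] yc mem[OF \<theta>P[OF ig]] by (simp add: m_assoc)
      also have "\<theta> (inv g) \<otimes> \<theta> (inv ?y) = \<one>" using ty mem[OF \<theta>P[OF ig]] by simp
      finally have "inv ?y \<otimes> inv g \<in> H" using yc g by (simp add: H_def)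
      then have "inv (inv ?y \<otimes> inv g) \<in> H" using sub by (simp add: subgroup.m_inv_closed)
      then have "g \<otimes> ?y \<in> H" using yc g by (simp add: inv_mult_group)
      moreover have "g = (g \<otimes> ?y) \<otimes> inv ?y" using yc g by (simp add: m_assoc)
      ultimately show "g \<in> H <#> P" using \<open>inv ?y \<in> P\<close> by (auto simp: set_mult_def)
    qed
  qed
  ultimately show ?thesis using sub by blast
qed

text \<open>Let \<open>P\<close> be a Sylow \<open>p\<close>-subgroup of \<open>K\<close>. If
  \<open>P\<close> is not normal in \<open>G\<close>, its normalizer is a supplement by the Frattini
  argument. If it is normal, so is its center, which is nontrivial; by \<open>min\<close> the center
  has index prime to \<open>p\<close> in \<open>K\<close>, hence is all of \<open>P\<close>. Then
  \<open>P\<close> is abelian of order prime to its index in \<open>G\<close>, and a complement of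
  \<open>P\<close> is a supplement of \<open>K\<close>.\<close>

lemma (in group) normal_supplement:
  assumes fin: "finite (carrier G)" and K: "K \<lhd> G" and p: "prime p" and dv: "p dvd card K"
    and ord: "Coset.order G = card K * r" and nd: "\<not> p dvd r"
    and min: "\<And>N. N \<lhd> G \<Longrightarrow> N \<subseteq> K \<Longrightarrow> N \<noteq> {\<one>} \<Longrightarrow> \<not> p dvd card K div card N"
  shows "\<exists>H. subgroup H G \<and> H \<noteq> carrier G \<and> H <#> K = carrier G"
proof -
  interpret K: normal K G by fact
  have KG: "K \<subseteq> carrier G" by (rule K.subset)
  have finK: "finite K" using fin KG finite_subset by blast
  have mem: "x \<in> carrier G" if "x \<in> K" for x using that KG by blast
  have gK: "group (G\<lparr>carrier := K\<rparr>)" by (rule K.subgroup_is_group[OF is_group])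
  have "card K \<noteq> 0" using finK K.one_closed card_gt_0_iff[of K] by blast
  then obtain a m where m: "card K = p ^ a * m" "\<not> p dvd m"
    using multiplicity_decompose'[of "card K" p] not_prime_unit[of p] p by blast
  have a0: "a > 0" using m dv by (cases a) auto
  have ordK: "Coset.order (G\<lparr>carrier := K\<rparr>) = p ^ a * m" using m by (simp add: Coset.order_def)
  obtain P where P': "subgroup P (G\<lparr>carrier := K\<rparr>)" and cP: "card P = p ^ a"
    using sylow_thm[OF p gK ordK] finK by auto
  have P: "subgroup P G" by (rule incl_subgroup[OF K.subgroup_axioms P'])
  interpret P: subgroup P G by (rule P)
  have PK: "P \<subseteq> K" using subgroup.subset[OF P'] by simp
  have Pmem: "x \<in> carrier G" if "x \<in> P" for x using that PK KG by blast
  have finP: "finite P" using finK PK finite_subset by blast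
  define c where "c g = (\<lambda>x. g \<otimes> x \<otimes> inv g)" for g
  have c_mult: "c (g \<otimes> h) ` S = c g ` c h ` S" if "g \<in> carrier G" "h \<in> carrier G" "S \<subseteq> carrier G" for g h S
    unfolding image_image by (rule image_cong) (use that in \<open>auto simp: c_def word_simps subset_iff\<close>)
  have c_one: "c \<one> ` S = S" if "S \<subseteq> carrier G" for S
    using that by (force simp: c_def image_def)
  have c_sub: "c g ` S \<subseteq> carrier G" if "g \<in> carrier G" "S \<subseteq> carrier G" for g S
    using that by (auto simp: c_def)
  have PG: "P \<subseteq> carrier G" using PK KG by blast
  show ?thesis
  proof (cases "P \<lhd> G")
    case True
    interpret PN: normal P G by (rule True)
    define Z where "Z = {z \<in> P. \<forall>g\<in>P. g \<otimes> z = z \<otimes> g}"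
    have ZG: "Z \<subseteq> carrier G" using PG by (auto simp: Z_def)
    have ZP: "Z \<subseteq> P" by (auto simp: Z_def)
    have subZ: "subgroup Z G"
    proof (rule subgroupI[OF ZG])
      have "\<one> \<in> Z" using P.one_closed Pmem by (simp add: Z_def)
      then show "Z \<noteq> {}" by blast
      show "inv z \<in> Z" if z: "z \<in> Z" for z
      proof -
        have "g \<otimes> inv z = inv z \<otimes> g" if g: "g \<in> P" for g
        proof -
          have e: "g \<otimes> z = z \<otimes> g" and zc: "z \<in> carrier G" using z g ZG by (auto simp: Z_def)
          have "inv z \<otimes> (g \<otimes> z) \<otimes> inv z = inv z \<otimes> (z \<otimes> g) \<otimes> inv z" using e by simp
          then show ?thesis using zc Pmem[OF g] by (simp add: word_simps)
        qed
        then show ?thesis using z by (auto simp: Z_def)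
      qed
      show "y \<otimes> z \<in> Z" if z: "y \<in> Z" "z \<in> Z" for y z
      proof -
        have "g \<otimes> (y \<otimes> z) = y \<otimes> z \<otimes> g" if g: "g \<in> P" for g
        proof -
          have e: "g \<otimes> y = y \<otimes> g" "g \<otimes> z = z \<otimes> g" using z g by (auto simp: Z_def)
          have cc: "y \<in> carrier G" "z \<in> carrier G" "g \<in> carrier G" using z ZG Pmem[OF g] by auto
          have "g \<otimes> (y \<otimes> z) = g \<otimes> y \<otimes> z" using cc by (simp add: m_assoc)
          also have "\<dots> = y \<otimes> (g \<otimes> z)" unfolding e(1) using cc by (simp add: m_assoc)
          also have "\<dots> = y \<otimes> z \<otimes> g" unfolding e(2) using cc by (simp add: m_assoc)
          finally show ?thesis .
        qed
        moreover have "y \<otimes> z \<in> P" using z ZP by blast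
        ultimately show ?thesis by (simp add: Z_def)
      qed
    qed
    have "Z \<lhd> G"
      unfolding normal_inv_iff
    proof (intro conjI subZ ballI)
      fix x z assume x: "x \<in> carrier G" and z: "z \<in> Z"
      have zc: "z \<in> carrier G" using z ZG by blast
      have "g \<otimes> (x \<otimes> z \<otimes> inv x) = x \<otimes> z \<otimes> inv x \<otimes> g" if g: "g \<in> P" for g
      proof -
        have "inv x \<otimes> g \<otimes> x \<in> P" using PN.inv_op_closed1[OF x g] .
        then have e: "inv x \<otimes> g \<otimes> x \<otimes> z = z \<otimes> (inv x \<otimes> g \<otimes> x)" using z by (auto simp: Z_def)
        have "g \<otimes> (x \<otimes> z \<otimes> inv x) = x \<otimes> (inv x \<otimes> g \<otimes> x \<otimes> z) \<otimes> inv x"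
          using x zc Pmem[OF g] by (simp add: word_simps)
        also have "\<dots> = x \<otimes> z \<otimes> inv x \<otimes> g" unfolding e using x zc Pmem[OF g] by (simp add: word_simps)
        finally show ?thesis .
      qed
      moreover have "x \<otimes> z \<otimes> inv x \<in> P" using PN.inv_op_closed2[OF x] z by (auto simp: Z_def)
      ultimately show "x \<otimes> z \<otimes> inv x \<in> Z" by (auto simp: Z_def)
    qed
    moreover have "Z \<noteq> {\<one>}" using pgroup_center_nontrivial[OF P cP a0 p] by (auto simp: Z_def)
    ultimately have nd': "\<not> p dvd card K div card Z" using min ZP PK by blast
    have "card Z dvd p ^ a"
    proof -
      have "subgroup Z (G\<lparr>carrier := P\<rparr>)" using subgroup_incl[OF subZ P ZP] .
      then have "card (rcosets\<^bsub>G\<lparr>carrier := P\<rparr>\<^esub> Z) * card Z = card P"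
        using group.lagrange[OF P.subgroup_is_group[OF is_group]] by (simp add: Coset.order_def)
      then show ?thesis using cP by (metis dvd_triv_right)
    qed
    then obtain b where b: "b \<le> a" "card Z = p ^ b" using p by (auto simp: divides_primepow_nat)
    have "b = a"
    proof (rule ccontr)
      assume "b \<noteq> a"
      then have ab: "a = b + Suc (a - b - 1)" using b by simp
      have "card K = p ^ b * (p * p ^ (a - b - 1) * m)" unfolding m(1) by (subst ab) (simp add: power_add mult.assoc)
      then have "card K div card Z = p * p ^ (a - b - 1) * m" using b p by (simp add: prime_gt_0_nat)
      then show False using nd' by (simp add: mult.assoc)
    qed
    then have ZeqP: "Z = P" using card_subset_eq[OF finP ZP] b cP by simp
    have "\<exists>H. subgroup H G \<and> H \<noteq> carrier G \<and> H <#> P = carrier G"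
    proof (rule abelian_normal_complement[OF fin True])
      show "\<And>x y. x \<in> P \<Longrightarrow> y \<in> P \<Longrightarrow> x \<otimes> y = y \<otimes> x" using ZeqP by (auto simp: Z_def)
      show "Coset.order G = card P * (m * r)" using ord m cP by simp
      show "coprime (card P) (m * r)"
        using cP m(2) nd p by (simp add: prime_imp_coprime prime_dvd_mult_iff)
      show "P \<noteq> {\<one>}" 
      proof
        assume "P = {\<one>}"
        then have "p ^ a = 1" using cP by simp
        then show False using a0 prime_gt_1_nat[OF p] one_less_power[of p a] by simp
      qed
    qed
    then obtain H where H: "subgroup H G" "H \<noteq> carrier G" "H <#> P = carrier G" by blast
    have "H <#> K \<subseteq> carrier G" using set_mult_closed[OF subgroup.subset[OF H(1)] KG] .
    moreover have "carrier G \<subseteq> H <#> K" using mono_set_mult[of H H P K G] PK H(3) by simp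
    ultimately show ?thesis using H by blast
  next
    case False
    define H where "H = {g \<in> carrier G. c g ` P = P}"
    have sub: "subgroup H G"
    proof (rule subgroupI)
      show "H \<subseteq> carrier G" by (auto simp: H_def)
      have "\<one> \<in> H" using c_one[OF PG] by (simp add: H_def)
      then show "H \<noteq> {}" by blast
      show "inv g \<in> H" if g: "g \<in> H" for g
      proof -
        have gc: "g \<in> carrier G" "c g ` P = P" using g by (auto simp: H_def)
        have "c (inv g) ` P = c (inv g) ` c g ` P" using gc by simp
        also have "\<dots> = c (inv g \<otimes> g) ` P" by (rule c_mult[symmetric]) (use gc PG in auto)
        also have "\<dots> = P" using gc c_one[OF PG] by simp
        finally show ?thesis using gc by (simp add: H_def)
      qed
      show "g \<otimes> h \<in> H" if "g \<in> H" "h \<in> H" for g h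
        using that c_mult[of g h P] PG by (simp add: H_def)
    qed
    have "H \<noteq> carrier G"
    proof
      assume H: "H = carrier G"
      have "P \<lhd> G"
        unfolding normal_inv_iff
      proof (intro conjI P ballI)
        fix x y assume "x \<in> carrier G" and y: "y \<in> P"
        then have "c x ` P = P" using H by (auto simp: H_def)
        then have "c x y \<in> P" using y by blast
        then show "x \<otimes> y \<otimes> inv x \<in> P" by (simp add: c_def)
      qed
      then show False using False by simp
    qed
    moreover have "carrier G \<subseteq> H <#> K"
    proof
      fix g assume g: "g \<in> carrier G"
      let ?Q = "c g ` P"
      have QK: "?Q \<subseteq> K" using K.inv_op_closed2[OF g] PK by (auto simp: c_def)
      have subQ: "subgroup ?Q G"
      proof (rule subgroupI[OF c_sub[OF g PG]])
        show "?Q \<noteq> {}" using P.one_closed by blast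
        show "inv y \<in> ?Q" if y: "y \<in> ?Q" for y
        proof -
          obtain x where x: "x \<in> P" "y = c g x" using y by blast
          have "inv y = c g (inv x)" using x g Pmem by (simp add: c_def word_simps)
          then show ?thesis using x by blast
        qed
        show "y \<otimes> z \<in> ?Q" if y: "y \<in> ?Q" "z \<in> ?Q" for y z
        proof -
          obtain x w where x: "x \<in> P" "y = c g x" "w \<in> P" "z = c g w" using y by blast
          have "y \<otimes> z = c g (x \<otimes> w)" using x g Pmem by (simp add: c_def word_simps)
          then show ?thesis using x by blast
        qed
      qed
      have subQ': "subgroup ?Q (G\<lparr>carrier := K\<rparr>)" by (rule subgroup_incl[OF subQ K.subgroup_axioms QK])
      have "inj_on (c g) P"
      proof (rule inj_onI)
        fix x y assume xy: "x \<in> P" "y \<in> P" "c g x = c g y"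
        have "inv g \<otimes> c g x \<otimes> g = inv g \<otimes> c g y \<otimes> g" using xy by simp
        then show "x = y" using xy g Pmem by (simp add: c_def word_simps)
      qed
      then have "card ?Q = p ^ a" using cP by (simp add: card_image)
      then obtain k where k: "k \<in> K" "?Q = (\<lambda>x. k \<otimes> x \<otimes> inv\<^bsub>G\<lparr>carrier := K\<rparr>\<^esub> k) ` P"
        using group.sylow_conjugate[OF gK _ p P' cP subQ' _ ordK m(2)] finK by auto
      then have e: "c g ` P = c k ` P" using m_inv_consistent[OF K.subgroup_axioms k(1)] by (simp add: c_def)
      have kc: "k \<in> carrier G" using mem[OF k(1)] .
      \<comment> \<open>Both \<open>g\<close> and \<open>k\<close> carry \<open>P\<close> to the
        same Sylow subgroup of \<open>K\<close>, so \<open>h\<close> normalizes \<open>P\<close>.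
        Writing k h as h (h^-1 k h) moves the factor from \<open>K\<close> to the right.\<close>
      define h where "h = inv k \<otimes> g"
      have hc: "h \<in> carrier G" using kc g by (simp add: h_def)
      have "c h ` P = c (inv k) ` c g ` P" unfolding h_def by (rule c_mult) (use kc g PG in auto)
      also have "\<dots> = c (inv k \<otimes> k) ` P" unfolding e by (rule c_mult[symmetric]) (use kc PG in auto)
      also have "\<dots> = P" using kc c_one[OF PG] by simp
      finally have hH: "h \<in> H" using hc by (simp add: H_def)
      have "inv h \<otimes> k \<otimes> h \<in> K" by (rule K.inv_op_closed1[OF hc k(1)])
      moreover have "g = h \<otimes> (inv h \<otimes> k \<otimes> h)" using kc g hc by (simp add: word_simps) (simp add: h_def word_simps)
      ultimately show "g \<in> H <#> K" using hH by (auto simp: set_mult_def)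
    qed
    moreover have "H <#> K \<subseteq> carrier G" using set_mult_closed[OF subgroup.subset[OF sub] KG] .
    ultimately show ?thesis using sub by blast
  qed
qed

section \<open>Redundant generating sets\<close>

text \<open>For subgroups \<open>M\<close> of \<open>K\<close> this is the index of \<open>M\<close>
  in \<open>K\<close>, counted by cosets in \<open>G\<close> so that \<open>K\<close> need not be
  made a group of its own. An infinite index yields 0.\<close>

definition coset_index :: "('a, 'b) monoid_scheme \<Rightarrow> 'a set \<Rightarrow> 'a set \<Rightarrow> nat" where
  "coset_index G K M = card ((\<lambda>x. M #>\<^bsub>G\<^esub> x) ` K)"

lemma (in group) coset_eq_iff:
  assumes "subgroup M G" "x \<in> carrier G" "y \<in> carrier G"
  shows "M #> x = M #> y \<longleftrightarrow> x \<otimes> inv y \<in> M"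
proof
  assume "M #> x = M #> y"
  then have "x \<in> M #> y" using rcos_self[OF assms(2,1)] by simp
  then show "x \<otimes> inv y \<in> M" using subgroup.rcos_module_imp[OF assms(1) is_group assms(3)] by blast
next
  assume "x \<otimes> inv y \<in> M"
  then have "x \<in> M #> y" using subgroup.rcos_module_rev[OF assms(1) is_group assms(3,2)] by blast
  then show "M #> x = M #> y" using repr_independence[OF _ assms(3,1)] by simp
qed

text \<open>The cosets of \<open>M\<close> in \<open>K\<close> are sorted by the coset of
  \<open>N\<close> that contains them, and right translation by g carries those inside
  \<open>N\<close> onto those inside N g.\<close>

lemma (in group) coset_index_mult:
  assumes M: "subgroup M G" and N: "subgroup N G" and K: "subgroup K G" and MN: "M \<subseteq> N" and NK: "N \<subseteq> K"
    and fin: "finite ((\<lambda>x. M #> x) ` K)"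
  shows "coset_index G K M = coset_index G K N * coset_index G N M"
proof -
  have c: "K \<subseteq> carrier G" "N \<subseteq> carrier G" "M \<subseteq> carrier G" using M N K by (auto dest: subgroup.subset)
  let ?F = "\<lambda>D. (\<lambda>x. M #> x) ` D"
  have sub: "D \<subseteq> K" if "D \<in> (\<lambda>x. N #> x) ` K" for D
  proof -
    obtain g where g: "g \<in> K" "D = N #> g" using \<open>D \<in> (\<lambda>x. N #> x) ` K\<close> by blast
    show ?thesis unfolding g(2) r_coset_def using g(1) NK subgroup.m_closed[OF K] by auto
  qed
  have cov: "(\<lambda>x. M #> x) ` K = (\<Union>D\<in>(\<lambda>x. N #> x) ` K. ?F D)"
  proof
    show "(\<lambda>x. M #> x) ` K \<subseteq> (\<Union>D\<in>(\<lambda>x. N #> x) ` K. ?F D)"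
    proof
      fix C assume "C \<in> (\<lambda>x. M #> x) ` K"
      then obtain x where x: "x \<in> K" "C = M #> x" by blast
      have "x \<in> N #> x" using rcos_self[OF _ N] x c by blast
      then show "C \<in> (\<Union>D\<in>(\<lambda>x. N #> x) ` K. ?F D)" using x by blast
    qed
    show "(\<Union>D\<in>(\<lambda>x. N #> x) ` K. ?F D) \<subseteq> (\<lambda>x. M #> x) ` K" using sub by blast
  qed
  have fin2: "finite ((\<lambda>x. N #> x) ` K)"
  proof -
    \<comment> \<open>Every coset of \<open>N\<close> is \<open>N\<close> times a coset of
      \<open>M\<close>, so finiteness passes from \<open>M\<close> to \<open>N\<close>.\<close>
    have "(\<lambda>x. N #> x) ` K = (\<lambda>C. N <#> C) ` (\<lambda>x. M #> x) ` K"
    proof -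
      have "N <#> (M #> x) = N #> x" if "x \<in> K" for x
      proof -
        have x: "x \<in> carrier G" using that c by blast
        have "N <#> (M #> x) = N <#> (M <#> {x})" by (simp add: r_coset_eq_set_mult)
        also have "\<dots> = (N <#> M) <#> {x}" using set_mult_assoc[of N M "{x}"] c x by simp
        also have "N <#> M = N"
        proof
          show "N <#> M \<subseteq> N" using subgroup.m_closed[OF N] MN by (auto simp: set_mult_def)
          show "N \<subseteq> N <#> M"
          proof
            fix y assume "y \<in> N"
            then have "y = y \<otimes> \<one>" "y \<in> N" using c by auto
            then show "y \<in> N <#> M" using subgroup.one_closed[OF M] unfolding set_mult_def by blast
          qed
        qed
        finally show ?thesis by (simp add: r_coset_eq_set_mult)
      qed
      then show ?thesis by (simp add: image_image)
    qed
    then show ?thesis using fin by simp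
  qed
  have "card ((\<lambda>x. M #> x) ` K) = (\<Sum>D\<in>(\<lambda>x. N #> x) ` K. card (?F D))"
    unfolding cov
  proof (rule card_UN_disjoint[OF fin2])
    show "\<forall>D\<in>(\<lambda>x. N #> x) ` K. finite (?F D)"
      using finite_subset[OF image_mono[OF sub] fin] by blast
    show "\<forall>D\<in>(\<lambda>x. N #> x) ` K. \<forall>E\<in>(\<lambda>x. N #> x) ` K. D \<noteq> E \<longrightarrow> ?F D \<inter> ?F E = {}"
    proof (intro ballI impI)
      fix D E assume D: "D \<in> (\<lambda>x. N #> x) ` K" and E: "E \<in> (\<lambda>x. N #> x) ` K" and ne: "D \<noteq> E"
      obtain g h where g: "g \<in> K" "D = N #> g" and h: "h \<in> K" "E = N #> h" using D E by blast
      show "?F D \<inter> ?F E = {}"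
      proof (rule ccontr)
        assume "?F D \<inter> ?F E \<noteq> {}"
        then obtain x y where xy: "x \<in> D" "y \<in> E" "M #> x = M #> y" by blast
        have xyc: "x \<in> carrier G" "y \<in> carrier G" using xy sub D E c by blast+
        have "x \<otimes> inv y \<in> N" using xy(3) coset_eq_iff[OF M xyc] MN by blast
        then have "N #> x = N #> y" using coset_eq_iff[OF N xyc] by simp
        moreover have "N #> g = N #> x" using repr_independence[OF _ _ N] xy(1) g c by blast
        moreover have "N #> h = N #> y" using repr_independence[OF _ _ N] xy(2) h c by blast
        ultimately show False using ne g h by simp
      qed
    qed
  qed
  also have "\<dots> = (\<Sum>D\<in>(\<lambda>x. N #> x) ` K. card (?F N))"
  proof (rule sum.cong)
    fix D assume "D \<in> (\<lambda>x. N #> x) ` K"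
    then obtain g where g: "g \<in> carrier G" "D = N #> g" using c by blast
    have "?F D = (\<lambda>C. C #> g) ` ?F N"
    proof -
      have "M #> (x \<otimes> g) = M #> x #> g" if "x \<in> N" for x
        using coset_mult_assoc[OF c(3), of x g] that c g by auto
      then show ?thesis unfolding g(2) r_coset_def[of G N g] by (auto simp: image_def)
    qed
    moreover have "inj_on (\<lambda>C. C #> g) (?F N)"
    proof (rule inj_onI)
      fix C C' assume CC: "C \<in> ?F N" "C' \<in> ?F N" "C #> g = C' #> g"
      have sub: "C \<subseteq> carrier G" "C' \<subseteq> carrier G" using CC(1,2) c(2) r_coset_subset_G[OF c(3)] by blast+
      have "C #> g #> inv g = C' #> g #> inv g" using CC by simp
      then show "C = C'" using sub g by (simp add: coset_mult_assoc)
    qed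
    ultimately show "card (?F D) = card (?F N)" by (simp add: card_image)
  qed simp
  finally show ?thesis by (simp add: coset_index_def)
qed

text \<open>\<open>N\<close> is taken of least index in \<open>K\<close> among the normal subgroups
  that witness \<open>p\<close>. A nontrivial normal subgroup of G/N inside K/N has a preimage of
  smaller index in \<open>K\<close>, which by minimality no longer witnesses \<open>p\<close>; this
  is the hypothesis \<open>min\<close> of \<open>normal_supplement\<close> in G/N. The preimage of
  the supplement found there is \<open>H\<close>.\<close>

lemma (in group) finite_index_supplement:
  assumes K: "K \<lhd> G" and p: "prime p" and np: "\<not> p dvd card (rcosets K)"
    and M: "M \<lhd> G" "M \<subseteq> K" "finite (rcosets M)" "p dvd coset_index G K M"
  shows "\<exists>N H. N \<lhd> G \<and> finite (rcosets N) \<and> N \<subseteq> K \<and> subgroup H G \<and> H \<noteq> carrier G \<and> N \<subseteq> H \<and> H <#> K = carrier G"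
proof -
  define P where "P N \<longleftrightarrow> N \<lhd> G \<and> N \<subseteq> K \<and> finite (rcosets N) \<and> p dvd coset_index G K N" for N
  define N where "N = arg_min (coset_index G K) P"
  have "P M" using M by (simp add: P_def)
  then have "P N" unfolding N_def by (rule arg_min_natI)
  then have N: "N \<lhd> G" "N \<subseteq> K" "finite (rcosets N)" "p dvd coset_index G K N" by (auto simp: P_def)
  have minN: "coset_index G K N \<le> coset_index G K L" if "P L" for L
    unfolding N_def using that by (rule arg_min_nat_le)
  interpret N: normal N G by (rule N(1))
  interpret K: normal K G by (rule K)
  have KG: "K \<subseteq> carrier G" and NG: "N \<subseteq> carrier G" by (rule K.subset N.subset)+
  define Q where "Q = G Mod N"
  interpret Q: group Q unfolding Q_def by (rule N.factorgroup_is_group)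
  have cQ: "carrier Q = rcosets N" by (simp add: Q_def FactGroup_def)
  have rimg: "rcosets N = (\<lambda>x. N #> x) ` carrier G" by (auto simp: RCOSETS_def)
  have finQ: "finite (carrier Q)" using cQ N(3) by simp
  have multQ: "(N #> x) \<otimes>\<^bsub>Q\<^esub> (N #> y) = N #> (x \<otimes> y)" if "x \<in> carrier G" "y \<in> carrier G" for x y
    using N.rcos_sum[OF that] by (simp add: Q_def)
  have oneQ: "\<one>\<^bsub>Q\<^esub> = N" by (simp add: Q_def)
  have q: "group_hom G Q (\<lambda>x. N #> x)"
    unfolding group_hom_def group_hom_axioms_def
    using is_group Q.is_group N.r_coset_hom_Mod by (simp add: Q_def)
  have invQ: "inv\<^bsub>Q\<^esub> (N #> x) = N #> inv x" if "x \<in> carrier G" for x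
    by (rule group_hom.hom_inv[OF q that, symmetric])
  let ?K = "(\<lambda>x. N #> x) ` K"
  have Ksub: "?K \<lhd> Q"
    unfolding Q.normal_inv_iff
  proof (intro conjI ballI)
    show "subgroup ?K Q" by (rule group_hom.subgroup_img_is_subgroup[OF q K.subgroup_axioms])
    fix D C assume "D \<in> carrier Q" "C \<in> ?K"
    then obtain x k where x: "x \<in> carrier G" "D = N #> x" "k \<in> K" "C = N #> k"
      unfolding cQ rimg by blast
    have kc: "k \<in> carrier G" using x(3) KG by blast
    have "D \<otimes>\<^bsub>Q\<^esub> C \<otimes>\<^bsub>Q\<^esub> inv\<^bsub>Q\<^esub> D = N #> (x \<otimes> k \<otimes> inv x)"
      unfolding x(2,4) invQ[OF x(1)] multQ[OF x(1) kc] by (rule multQ) (use x(1) kc in auto)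
    then show "D \<otimes>\<^bsub>Q\<^esub> C \<otimes>\<^bsub>Q\<^esub> inv\<^bsub>Q\<^esub> D \<in> ?K" using K.inv_op_closed2[OF x(1,3)] by blast
  qed
  have finK: "finite ?K" using finQ unfolding cQ rimg by (rule finite_subset[rotated]) (use KG in blast)
  have ord: "Coset.order Q = card ?K * card (rcosets K)"
  proof -
    have "coset_index G (carrier G) N = coset_index G (carrier G) K * coset_index G K N"
      by (rule coset_index_mult[OF N.subgroup_axioms K.subgroup_axioms subgroup_self N(2) KG])
        (use N(3) rimg in simp)
    moreover have "rcosets K = (\<lambda>x. K #> x) ` carrier G" by (auto simp: RCOSETS_def)
    ultimately show ?thesis by (simp add: coset_index_def Coset.order_def cQ rimg mult.commute)
  qed
  have min': "\<not> p dvd card ?K div card L" if L: "L \<lhd> Q" "L \<subseteq> ?K" "L \<noteq> {\<one>\<^bsub>Q\<^esub>}" for L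
  proof -
    interpret L: normal L Q by (rule L(1))
    define L' where "L' = {x \<in> carrier G. N #> x \<in> L}"
    have L'G: "L' \<subseteq> carrier G" by (auto simp: L'_def)
    have subL': "subgroup L' G"
    proof (rule subgroupI[OF L'G])
      have "\<one> \<in> L'" using L.one_closed NG oneQ by (simp add: L'_def)
      then show "L' \<noteq> {}" by blast
      show "inv x \<in> L'" if "x \<in> L'" for x
        using that L.m_inv_closed[of "N #> x"] invQ[of x] by (simp add: L'_def)
      show "x \<otimes> y \<in> L'" if xy: "x \<in> L'" "y \<in> L'" for x y
      proof -
        have c: "x \<in> carrier G" "y \<in> carrier G" "N #> x \<in> L" "N #> y \<in> L" using xy by (auto simp: L'_def)
        show ?thesis using L.m_closed[OF c(3,4)] c(1,2) by (simp add: multQ L'_def)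
      qed
    qed
    have "L' \<lhd> G"
      unfolding normal_inv_iff
    proof (intro conjI ballI subL')
      fix x h assume x: "x \<in> carrier G" and h: "h \<in> L'"
      have hc: "h \<in> carrier G" "N #> h \<in> L" using h by (auto simp: L'_def)
      have "N #> x \<in> carrier Q" unfolding cQ rimg using x by blast
      from L.inv_op_closed2[OF this hc(2)]
      have "N #> (x \<otimes> h \<otimes> inv x) \<in> L" using x hc by (simp add: multQ invQ)
      then show "x \<otimes> h \<otimes> inv x \<in> L'" using x hc by (simp add: L'_def)
    qed
    moreover have NL: "N \<subseteq> L'"
    proof
      fix x assume x: "x \<in> N"
      then have "N #> x = N" using coset_join2[OF _ N.subgroup_axioms x] NG by blast
      then show "x \<in> L'" using x NG L.one_closed oneQ by (auto simp: L'_def)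
    qed
    moreover have LK: "L' \<subseteq> K"
    proof
      fix x assume x: "x \<in> L'"
      then obtain k where k: "k \<in> K" "N #> x = N #> k" "x \<in> carrier G" using L(2) by (auto simp: L'_def)
      then have "x \<otimes> inv k \<in> K" using coset_eq_iff[OF N.subgroup_axioms k(3)] KG N(2) by blast
      then have "x \<otimes> inv k \<otimes> k \<in> K" using k by simp
      then show "x \<in> K" using k KG by (simp add: m_assoc subset_iff)
    qed
    moreover have "finite (rcosets L')"
    proof -
      have "coset_index G (carrier G) N = coset_index G (carrier G) L' * coset_index G L' N"
        by (rule coset_index_mult[OF N.subgroup_axioms subL' subgroup_self NL L'G]) (use N(3) rimg in simp)
      moreover have "coset_index G (carrier G) N > 0"
        unfolding coset_index_def card_gt_0_iff using N(3) rimg one_closed by auto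
      ultimately have "coset_index G (carrier G) L' > 0" by simp
      moreover have "rcosets L' = (\<lambda>x. L' #> x) ` carrier G" by (auto simp: RCOSETS_def)
      ultimately show ?thesis by (simp add: coset_index_def card_gt_0_iff)
    qed
    moreover have img: "(\<lambda>x. N #> x) ` L' = L"
    proof
      show "(\<lambda>x. N #> x) ` L' \<subseteq> L" by (auto simp: L'_def)
      show "L \<subseteq> (\<lambda>x. N #> x) ` L'" using L(2) KG by (auto simp: L'_def)
    qed
    have mul: "card ?K = coset_index G K L' * card L"
    proof -
      have "coset_index G K N = coset_index G K L' * coset_index G L' N"
        by (rule coset_index_mult[OF N.subgroup_axioms subL' K.subgroup_axioms NL LK finK])
      then show ?thesis by (simp add: coset_index_def img)
    qed
    have finL: "finite L" using finK L(2) finite_subset by blast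
    have "card L > 1"
    proof -
      have "card L > 0" using finL L.one_closed card_gt_0_iff by blast
      moreover have "card L \<noteq> 1"
      proof
        assume "card L = 1"
        then obtain a where "L = {a}" by (rule card_1_singletonE)
        then show False using L(3) L.one_closed by simp
      qed
      ultimately show ?thesis by simp
    qed
    have "card ?K > 0" using finK K.one_closed card_gt_0_iff by blast
    then have "coset_index G K L' < card ?K" using mul \<open>card L > 1\<close> by simp
    then have "\<not> P L'" using minN[of L'] by (auto simp: coset_index_def)
    then have "\<not> p dvd coset_index G K L'" using calculation by (simp add: P_def)
    moreover have "card ?K div card L = coset_index G K L'" using mul \<open>card L > 1\<close> by simp
    ultimately show ?thesis by simp
  qed
  have dv: "p dvd card ?K" using N(4) by (simp add: coset_index_def)
  obtain H where H: "subgroup H Q" "H \<noteq> carrier Q" "H <#>\<^bsub>Q\<^esub> ?K = carrier Q"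
    using Q.normal_supplement[OF finQ Ksub p dv ord np min'] by blast
  define H' where "H' = {x \<in> carrier G. N #> x \<in> H}"
  have H'G: "H' \<subseteq> carrier G" by (auto simp: H'_def)
  have subH': "subgroup H' G"
  proof (rule subgroupI[OF H'G])
    have "\<one> \<in> H'" using subgroup.one_closed[OF H(1)] NG oneQ by (simp add: H'_def)
    then show "H' \<noteq> {}" by blast
    show "inv x \<in> H'" if "x \<in> H'" for x
      using that subgroup.m_inv_closed[OF H(1), of "N #> x"] invQ[of x] by (simp add: H'_def)
    show "x \<otimes> y \<in> H'" if xy: "x \<in> H'" "y \<in> H'" for x y
    proof -
      have c: "x \<in> carrier G" "y \<in> carrier G" "N #> x \<in> H" "N #> y \<in> H" using xy by (auto simp: H'_def)
      show ?thesis using subgroup.m_closed[OF H(1) c(3,4)] c(1,2) by (simp add: multQ H'_def)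
    qed
  qed
  have "N \<subseteq> H'"
  proof
    fix x assume x: "x \<in> N"
    then have "N #> x = N" using coset_join2[OF _ N.subgroup_axioms x] NG by blast
    then show "x \<in> H'" using x NG subgroup.one_closed[OF H(1)] oneQ by (auto simp: H'_def)
  qed
  moreover have "H' \<noteq> carrier G"
  proof
    assume "H' = carrier G"
    then have "carrier Q \<subseteq> H" unfolding cQ rimg by (auto simp: H'_def)
    then show False using H(2) subgroup.subset[OF H(1)] by blast
  qed
  moreover have "H' <#> K = carrier G"
  proof
    show "H' <#> K \<subseteq> carrier G" by (rule set_mult_closed[OF H'G KG])
    show "carrier G \<subseteq> H' <#> K"
    proof
      fix g assume g: "g \<in> carrier G"
      then have "N #> g \<in> H <#>\<^bsub>Q\<^esub> ?K" unfolding H(3) cQ rimg by blast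
      then obtain h k where h: "h \<in> H" "k \<in> K" "N #> g = h \<otimes>\<^bsub>Q\<^esub> (N #> k)" unfolding set_mult_def by blast
      have kc: "k \<in> carrier G" using h KG by blast
      have "h \<in> carrier Q" using h subgroup.subset[OF H(1)] by blast
      then obtain x where x: "x \<in> carrier G" "h = N #> x" unfolding cQ rimg by blast
      have "N #> (g \<otimes> inv k) = (N #> g) \<otimes>\<^bsub>Q\<^esub> (N #> inv k)" using g kc by (simp add: multQ)
      also have "\<dots> = N #> x" unfolding h(3) x(2) using x(1) kc by (simp add: multQ m_assoc)
      finally have "g \<otimes> inv k \<in> H'" using h(1) x g kc by (simp add: H'_def)
      moreover have "g = g \<otimes> inv k \<otimes> k" using g kc by (simp add: m_assoc)
      ultimately show "g \<in> H' <#> K" using h(2) unfolding set_mult_def by blast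
    qed
  qed
  ultimately show ?thesis using N subH' by blast
qed

text \<open>In the induction step a generator \<open>s\<close> is split as
  \<open>l \<otimes> y\<close> with \<open>l\<close> in the new subgroup and \<open>y\<close> in
  \<open>K\<close>. Since \<open>K\<close> lies in all earlier \<open>H i\<close>, \<open>y\<close>
  can only miss the new one, and \<open>l\<close> belongs to the same earlier \<open>H i\<close> as
  \<open>s\<close>. The exceptional index \<open>j\<close> may be at least \<open>k\<close>, which
  covers elements without an exception. The \<open>N\<close> of \<open>step\<close> lies in the new
  subgroup and in \<open>K\<close>, so it takes the place of \<open>K\<close> in the next
  round.\<close>

lemma (in group) redundant_generators:
  assumes step: "\<And>K. K \<lhd> G \<Longrightarrow> finite (rcosets K) \<Longrightarrow> \<exists>N H. N \<lhd> G \<and> finite (rcosets N) \<and> N \<subseteq> K \<and>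
      subgroup H G \<and> H \<noteq> carrier G \<and> N \<subseteq> H \<and> H <#> K = carrier G"
    and fg: "finite S0" "S0 \<subseteq> carrier G" "generate G S0 = carrier G"
  shows "\<exists>S H K. finite S \<and> S \<subseteq> carrier G \<and> generate G S = carrier G \<and> K \<lhd> G \<and> finite (rcosets K) \<and>
    (\<forall>i<(k::nat). subgroup (H i) G \<and> H i \<noteq> carrier G \<and> K \<subseteq> H i) \<and> (\<forall>s\<in>S. \<exists>j. \<forall>i<k. i \<noteq> j \<longrightarrow> s \<in> H i)"
proof (induction k)
  case 0
  have "carrier G \<lhd> G" unfolding normal_inv_iff using subgroup_self by simp
  moreover have "rcosets (carrier G) \<subseteq> {carrier G}"
    unfolding RCOSETS_def using coset_join2[OF _ subgroup_self] by auto
  then have "finite (rcosets (carrier G))" using finite_subset by blast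
  ultimately show ?case using fg by (intro exI[of _ S0] exI[of _ "\<lambda>_. {}"] exI[of _ "carrier G"]) auto
next
  case (Suc k)
  then obtain S H K where *: "finite S" "S \<subseteq> carrier G" "generate G S = carrier G" "K \<lhd> G" "finite (rcosets K)"
    "\<And>i. i < k \<Longrightarrow> subgroup (H i) G" "\<And>i. i < k \<Longrightarrow> H i \<noteq> carrier G" "\<And>i. i < k \<Longrightarrow> K \<subseteq> H i"
    "\<And>s. s \<in> S \<Longrightarrow> \<exists>j. \<forall>i<k. i \<noteq> j \<longrightarrow> s \<in> H i" by blast
  obtain N L where L: "N \<lhd> G" "finite (rcosets N)" "N \<subseteq> K" "subgroup L G" "L \<noteq> carrier G" "N \<subseteq> L" "L <#> K = carrier G"
    using step[OF *(4,5)] by blast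
  interpret K: normal K G by (rule *(4))
  have LG: "L \<subseteq> carrier G" and KG: "K \<subseteq> carrier G" using subgroup.subset[OF L(4)] K.subset by auto
  have "\<forall>s\<in>S. \<exists>l y. l \<in> L \<and> y \<in> K \<and> s = l \<otimes> y"
  proof
    fix s assume "s \<in> S"
    then have "s \<in> L <#> K" using *(2) L(7) by blast
    then show "\<exists>l y. l \<in> L \<and> y \<in> K \<and> s = l \<otimes> y" unfolding set_mult_def by blast
  qed
  then obtain l y where ly: "\<And>s. s \<in> S \<Longrightarrow> l s \<in> L" "\<And>s. s \<in> S \<Longrightarrow> y s \<in> K" "\<And>s. s \<in> S \<Longrightarrow> s = l s \<otimes> y s"
    by metis
  define S' where "S' = l ` S \<union> y ` S"
  define H' where "H' i = (if i = k then L else H i)" for i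
  have S'G: "S' \<subseteq> carrier G" using ly(1,2) LG KG by (auto simp: S'_def)
  have "S \<subseteq> generate G S'"
  proof
    fix s assume s: "s \<in> S"
    have "l s \<in> generate G S'" "y s \<in> generate G S'" using s by (auto simp: S'_def intro: generate.incl)
    then have "l s \<otimes> y s \<in> generate G S'" by (rule generate.eng)
    then show "s \<in> generate G S'" using ly(3)[OF s] by simp
  qed
  then have "generate G S \<subseteq> generate G S'" by (rule generate_subgroup_incl[OF _ generate_is_subgroup[OF S'G]])
  then have gen: "generate G S' = carrier G" using *(3) generate_incl[OF S'G] by blast
  have "\<exists>j. \<forall>i<Suc k. i \<noteq> j \<longrightarrow> s \<in> H' i" if s: "s \<in> S'" for s
    using s unfolding S'_def
  proof
    assume "s \<in> y ` S"
    then have "s \<in> K" using ly(2) by blast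
    then have "\<forall>i<Suc k. i \<noteq> k \<longrightarrow> s \<in> H' i" using *(8) by (auto simp: H'_def less_Suc_eq)
    then show ?thesis by blast
  next
    assume "s \<in> l ` S"
    then obtain u where u: "u \<in> S" "s = l u" by blast
    obtain j where j: "\<forall>i<k. i \<noteq> j \<longrightarrow> u \<in> H i" using *(9)[OF u(1)] by blast
    have "s \<in> H' i" if i: "i < Suc k" "i \<noteq> j" for i
    proof (cases "i = k")
      case True then show ?thesis using ly(1)[OF u(1)] u by (simp add: H'_def)
    next
      case False
      then have ik: "i < k" using i by simp
      have "u \<in> H i" "y u \<in> H i" using j ik i(2) ly(2)[OF u(1)] *(8)[OF ik] by auto
      then have "u \<otimes> inv (y u) \<in> H i" using *(6)[OF ik] by (simp add: subgroup.m_closed subgroup.m_inv_closed)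
      moreover have "u \<otimes> inv (y u) = s"
      proof -
        have c: "l u \<in> carrier G" "y u \<in> carrier G" using ly(1,2)[OF u(1)] LG KG by auto
        have "u \<otimes> inv (y u) = (l u \<otimes> y u) \<otimes> inv (y u)" using ly(3)[OF u(1)] by simp
        also have "\<dots> = l u" using c by (simp add: m_assoc)
        finally show ?thesis using u(2) by simp
      qed
      ultimately show ?thesis using False by (simp add: H'_def)
    qed
    then show ?thesis by blast
  qed
  moreover have "\<forall>i<Suc k. subgroup (H' i) G \<and> H' i \<noteq> carrier G \<and> N \<subseteq> H' i"
  proof (intro allI impI)
    fix i assume i: "i < Suc k"
    show "subgroup (H' i) G \<and> H' i \<noteq> carrier G \<and> N \<subseteq> H' i"
    proof (cases "i = k")
      case True then show ?thesis using L by (simp add: H'_def)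
    next
      case False
      then have "i < k" using i by simp
      then show ?thesis using *(6-8)[of i] L(3) False by (auto simp: H'_def)
    qed
  qed
  moreover have "finite S'" using *(1) by (simp add: S'_def)
  ultimately show ?case using S'G gen L(1,2) by blast
qed

section \<open>Quasi-regular representations\<close>

text \<open>A space of functions with finite support, carried into the type \<open>'h\<close> by an
  injection, because the Kazhdan constant only ranges over Hilbert spaces inside that type.
  Completeness is deduced from closure under pointwise limits, \<open>lim\<close>.\<close>

locale function_space =
  fixes E :: "('x \<Rightarrow> complex) set" and Y :: "'x set" and \<phi> :: "('x \<Rightarrow> complex) \<Rightarrow> 'h"
  assumes fin: "finite Y"
    and supp: "\<And>f x. f \<in> E \<Longrightarrow> x \<notin> Y \<Longrightarrow> f x = 0"
    and zero: "(\<lambda>_. 0) \<in> E"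
    and add: "\<And>f g. f \<in> E \<Longrightarrow> g \<in> E \<Longrightarrow> (\<lambda>x. f x + g x) \<in> E"
    and smult: "\<And>c f. f \<in> E \<Longrightarrow> (\<lambda>x. c * f x) \<in> E"
    and lim: "\<And>F f. (\<And>n. F n \<in> E) \<Longrightarrow> (\<And>x. (\<lambda>n. F n x) \<longlonglongrightarrow> f x) \<Longrightarrow> f \<in> E"
    and inj: "inj_on \<phi> E"
begin

text \<open>
  Extending the inverse of \<open>\<phi>\<close> by zero makes the distance of the transported structure symmetric on
  the whole type, as required by the locale \<^locale>\<open>Metric_space\<close>.
\<close>

definition coords :: "'h \<Rightarrow> 'x \<Rightarrow> complex" where
  "coords a = (if a \<in> \<phi> ` E then inv_into E \<phi> a else (\<lambda>_. 0))"

definition space :: "'h hilbert" where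
  "space = \<lparr>carrier = \<phi> ` E, monoid.mult = (\<lambda>a b. a), one = \<phi> (\<lambda>_. 0), ring.zero = \<phi> (\<lambda>_. 0),
     ring.add = (\<lambda>a b. \<phi> (\<lambda>x. coords a x + coords b x)),
     module.smult = (\<lambda>c a. \<phi> (\<lambda>x. c * coords a x)),
     inprod = (\<lambda>a b. \<Sum>x\<in>Y. coords a x * cnj (coords b x))\<rparr>"

lemma coords_phi [simp]: "f \<in> E \<Longrightarrow> coords (\<phi> f) = f"
  using inj by (simp add: coords_def)

lemma coords_in [simp]: "coords a \<in> E"
  using zero inv_into_into[of a \<phi> E] by (auto simp: coords_def)

lemma phi_coords: "a \<in> \<phi> ` E \<Longrightarrow> \<phi> (coords a) = a"
  by (simp add: coords_def f_inv_into_f)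

lemma phi_eq_iff: "f \<in> E \<Longrightarrow> g \<in> E \<Longrightarrow> \<phi> f = \<phi> g \<longleftrightarrow> f = g"
  using inj by (auto dest: inj_onD)

lemma uminus_in: "f \<in> E \<Longrightarrow> (\<lambda>x. - f x) \<in> E"
  using smult[of f "-1"] by simp

lemma diff_in: "f \<in> E \<Longrightarrow> g \<in> E \<Longrightarrow> (\<lambda>x. f x - g x) \<in> E"
  using add[of f "\<lambda>x. - g x"] uminus_in by simp

lemma space_simps [simp]:
  "carrier space = \<phi> ` E"
  "\<zero>\<^bsub>space\<^esub> = \<phi> (\<lambda>_. 0)"
  "a \<oplus>\<^bsub>space\<^esub> b = \<phi> (\<lambda>x. coords a x + coords b x)"
  "c \<odot>\<^bsub>space\<^esub> a = \<phi> (\<lambda>x. c * coords a x)"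
  "inprod space a b = (\<Sum>x\<in>Y. coords a x * cnj (coords b x))"
  by (simp_all add: space_def)

lemma abelian_group_space: "abelian_group space"
proof (rule abelian_groupI)
  show "\<And>x. x \<in> carrier space \<Longrightarrow> \<exists>y\<in>carrier space. y \<oplus>\<^bsub>space\<^esub> x = \<zero>\<^bsub>space\<^esub>"
  proof -
    fix a assume "a \<in> carrier space"
    have "\<phi> (\<lambda>x. - coords a x) \<in> carrier space" by (simp add: uminus_in)
    moreover have "\<phi> (\<lambda>x. - coords a x) \<oplus>\<^bsub>space\<^esub> a = \<zero>\<^bsub>space\<^esub>" by (simp add: uminus_in)
    ultimately show "\<exists>y\<in>carrier space. y \<oplus>\<^bsub>space\<^esub> a = \<zero>\<^bsub>space\<^esub>" by blast
  qed
qed (auto simp: add zero algebra_simps)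

text \<open>Since \<open>coords\<close> is defined on the whole type, the formula holds for
  arbitrary \<open>a\<close> and \<open>b\<close>; this yields the symmetry of the distance outside
  the carrier as well.\<close>

lemma a_minus_space: "a \<ominus>\<^bsub>space\<^esub> b = \<phi> (\<lambda>x. coords a x - coords b x)"
proof -
  have "\<ominus>\<^bsub>space\<^esub> b = \<phi> (\<lambda>x. - coords b x)"
    unfolding a_inv_def m_inv_def
  proof (rule the_equality)
    show "\<phi> (\<lambda>x. - coords b x) \<in> carrier (add_monoid space) \<and>
      b \<otimes>\<^bsub>add_monoid space\<^esub> \<phi> (\<lambda>x. - coords b x) = \<one>\<^bsub>add_monoid space\<^esub> \<and>
      \<phi> (\<lambda>x. - coords b x) \<otimes>\<^bsub>add_monoid space\<^esub> b = \<one>\<^bsub>add_monoid space\<^esub>"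
      by (simp add: uminus_in)
    fix y assume y: "y \<in> carrier (add_monoid space) \<and>
      b \<otimes>\<^bsub>add_monoid space\<^esub> y = \<one>\<^bsub>add_monoid space\<^esub> \<and> y \<otimes>\<^bsub>add_monoid space\<^esub> b = \<one>\<^bsub>add_monoid space\<^esub>"
    then obtain g where g: "g \<in> E" "y = \<phi> g" by auto
    have "\<phi> (\<lambda>x. coords b x + g x) = \<phi> (\<lambda>_. 0)" using y g by simp
    then have "(\<lambda>x. coords b x + g x) = (\<lambda>_. 0)" using phi_eq_iff add zero g coords_in by blast
    then have "g x = - coords b x" for x by (metis add.commute add_eq_0_iff)
    then show "y = \<phi> (\<lambda>x. - coords b x)" using g by (simp add: fun_eq_iff) metis
  qed
  then show ?thesis by (simp add: a_minus_def uminus_in)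
qed

lemma hnorm_space: "hnorm space a = L2_set (\<lambda>x. cmod (coords a x)) Y"
  unfolding hnorm_def L2_set_def
  by (simp add: complex_mult_cnj cmod_power2)

lemma coords_eqI:
  assumes "a \<in> \<phi> ` E" "b \<in> \<phi> ` E" "\<And>x. x \<in> Y \<Longrightarrow> coords a x = coords b x"
  shows "a = b"
proof -
  have "coords a = coords b"
    using assms(3) supp coords_in by (metis (no_types) ext)
  then show ?thesis using assms(1,2) phi_coords by metis
qed

lemma Metric_space_space: "Metric_space (carrier space) (\<lambda>x y. hnorm space (x \<ominus>\<^bsub>space\<^esub> y))"
proof -
  have d: "hnorm space (a \<ominus>\<^bsub>space\<^esub> b) = L2_set (\<lambda>x. cmod (coords a x - coords b x)) Y" for a b
    by (simp add: hnorm_space a_minus_space diff_in)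
  show ?thesis
    unfolding d
  proof
    show "\<And>x y. 0 \<le> L2_set (\<lambda>z. cmod (coords x z - coords y z)) Y" by simp
    show "\<And>x y. L2_set (\<lambda>z. cmod (coords x z - coords y z)) Y = L2_set (\<lambda>z. cmod (coords y z - coords x z)) Y"
      by (simp add: norm_minus_commute)
    show "(L2_set (\<lambda>z. cmod (coords x z - coords y z)) Y = 0) = (x = y)"
      if "x \<in> carrier space" "y \<in> carrier space" for x y
      using that coords_eqI[of x y] fin by (auto simp: L2_set_eq_0_iff)
    show "L2_set (\<lambda>x. cmod (coords a x - coords c x)) Y
      \<le> L2_set (\<lambda>x. cmod (coords a x - coords b x)) Y + L2_set (\<lambda>x. cmod (coords b x - coords c x)) Y" for a b c
    proof -
      have "L2_set (\<lambda>x. cmod (coords a x - coords c x)) Y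
        \<le> L2_set (\<lambda>x. cmod (coords a x - coords b x) + cmod (coords b x - coords c x)) Y"
        by (rule L2_set_mono) (use norm_triangle_ineq[of "coords a x - coords b x" "coords b x - coords c x" for x] in auto)
      also have "\<dots> \<le> L2_set (\<lambda>x. cmod (coords a x - coords b x)) Y + L2_set (\<lambda>x. cmod (coords b x - coords c x)) Y"
        by (rule L2_set_triangle_ineq)
      finally show ?thesis .
    qed
  qed
qed

text \<open>Each coordinate of a Cauchy sequence is Cauchy, \<open>lim\<close> puts the pointwise
  limit into \<open>E\<close>, and over the finite set \<open>Y\<close> pointwise convergence is
  convergence in norm.\<close>

lemma mcomplete_space: "Metric_space.mcomplete (carrier space) (\<lambda>x y. hnorm space (x \<ominus>\<^bsub>space\<^esub> y))"
proof -
  interpret M: Metric_space "carrier space" "\<lambda>x y. hnorm space (x \<ominus>\<^bsub>space\<^esub> y)" by (rule Metric_space_space)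
  have d: "hnorm space (a \<ominus>\<^bsub>space\<^esub> b) = L2_set (\<lambda>x. cmod (coords a x - coords b x)) Y" for a b
    by (simp add: hnorm_space a_minus_space diff_in)
  show ?thesis
    unfolding M.mcomplete_def
  proof (intro allI impI)
    fix \<sigma> assume C: "M.MCauchy \<sigma>"
    have \<sigma>: "\<And>n. \<sigma> n \<in> \<phi> ` E" using C unfolding M.MCauchy_def by auto
    have cau: "\<And>\<epsilon>. \<epsilon> > 0 \<Longrightarrow> \<exists>N. \<forall>n n'. N \<le> n \<longrightarrow> N \<le> n' \<longrightarrow>
        L2_set (\<lambda>x. cmod (coords (\<sigma> n) x - coords (\<sigma> n') x)) Y < \<epsilon>"
      using C unfolding M.MCauchy_def unfolding d by blast
    have "\<exists>l. (\<lambda>n. coords (\<sigma> n) x) \<longlonglongrightarrow> l" for x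
    proof (cases "x \<in> Y")
      case True
      have "Cauchy (\<lambda>n. coords (\<sigma> n) x)"
      proof (rule metric_CauchyI)
        fix e :: real assume "e > 0"
        then obtain N where N: "\<And>n n'. N \<le> n \<Longrightarrow> N \<le> n' \<Longrightarrow> L2_set (\<lambda>x. cmod (coords (\<sigma> n) x - coords (\<sigma> n') x)) Y < e"
          using cau by blast
        have "dist (coords (\<sigma> m) x) (coords (\<sigma> n) x) < e" if "m \<ge> N" "n \<ge> N" for m n
          using member_le_L2_set[OF fin True, of "\<lambda>x. cmod (coords (\<sigma> m) x - coords (\<sigma> n) x)"] N[OF that]
          by (simp add: dist_norm)
        then show "\<exists>M. \<forall>m\<ge>M. \<forall>n\<ge>M. dist (coords (\<sigma> m) x) (coords (\<sigma> n) x) < e" by blast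
      qed
      then show ?thesis using Cauchy_convergent convergent_def by blast
    next
      case False
      then have "(\<lambda>n. coords (\<sigma> n) x) = (\<lambda>n. 0)" using supp coords_in by blast
      then show ?thesis by auto
    qed
    then obtain f where f: "\<And>x. (\<lambda>n. coords (\<sigma> n) x) \<longlonglongrightarrow> f x" by metis
    have fE: "f \<in> E" by (rule lim[of "\<lambda>n. coords (\<sigma> n)"]) (simp_all add: f)
    have "(\<lambda>n. L2_set (\<lambda>x. cmod (coords (\<sigma> n) x - f x)) Y) \<longlonglongrightarrow> sqrt (\<Sum>x\<in>Y. (cmod (f x - f x))\<^sup>2)"
      unfolding L2_set_def by (intro tendsto_intros f)
    then have "(\<lambda>n. L2_set (\<lambda>x. cmod (coords (\<sigma> n) x - f x)) Y) \<longlonglongrightarrow> 0" by simp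
    then have "(\<lambda>n. hnorm space (\<sigma> n \<ominus>\<^bsub>space\<^esub> \<phi> f)) \<longlonglongrightarrow> 0" by (simp add: d fE)
    then have "\<exists>N. \<forall>n\<ge>N. hnorm space (\<sigma> n \<ominus>\<^bsub>space\<^esub> \<phi> f) < e" if "e > 0" for e
      using that unfolding LIMSEQ_def dist_real_def by (metis abs_less_iff diff_zero)
    then have "limitin M.mtopology \<sigma> (\<phi> f) sequentially"
      unfolding M.limit_metric_sequentially using fE \<sigma> by simp
    then show "\<exists>x. limitin M.mtopology \<sigma> x sequentially" by blast
  qed
qed

lemma hilbert_space_space: "hilbert_space space"
  unfolding hilbert_space_def hilbert_space_axioms_def
proof (intro conjI allI impI mcomplete_space)
  show "module ring_of_type_algebra space"
    by (rule moduleI[OF cring_from_type_algebra abelian_group_space])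
      (auto simp: ring_of_type_algebra_def add smult algebra_simps phi_coords)
  fix a b c assume "a \<in> carrier space" "b \<in> carrier space" "c \<in> carrier space"
  show "inprod space (a \<oplus>\<^bsub>space\<^esub> b) c = inprod space a c + inprod space b c"
    by (simp add: add sum.distrib algebra_simps)
next
  fix a b c assume "a \<in> carrier space" "b \<in> carrier space"
  show "inprod space (c \<odot>\<^bsub>space\<^esub> a) b = c * inprod space a b"
    by (simp add: smult sum_distrib_left algebra_simps)
next
  fix a b assume "a \<in> carrier space" "b \<in> carrier space"
  show "inprod space b a = cnj (inprod space a b)" by (simp add: mult.commute)
next
  fix a assume a: "a \<in> carrier space"
  have "Re (inprod space a a) = (\<Sum>x\<in>Y. (cmod (coords a x))\<^sup>2)"
    by (simp add: complex_mult_cnj cmod_power2)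
  moreover have "0 \<le> (\<Sum>x\<in>Y. (cmod (coords a x))\<^sup>2)" by (rule sum_nonneg) simp
  ultimately show "0 \<le> Re (inprod space a a)" by simp
  assume 0: "inprod space a a = 0"
  then have "(\<Sum>x\<in>Y. (cmod (coords a x))\<^sup>2) = 0"
    using \<open>Re (inprod space a a) = _\<close> by simp
  then have "\<forall>x\<in>Y. coords a x = 0" using fin by (simp add: sum_nonneg_eq_0_iff)
  then show "a = \<zero>\<^bsub>space\<^esub>" using a coords_eqI[of a "\<phi> (\<lambda>_. 0)"] zero by simp
qed

end

locale function_rep = function_space E Y \<phi> + group G
  for E :: "('x \<Rightarrow> complex) set" and Y and \<phi> :: "('x \<Rightarrow> complex) \<Rightarrow> 'h" and G :: "('g, 'b) monoid_scheme" (structure) +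
  fixes p :: "'g \<Rightarrow> 'x \<Rightarrow> 'x"
  assumes p_mult: "\<And>g h x. g \<in> carrier G \<Longrightarrow> h \<in> carrier G \<Longrightarrow> x \<in> Y \<Longrightarrow> p (g \<otimes> h) x = p g (p h x)"
    and p_one: "\<And>x. x \<in> Y \<Longrightarrow> p \<one> x = x"
    and p_in: "\<And>g x. g \<in> carrier G \<Longrightarrow> x \<in> Y \<Longrightarrow> p g x \<in> Y"
    and E_inv: "\<And>g f. g \<in> carrier G \<Longrightarrow> f \<in> E \<Longrightarrow> (\<lambda>x. if x \<in> Y then f (p g x) else 0) \<in> E"
begin

text \<open>The inverse turns the action on points into a left action on functions; the value 0
  keeps supports inside \<open>Y\<close>.\<close>

definition act :: "'g \<Rightarrow> ('x \<Rightarrow> complex) \<Rightarrow> 'x \<Rightarrow> complex" where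
  "act g f = (\<lambda>x. if x \<in> Y then f (p (inv g) x) else 0)"

definition rep :: "'g \<Rightarrow> 'h \<Rightarrow> 'h" where
  "rep g = (\<lambda>a\<in>\<phi> ` E. \<phi> (act g (coords a)))"

lemma act_in: "g \<in> carrier G \<Longrightarrow> f \<in> E \<Longrightarrow> act g f \<in> E"
  unfolding act_def by (rule E_inv) auto

lemma act_mult:
  assumes "g \<in> carrier G" "h \<in> carrier G"
  shows "act (g \<otimes> h) f = act g (act h f)"
  using assms by (auto simp: act_def fun_eq_iff inv_mult_group p_mult p_in)

lemma act_one: "f \<in> E \<Longrightarrow> act \<one> f = f"
  using supp by (auto simp: act_def fun_eq_iff p_one)

lemma rep_phi: "f \<in> E \<Longrightarrow> rep g (\<phi> f) = \<phi> (act g f)"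
  by (simp add: rep_def)

lemma rep_mult:
  assumes "g \<in> carrier G" "h \<in> carrier G" "f \<in> E"
  shows "rep (g \<otimes> h) (\<phi> f) = rep g (rep h (\<phi> f))"
  using assms by (simp add: rep_phi act_in act_mult)

lemma rep_one: "f \<in> E \<Longrightarrow> rep \<one> (\<phi> f) = \<phi> f"
  by (simp add: rep_phi act_one)

lemma rep_unitary: "g \<in> carrier G \<Longrightarrow> rep g \<in> carrier (unitary_group space)"
proof -
  assume g: "g \<in> carrier G"
  have "bij_betw (rep g) (\<phi> ` E) (\<phi> ` E)"
  proof (rule bij_betw_byWitness[where f' = "rep (inv g)"])
    have "rep (inv g) (rep g a) = a" "rep g (rep (inv g) a) = a" if a: "a \<in> \<phi> ` E" for a
    proof -
      obtain f where f: "f \<in> E" "a = \<phi> f" using a by blast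
      show "rep (inv g) (rep g a) = a" "rep g (rep (inv g) a) = a"
        using rep_mult[of "inv g" g f] rep_mult[of g "inv g" f] rep_one[OF f(1)] f g by auto
    qed
    then show "\<forall>a\<in>\<phi> ` E. rep (inv g) (rep g a) = a" "\<forall>a\<in>\<phi> ` E. rep g (rep (inv g) a) = a" by auto
    show "rep g ` \<phi> ` E \<subseteq> \<phi> ` E" "rep (inv g) ` \<phi> ` E \<subseteq> \<phi> ` E"
      using g by (auto simp: rep_phi act_in)
  qed
  moreover have "rep g \<in> extensional (\<phi> ` E)" by (simp add: rep_def)
  ultimately have "rep g \<in> Bij (carrier space)" by (simp add: Bij_def)
  moreover have "rep g (a \<oplus>\<^bsub>space\<^esub> b) = rep g a \<oplus>\<^bsub>space\<^esub> rep g b"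
    "rep g (c \<odot>\<^bsub>space\<^esub> a) = c \<odot>\<^bsub>space\<^esub> rep g a"
    "inprod space (rep g a) (rep g b) = inprod space a b"
    if ab: "a \<in> carrier space" "b \<in> carrier space" for a b c
  proof -
    obtain f1 f2 where f: "f1 \<in> E" "a = \<phi> f1" "f2 \<in> E" "b = \<phi> f2" using ab by auto
    show "rep g (a \<oplus>\<^bsub>space\<^esub> b) = rep g a \<oplus>\<^bsub>space\<^esub> rep g b"
      using f g by (simp add: rep_phi act_in add) (rule arg_cong[of _ _ \<phi>], auto simp: act_def)
    show "rep g (c \<odot>\<^bsub>space\<^esub> a) = c \<odot>\<^bsub>space\<^esub> rep g a"
      using f g by (simp add: rep_phi act_in smult) (rule arg_cong[of _ _ \<phi>], auto simp: act_def)
    have bij: "bij_betw (p (inv g)) Y Y"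
    proof (rule bij_betw_byWitness[where f' = "p g"])
      show "\<forall>x\<in>Y. p g (p (inv g) x) = x"
        using p_mult[of g "inv g"] g by (auto simp: p_one)
      show "\<forall>x\<in>Y. p (inv g) (p g x) = x"
        using p_mult[of "inv g" g] g by (auto simp: p_one)
    qed (use p_in g in auto)
    have "inprod space (rep g a) (rep g b) = (\<Sum>x\<in>Y. f1 (p (inv g) x) * cnj (f2 (p (inv g) x)))"
      using f g by (simp add: rep_phi act_in) (simp add: act_def)
    also have "\<dots> = (\<Sum>x\<in>Y. f1 x * cnj (f2 x))"
      by (rule sum.reindex_bij_betw[OF bij])
    also have "\<dots> = inprod space a b" using f by simp
    finally show "inprod space (rep g a) (rep g b) = inprod space a b" .
  qed
  ultimately show ?thesis unfolding unitary_group_def by (simp del: space_simps)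
qed

lemma unitary_rep_rep: "unitary_rep G space rep"
  unfolding unitary_rep_def
proof (intro conjI hilbert_space_space homI rep_unitary)
  fix g h assume gh: "g \<in> carrier G" "h \<in> carrier G"
  have B: "rep g \<in> Bij (carrier space)" "rep h \<in> Bij (carrier space)"
    using rep_unitary[OF gh(1)] rep_unitary[OF gh(2)] by (auto simp: unitary_group_def)
  have "rep (g \<otimes> h) = compose (carrier space) (rep g) (rep h)"
  proof
    fix a
    show "rep (g \<otimes> h) a = compose (carrier space) (rep g) (rep h) a"
    proof (cases "a \<in> \<phi> ` E")
      case True
      then show ?thesis using rep_mult[OF gh] by (auto simp: compose_def)
    next
      case False
      then show ?thesis by (simp add: compose_def rep_def)
    qed
  qed
  then show "rep (g \<otimes> h) = rep g \<otimes>\<^bsub>unitary_group space\<^esub> rep h"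
    using B by (simp add: unitary_group_def BijGroup_def)
qed

end


text \<open>A function supported on \<open>Y\<close> is recovered from its values along a finite
  enumeration of \<open>Y\<close>, and this finite list, padded with zeros, is an element of
  \<open>nat \<Rightarrow> complex\<close>.\<close>

lemma fun_universe:
  fixes Y :: "'x set"
  assumes "finite Y" and "\<exists>\<iota> :: (nat \<Rightarrow> complex) \<Rightarrow> 'h. inj \<iota>"
  shows "\<exists>\<phi> :: ('x \<Rightarrow> complex) \<Rightarrow> 'h. inj_on \<phi> {f. \<forall>x. x \<notin> Y \<longrightarrow> f x = 0}"
proof -
  obtain \<iota> :: "(nat \<Rightarrow> complex) \<Rightarrow> 'h" where \<iota>: "inj \<iota>" using assms(2) by blast
  obtain e :: "nat \<Rightarrow> 'x" and n where e: "Y = e ` {i. i < n}" using finite_imp_nat_seg_image_inj_on[OF assms(1)] by blast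
  have "inj_on (\<lambda>f. \<iota> (\<lambda>i. if i < n then f (e i) else 0)) {f. \<forall>x. x \<notin> Y \<longrightarrow> f x = 0}"
  proof (rule inj_onI)
    fix f g :: "'x \<Rightarrow> complex"
    assume f: "f \<in> {f. \<forall>x. x \<notin> Y \<longrightarrow> f x = 0}" and g: "g \<in> {f. \<forall>x. x \<notin> Y \<longrightarrow> f x = 0}"
      and eq: "\<iota> (\<lambda>i. if i < n then f (e i) else 0) = \<iota> (\<lambda>i. if i < n then g (e i) else 0)"
    have "(\<lambda>i. if i < n then f (e i) else 0) = (\<lambda>i. if i < n then g (e i) else 0)"
      using \<iota> eq by (auto dest: injD)
    then have *: "f (e i) = g (e i)" if "i < n" for i using that by (metis (full_types))
    show "f = g"
    proof
      fix x show "f x = g x" using f g * by (cases "x \<in> Y") (auto simp: e)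
    qed
  qed
  then show ?thesis by blast
qed

text \<open>Functions on the cosets of \<open>H i\<close> are realised as functions on G/K, which is
  possible because \<open>K\<close> lies in every \<open>H i\<close>. All \<open>k\<close> blocks
  then use the same set \<open>Q\<close>, on which \<open>G\<close> acts by left multiplication in
  the quotient group.\<close>

lemma kazhdan_const_le:
  fixes G (structure)
  assumes univ: "\<exists>\<iota> :: (nat \<Rightarrow> complex) \<Rightarrow> 'h. inj \<iota>"
    and G: "group G" and K: "K \<lhd> G" and finK: "finite (rcosets K)" and k: "k > 0"
    and H: "\<And>i. i < (k::nat) \<Longrightarrow> subgroup (H i) G" "\<And>i. i < k \<Longrightarrow> H i \<noteq> carrier G" "\<And>i. i < k \<Longrightarrow> K \<subseteq> H i"
    and S: "S \<subseteq> carrier G" "\<And>s. s \<in> S \<Longrightarrow> \<exists>j. \<forall>i<k. i \<noteq> j \<longrightarrow> s \<in> H i"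
  shows "kazhdan_const TYPE('h) G S \<le> ennreal (2 / sqrt (real k))"
proof -
  interpret group G by (rule G)
  interpret K: normal K G by (rule K)
  have KG: "K \<subseteq> carrier G" by (rule K.subset)
  define Q where "Q = rcosets K"
  have rimg: "Q = (\<lambda>x. K #> x) ` carrier G" by (auto simp: Q_def RCOSETS_def)
  have finQ: "finite Q" using finK by (simp add: Q_def)
  define Y where "Y = {..<k} \<times> Q"
  have memY: "(i, C) \<in> Y \<longleftrightarrow> i < k \<and> C \<in> Q" for i C by (simp add: Y_def)
  have finY: "finite Y" using finQ by (simp add: Y_def)
  \<comment> \<open>The sum condition removes the constants, which are the only invariant functions
    on a transitive block.\<close>
  define E where "E = {f :: nat \<times> 'a set \<Rightarrow> complex. (\<forall>x. x \<notin> Y \<longrightarrow> f x = 0) \<and> (\<forall>i<k. (\<Sum>C\<in>Q. f (i, C)) = 0)}"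
  obtain \<phi> :: "(nat \<times> 'a set \<Rightarrow> complex) \<Rightarrow> 'h" where "inj_on \<phi> {f. \<forall>x. x \<notin> Y \<longrightarrow> f x = 0}"
    using fun_universe[OF finY univ] by blast
  then have inj: "inj_on \<phi> E" by (rule inj_on_subset) (auto simp: E_def)
  define p where "p g = (\<lambda>(i::nat, C). (i, (K #> g) <#> C))" for g
  have mulQ: "(K #> g) <#> (K #> x) = K #> (g \<otimes> x)" if "g \<in> carrier G" "x \<in> carrier G" for g x
    using K.rcos_sum[OF that] .
  have mulC: "(K #> g) <#> C \<in> Q" if "g \<in> carrier G" "C \<in> Q" for g C
    using that mulQ unfolding rimg by auto
  have mul_assoc: "(K #> (g \<otimes> h)) <#> C = (K #> g) <#> ((K #> h) <#> C)"
    if "g \<in> carrier G" "h \<in> carrier G" "C \<in> Q" for g h C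
    using that unfolding rimg by (auto simp: mulQ m_assoc)
  have mul_one: "(K #> \<one>) <#> C = C" if "C \<in> Q" for C
    using that unfolding rimg by (auto simp: mulQ simp del: coset_mult_one)
  have bijQ: "bij_betw (\<lambda>C. (K #> g) <#> C) Q Q" if g: "g \<in> carrier G" for g
  proof (rule bij_betw_byWitness[where f' = "\<lambda>C. (K #> inv g) <#> C"])
    show "\<forall>C\<in>Q. (K #> inv g) <#> ((K #> g) <#> C) = C"
      using mul_assoc[of "inv g" g] mul_one g by simp
    show "\<forall>C\<in>Q. (K #> g) <#> ((K #> inv g) <#> C) = C"
      using mul_assoc[of g "inv g"] mul_one g by simp
  qed (use mulC g in auto)
  interpret function_rep E Y \<phi> G p
  proof
    show "finite Y" by (rule finY)
    show "\<And>f x. f \<in> E \<Longrightarrow> x \<notin> Y \<Longrightarrow> f x = 0" by (auto simp: E_def)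
    show "(\<lambda>_. 0) \<in> E" by (simp add: E_def)
    show "\<And>f g. f \<in> E \<Longrightarrow> g \<in> E \<Longrightarrow> (\<lambda>x. f x + g x) \<in> E" by (simp add: E_def sum.distrib)
    show "\<And>c f. f \<in> E \<Longrightarrow> (\<lambda>x. c * f x) \<in> E" by (simp add: E_def sum_distrib_left[symmetric])
    show "inj_on \<phi> E" by (rule inj)
    show "f \<in> E" if F: "\<And>n. F n \<in> E" "\<And>x. (\<lambda>n. F n x) \<longlonglongrightarrow> f x" for F f
    proof -
      have "f x = 0" if "x \<notin> Y" for x
      proof -
        have "(\<lambda>n. F n x) = (\<lambda>n. 0)" using F(1) that unfolding E_def by blast
        then show ?thesis using F(2)[of x] by (simp add: LIMSEQ_const_iff)
      qed
      moreover have "(\<Sum>C\<in>Q. f (i, C)) = 0" if i: "i < k" for i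
      proof -
        have "(\<lambda>n. \<Sum>C\<in>Q. F n (i, C)) \<longlonglongrightarrow> (\<Sum>C\<in>Q. f (i, C))" by (intro tendsto_sum F(2))
        moreover have "(\<lambda>n. \<Sum>C\<in>Q. F n (i, C)) = (\<lambda>n. 0)" using F(1) i by (auto simp: E_def)
        ultimately show ?thesis by (simp add: LIMSEQ_const_iff)
      qed
      ultimately show ?thesis by (simp add: E_def)
    qed
    show "\<And>g h x. g \<in> carrier G \<Longrightarrow> h \<in> carrier G \<Longrightarrow> x \<in> Y \<Longrightarrow> p (g \<otimes> h) x = p g (p h x)"
      by (auto simp: p_def Y_def mul_assoc)
    show "\<And>x. x \<in> Y \<Longrightarrow> p \<one> x = x" using mul_one by (auto simp: p_def Y_def)
    show "\<And>g x. g \<in> carrier G \<Longrightarrow> x \<in> Y \<Longrightarrow> p g x \<in> Y" using mulC by (auto simp: p_def Y_def)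
    show "(\<lambda>x. if x \<in> Y then f (p g x) else 0) \<in> E" if g: "g \<in> carrier G" and f: "f \<in> E" for g f
    proof -
      have "(\<Sum>C\<in>Q. if (i, C) \<in> Y then f (p g (i, C)) else 0) = 0" if i: "i < k" for i
      proof -
        have "(\<Sum>C\<in>Q. if (i, C) \<in> Y then f (p g (i, C)) else 0) = (\<Sum>C\<in>Q. f (i, (K #> g) <#> C))"
          by (rule sum.cong) (use i in \<open>auto simp: Y_def p_def\<close>)
        also have "\<dots> = (\<Sum>C\<in>Q. f (i, C))" by (rule sum.reindex_bij_betw[OF bijQ[OF g]])
        also have "\<dots> = 0" using f i by (simp add: E_def)
        finally show ?thesis .
      qed
      then show ?thesis by (simp add: E_def)
    qed
  qed
  have inv0: "invariant_vectors G space rep = {\<zero>\<^bsub>space\<^esub>}"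
  proof
    have "act g (\<lambda>_. 0) = (\<lambda>_. 0)" for g by (simp add: act_def)
    then show "{\<zero>\<^bsub>space\<^esub>} \<subseteq> invariant_vectors G space rep"
      using zero by (auto simp: invariant_vectors_def rep_phi)
    show "invariant_vectors G space rep \<subseteq> {\<zero>\<^bsub>space\<^esub>}"
    proof
      fix a assume a: "a \<in> invariant_vectors G space rep"
      then obtain f where f: "f \<in> E" "a = \<phi> f" by (auto simp: invariant_vectors_def)
      have fix_f: "act g f = f" if g: "g \<in> carrier G" for g
      proof -
        have "\<phi> (act g f) = \<phi> f" using a f g by (simp add: invariant_vectors_def rep_phi)
        then show ?thesis using phi_eq_iff[OF act_in[OF g f(1)] f(1)] by simp
      qed
      have const: "f (i, C) = f (i, K #> \<one>)" if i: "i < k" and C: "C \<in> Q" for i C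
      proof -
        obtain x where x: "x \<in> carrier G" "C = K #> x" using C unfolding rimg by blast
        have "f (i, C) = act x f (i, C)" using fix_f[OF x(1)] by simp
        also have "\<dots> = f (i, (K #> inv x) <#> C)" using i C by (simp add: act_def memY p_def)
        also have "(K #> inv x) <#> C = K #> \<one>" using x by (simp add: mulQ del: coset_mult_one)
        finally show ?thesis .
      qed
      have "card Q > 0" using finQ rimg by (auto simp: card_gt_0_iff)
      have "f (i, C) = 0" if i: "i < k" and C: "C \<in> Q" for i C
      proof -
        have "(\<Sum>C\<in>Q. f (i, C)) = (\<Sum>C\<in>Q. f (i, K #> \<one>))" by (rule sum.cong) (use const[OF i] in auto)
        then have "of_nat (card Q) * f (i, K #> \<one>) = 0" using f(1) i by (simp add: E_def)
        then show ?thesis using const[OF i C] \<open>card Q > 0\<close> by simp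
      qed
      then have "f x = 0" for x using f(1) by (cases x) (auto simp: E_def Y_def)
      then have "f = (\<lambda>_. 0)" by auto
      then show "a \<in> {\<zero>\<^bsub>space\<^esub>}" using f by simp
    qed
  qed
  define L where "L i = (\<lambda>x. K #> x) ` H i" for i
  have HG: "H i \<subseteq> carrier G" if "i < k" for i using subgroup.subset[OF H(1)[OF that]] .
  have LQ: "L i \<subseteq> Q" if "i < k" for i using HG[OF that] by (auto simp: L_def rimg)
  have memL: "x \<in> H i" if i: "i < k" and x: "x \<in> carrier G" "K #> x \<in> L i" for i x
  proof -
    obtain h where h: "h \<in> H i" "K #> x = K #> h" using x by (auto simp: L_def)
    have "x \<in> K #> h" using rcos_self[OF x(1) K.subgroup_axioms] h by simp
    then obtain u where u: "u \<in> K" "x = u \<otimes> h" by (auto simp: r_coset_def)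
    then show ?thesis using H(3)[OF i] h subgroup.m_closed[OF H(1)[OF i]] by blast
  qed
  have LneQ: "L i \<noteq> Q" if i: "i < k" for i
  proof
    assume "L i = Q"
    then have "carrier G \<subseteq> H i" using memL[OF i] unfolding rimg by blast
    then show False using H(2)[OF i] HG[OF i] by blast
  qed
  \<comment> \<open>The centred indicator of \<open>L i\<close>, scaled by \<open>card Q\<close> to
    avoid fractions.\<close>
  define w :: "nat \<Rightarrow> 'a set \<Rightarrow> complex" where
    "w i C = (if C \<in> L i then of_nat (card Q) else 0) - of_nat (card (L i))" for i C
  define N where "N i = L2_set (\<lambda>C. cmod (w i C)) Q" for i
  have sumw: "(\<Sum>C\<in>Q. w i C) = 0" if i: "i < k" for i
  proof -
    have "(\<Sum>C\<in>Q. if C \<in> L i then of_nat (card Q) else 0 :: complex) = (\<Sum>C\<in>L i. of_nat (card Q))"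
      using LQ[OF i] finQ by (simp add: sum.If_cases Int_absorb1)
    then show ?thesis by (simp add: w_def sum_subtractf)
  qed
  have Npos: "N i > 0" if i: "i < k" for i
  proof -
    obtain C where C: "C \<in> Q" "C \<notin> L i" using LQ[OF i] LneQ[OF i] by blast
    have "K #> \<one> \<in> L i" unfolding L_def using subgroup.one_closed[OF H(1)[OF i]] by blast
    then have "card (L i) > 0" using finite_subset[OF LQ[OF i] finQ] card_gt_0_iff by blast
    then have "w i C \<noteq> 0" using C by (simp add: w_def)
    then have "N i \<noteq> 0" unfolding N_def using finQ C by (auto simp: L2_set_eq_0_iff)
    then show ?thesis using L2_set_nonneg[of "\<lambda>C. cmod (w i C)" Q] by (simp add: N_def less_le)
  qed
  \<comment> \<open>Each block is normalised to squared norm 1/k, so that the total norm is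
    1.\<close>
  define \<xi> :: "nat \<times> 'a set \<Rightarrow> complex" where
    "\<xi> = (\<lambda>(i, C). if (i, C) \<in> Y then w i C / of_real (N i * sqrt (real k)) else 0)"
  have \<xi>E: "\<xi> \<in> E"
  proof -
    have "(\<Sum>C\<in>Q. \<xi> (i, C)) = 0" if i: "i < k" for i
    proof -
      have "(\<Sum>C\<in>Q. \<xi> (i, C)) = (\<Sum>C\<in>Q. w i C / of_real (N i * sqrt (real k)))"
        by (rule sum.cong) (use i in \<open>auto simp: \<xi>_def Y_def\<close>)
      also have "\<dots> = (\<Sum>C\<in>Q. w i C) / of_real (N i * sqrt (real k))" by (simp only: sum_divide_distrib)
      finally show ?thesis using sumw[OF i] by simp
    qed
    then show ?thesis by (auto simp: E_def \<xi>_def)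
  qed
  have blocks: "(\<Sum>C\<in>Q. (cmod (\<xi> (i, C)))\<^sup>2) = 1 / real k" if i: "i < k" for i
  proof -
    have "(\<Sum>C\<in>Q. (cmod (\<xi> (i, C)))\<^sup>2) = (\<Sum>C\<in>Q. (cmod (w i C))\<^sup>2 / ((N i)\<^sup>2 * real k))"
      by (rule sum.cong) (use i Npos[OF i] in \<open>auto simp: \<xi>_def Y_def norm_divide norm_mult power_divide power_mult_distrib\<close>)
    also have "\<dots> = (\<Sum>C\<in>Q. (cmod (w i C))\<^sup>2) / ((N i)\<^sup>2 * real k)" by (simp only: sum_divide_distrib)
    also have "(\<Sum>C\<in>Q. (cmod (w i C))\<^sup>2) = (N i)\<^sup>2" by (simp add: N_def L2_set_def sum_nonneg)
    finally show ?thesis using Npos[OF i] by simp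
  qed
  have sumY: "(\<Sum>x\<in>Y. F x) = (\<Sum>i<k. \<Sum>C\<in>Q. F (i, C))" for F :: "nat \<times> 'a set \<Rightarrow> real"
    by (simp add: Y_def sum.cartesian_product)
  have norm\<xi>: "hnorm space (\<phi> \<xi>) = 1"
  proof -
    have "(\<Sum>x\<in>Y. (cmod (\<xi> x))\<^sup>2) = (\<Sum>i<k. 1 / real k)"
      unfolding sumY by (rule sum.cong) (use blocks in auto)
    also have "\<dots> = 1" using k by simp
    finally show ?thesis by (simp add: hnorm_space \<xi>E L2_set_def)
  qed
  have disp: "hnorm space (rep s (\<phi> \<xi>) \<ominus>\<^bsub>space\<^esub> \<phi> \<xi>) \<le> 2 / sqrt (real k)" if s: "s \<in> S" for s
  proof -
    have sG: "s \<in> carrier G" using s S by blast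
    obtain j where j: "\<And>i. i < k \<Longrightarrow> i \<noteq> j \<Longrightarrow> s \<in> H i" using S(2)[OF s] by blast
    define D where "D i = (\<Sum>C\<in>Q. (cmod (act s \<xi> (i, C) - \<xi> (i, C)))\<^sup>2)" for i
    \<comment> \<open>For \<open>s\<close> in \<open>H i\<close>, translation by
      \<open>inv s\<close> preserves \<open>L i\<close>, so the vector does not change on this
      block.\<close>
    have D0: "D i = 0" if i: "i < k" "i \<noteq> j" for i
    proof -
      have sH: "inv s \<in> H i" using j[OF i] subgroup.m_inv_closed[OF H(1)[OF i(1)]] by blast
      have "act s \<xi> (i, C) = \<xi> (i, C)" if C: "C \<in> Q" for C
      proof -
        obtain x where x: "x \<in> carrier G" "C = K #> x" using C unfolding rimg by blast
        have m: "(K #> inv s) <#> C = K #> (inv s \<otimes> x)" using x sG by (simp add: mulQ)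
        have "K #> (inv s \<otimes> x) \<in> L i \<longleftrightarrow> C \<in> L i"
        proof
          assume "K #> (inv s \<otimes> x) \<in> L i"
          then have "inv s \<otimes> x \<in> H i" using memL[OF i(1)] sG x by simp
          then have "s \<otimes> (inv s \<otimes> x) \<in> H i" using j[OF i] subgroup.m_closed[OF H(1)[OF i(1)]] by blast
          then have "x \<in> H i" using sG x by (simp add: m_assoc[symmetric])
          then show "C \<in> L i" using x by (simp add: L_def)
        next
          assume "C \<in> L i"
          then have "x \<in> H i" using memL[OF i(1)] x by simp
          then have "inv s \<otimes> x \<in> H i" using sH subgroup.m_closed[OF H(1)[OF i(1)]] by blast
          then show "K #> (inv s \<otimes> x) \<in> L i" by (simp add: L_def)
        qed
        then have "w i ((K #> inv s) <#> C) = w i C" by (simp add: m w_def)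
        moreover have "(K #> inv s) <#> C \<in> Q" using mulC sG C by simp
        ultimately show ?thesis using C i by (simp add: act_def memY p_def \<xi>_def)
      qed
      then show ?thesis by (simp add: D_def)
    qed
    have Dj: "D i \<le> 4 / real k" if i: "i < k" for i
    proof -
      \<comment> \<open>On a block both the vector and its translate have squared norm 1/k, and the
        square of |a - b| is at most twice the sum of the squares of |a| and |b|; hence 4/k.\<close>
      have "D i \<le> (\<Sum>C\<in>Q. 2 * (cmod (act s \<xi> (i, C)))\<^sup>2 + 2 * (cmod (\<xi> (i, C)))\<^sup>2)"
        unfolding D_def
      proof (rule sum_mono)
        fix C
        let ?a = "cmod (act s \<xi> (i, C))" and ?b = "cmod (\<xi> (i, C))"
        have "(cmod (act s \<xi> (i, C) - \<xi> (i, C)))\<^sup>2 \<le> (?a + ?b)\<^sup>2"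
          by (rule power_mono[OF norm_triangle_ineq4]) simp
        also have "\<dots> \<le> 2 * ?a\<^sup>2 + 2 * ?b\<^sup>2" using zero_le_power2[of "?a - ?b"]
          by (simp add: power2_eq_square algebra_simps)
        finally show "(cmod (act s \<xi> (i, C) - \<xi> (i, C)))\<^sup>2 \<le> 2 * ?a\<^sup>2 + 2 * ?b\<^sup>2" .
      qed
      also have "\<dots> = 2 * (\<Sum>C\<in>Q. (cmod (act s \<xi> (i, C)))\<^sup>2) + 2 * (1 / real k)"
        by (simp only: sum.distrib sum_distrib_left[symmetric] blocks[OF i])
      also have "(\<Sum>C\<in>Q. (cmod (act s \<xi> (i, C)))\<^sup>2) = (\<Sum>C\<in>Q. (cmod (\<xi> (i, (K #> inv s) <#> C)))\<^sup>2)"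
        by (rule sum.cong) (use i in \<open>auto simp: act_def memY p_def\<close>)
      also have "\<dots> = (\<Sum>C\<in>Q. (cmod (\<xi> (i, C)))\<^sup>2)"
        by (rule sum.reindex_bij_betw[OF bijQ]) (use sG in simp)
      finally show ?thesis using blocks[OF i] by simp
    qed
    have "(\<Sum>x\<in>Y. (cmod (act s \<xi> x - \<xi> x))\<^sup>2) = (\<Sum>i<k. D i)" unfolding sumY by (simp add: D_def)
    also have "\<dots> \<le> (\<Sum>i<k. if i = j then 4 / real k else 0)"
      by (rule sum_mono) (use D0 Dj in auto)
    \<comment> \<open>Only an inequality, since the sum is 0 when \<open>j\<close> is not below
      \<open>k\<close>.\<close>
    also have "\<dots> \<le> 4 / real k" by (simp add: sum.delta)
    finally have "sqrt (\<Sum>x\<in>Y. (cmod (act s \<xi> x - \<xi> x))\<^sup>2) \<le> sqrt (4 / real k)" by (rule real_sqrt_le_mono)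
    also have "sqrt (4 / real k) = 2 / sqrt (real k)" by (simp add: real_sqrt_divide)
    finally show ?thesis
      using \<xi>E sG by (simp add: rep_phi a_minus_space hnorm_space act_in diff_in L2_set_def)
  qed
  have "kazhdan_const TYPE('h) G S \<le> (INF \<xi> \<in> {\<xi> \<in> carrier space. hnorm space \<xi> = 1}.
        SUP s \<in> S. ennreal (hnorm space (rep s \<xi> \<ominus>\<^bsub>space\<^esub> \<xi>)))"
    unfolding kazhdan_const_def by (rule INF_lower2[of "(space, rep)"]) (use unitary_rep_rep inv0 in auto)
  also have "\<dots> \<le> (SUP s \<in> S. ennreal (hnorm space (rep s (\<phi> \<xi>) \<ominus>\<^bsub>space\<^esub> \<phi> \<xi>)))"
    by (rule INF_lower) (use \<xi>E norm\<xi> in auto)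
  also have "\<dots> \<le> ennreal (2 / sqrt (real k))"
    by (rule SUP_least) (use disp in \<open>auto intro: ennreal_leI\<close>)
  finally show ?thesis .
qed

section \<open>Filtrations of finitely generated domains\<close>

definition is_subring :: "'a::field set \<Rightarrow> bool" where
  "is_subring A \<longleftrightarrow> 1 \<in> A \<and> (\<forall>x\<in>A. \<forall>y\<in>A. x - y \<in> A \<and> x * y \<in> A)"

definition is_ideal :: "'a::field set \<Rightarrow> 'a set \<Rightarrow> bool" where
  "is_ideal A I \<longleftrightarrow> I \<subseteq> A \<and> 0 \<in> I \<and> (\<forall>x\<in>I. \<forall>y\<in>I. x - y \<in> I) \<and> (\<forall>a\<in>A. \<forall>x\<in>I. a * x \<in> I)"

text \<open>Finiteness of the quotient A/I, expressed by a finite set of representatives so that no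
  quotient ring has to be formed.\<close>

definition cofinite_in :: "'a::field set \<Rightarrow> 'a set \<Rightarrow> bool" where
  "cofinite_in A I \<longleftrightarrow> (\<exists>T. finite T \<and> T \<subseteq> A \<and> (\<forall>a\<in>A. \<exists>t\<in>T. a - t \<in> I))"

definition unit_mod :: "'a::field set \<Rightarrow> 'a set \<Rightarrow> 'a \<Rightarrow> bool" where
  "unit_mod A I c \<longleftrightarrow> c \<in> A \<and> (\<exists>b\<in>A. c * b - 1 \<in> I)"

text \<open>
  The ideals \<open>J k\<close> play the role of the powers of a maximal ideal. Constructing them along a tower of
  generators avoids the Nullstellensatz over the integers and Krull's intersection theorem.
\<close>

definition filtration :: "'a::field set \<Rightarrow> (nat \<Rightarrow> 'a set) \<Rightarrow> bool" where
  "filtration A J \<longleftrightarrow> is_subring A \<and> J 0 = A \<and>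
     (\<forall>k. is_ideal A (J k) \<and> cofinite_in A (J k) \<and> J (Suc k) \<subseteq> J k) \<and>
     (\<forall>i j. \<forall>x\<in>J i. \<forall>y\<in>J j. x * y \<in> J (i + j)) \<and> (\<Inter>k. J k) \<subseteq> {0}"

lemma is_subringD:
  assumes "is_subring A"
  shows "0 \<in> A" "1 \<in> A" "x \<in> A \<Longrightarrow> y \<in> A \<Longrightarrow> x - y \<in> A" "x \<in> A \<Longrightarrow> y \<in> A \<Longrightarrow> x * y \<in> A"
    "x \<in> A \<Longrightarrow> - x \<in> A" "x \<in> A \<Longrightarrow> y \<in> A \<Longrightarrow> x + y \<in> A" "x \<in> A \<Longrightarrow> x ^ n \<in> A"
proof -
  have *: "1 \<in> A" "\<And>x y. x \<in> A \<Longrightarrow> y \<in> A \<Longrightarrow> x - y \<in> A" "\<And>x y. x \<in> A \<Longrightarrow> y \<in> A \<Longrightarrow> x * y \<in> A"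
    using assms by (auto simp: is_subring_def)
  show 0: "0 \<in> A" using *(2)[OF *(1) *(1)] by simp
  have m: "- x \<in> A" if "x \<in> A" for x using *(2)[OF 0 that] by simp
  show "1 \<in> A" "x \<in> A \<Longrightarrow> y \<in> A \<Longrightarrow> x - y \<in> A" "x \<in> A \<Longrightarrow> y \<in> A \<Longrightarrow> x * y \<in> A" "x \<in> A \<Longrightarrow> - x \<in> A"
    using * m by auto
  show "x \<in> A \<Longrightarrow> y \<in> A \<Longrightarrow> x + y \<in> A" using *(2)[of x "- y"] m[of y] by simp
  show "x \<in> A \<Longrightarrow> x ^ n \<in> A" by (induction n) (use * in auto)
qed

lemma is_idealD:
  assumes "is_ideal A I"
  shows "0 \<in> I" "I \<subseteq> A" "x \<in> I \<Longrightarrow> y \<in> I \<Longrightarrow> x - y \<in> I" "a \<in> A \<Longrightarrow> x \<in> I \<Longrightarrow> a * x \<in> I"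
    "a \<in> A \<Longrightarrow> x \<in> I \<Longrightarrow> x * a \<in> I" "x \<in> I \<Longrightarrow> - x \<in> I" "x \<in> I \<Longrightarrow> y \<in> I \<Longrightarrow> x + y \<in> I" "x \<in> I \<Longrightarrow> x \<in> A"
proof -
  have *: "0 \<in> I" "I \<subseteq> A" "\<And>x y. x \<in> I \<Longrightarrow> y \<in> I \<Longrightarrow> x - y \<in> I" "\<And>a x. a \<in> A \<Longrightarrow> x \<in> I \<Longrightarrow> a * x \<in> I"
    using assms by (auto simp: is_ideal_def)
  have m: "- x \<in> I" if "x \<in> I" for x using *(3)[OF *(1) that] by simp
  show "0 \<in> I" "I \<subseteq> A" "x \<in> I \<Longrightarrow> y \<in> I \<Longrightarrow> x - y \<in> I" "a \<in> A \<Longrightarrow> x \<in> I \<Longrightarrow> a * x \<in> I"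
    "a \<in> A \<Longrightarrow> x \<in> I \<Longrightarrow> x * a \<in> I" "x \<in> I \<Longrightarrow> - x \<in> I" "x \<in> I \<Longrightarrow> x \<in> A"
    using * m *(4)[of a x] by (auto simp: mult.commute)
  show "x \<in> I \<Longrightarrow> y \<in> I \<Longrightarrow> x + y \<in> I" using *(3)[of x "- y"] m[of y] by simp
qed

lemma is_subring_is_ideal: "is_subring A \<Longrightarrow> is_ideal A A"
  by (auto simp: is_ideal_def dest: is_subringD)

lemma is_ideal_sum: "is_ideal A I \<Longrightarrow> (\<And>x. x \<in> S \<Longrightarrow> f x \<in> I) \<Longrightarrow> sum f S \<in> I"
  by (induction S rule: infinite_finite_induct) (auto dest: is_idealD)

lemma is_subring_sum: "is_subring A \<Longrightarrow> (\<And>x. x \<in> S \<Longrightarrow> f x \<in> A) \<Longrightarrow> sum f S \<in> A"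
  using is_ideal_sum is_subring_is_ideal by blast

lemma filtrationD:
  assumes "filtration A J"
  shows "is_subring A" "J 0 = A" "is_ideal A (J k)" "cofinite_in A (J k)" "J (Suc k) \<subseteq> J k"
    "x \<in> J i \<Longrightarrow> y \<in> J j \<Longrightarrow> x * y \<in> J (i + j)" "(\<And>k. z \<in> J k) \<Longrightarrow> z = 0"
    "i \<le> j \<Longrightarrow> J j \<subseteq> J i"
proof -
  have d: "\<And>k. J (Suc k) \<subseteq> J k" using assms by (simp add: filtration_def)
  show "is_subring A" "J 0 = A" "is_ideal A (J k)" "cofinite_in A (J k)" "J (Suc k) \<subseteq> J k"
    "x \<in> J i \<Longrightarrow> y \<in> J j \<Longrightarrow> x * y \<in> J (i + j)"
    using assms by (auto simp: filtration_def)
  have "(\<Inter>k. J k) \<subseteq> {0}" using assms by (simp add: filtration_def)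
  then show "(\<And>k. z \<in> J k) \<Longrightarrow> z = 0" by blast
  show "i \<le> j \<Longrightarrow> J j \<subseteq> J i" using d by (rule lift_Suc_antimono_le)
qed

text \<open>Otherwise multiplicativity would put 1 into every \<open>J k\<close>, whereas the
  intersection is zero.\<close>

lemma filtration_proper: "filtration A J \<Longrightarrow> 1 \<notin> J 1"
proof
  assume J: "filtration A J" and 1: "1 \<in> J 1"
  have "1 \<in> J k" for k
  proof (induction k)
    case 0 show ?case using filtrationD(1,2)[OF J] is_subringD(2) by blast
  next
    case (Suc k) then show ?case using filtrationD(6)[OF J Suc 1] by simp
  qed
  then show False using filtrationD(7)[OF J, of 1] by simp
qed

text \<open>Newton iteration for inverses: combining an inverse modulo \<open>J k\<close> with one
  modulo \<open>J 1\<close> gives an element whose error is, up to sign, the product of the two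
  errors, hence lies in \<open>J (k + 1)\<close>.\<close>

lemma unit_mod_filtration:
  assumes J: "filtration A J" and u: "unit_mod A (J 1) a"
  shows "unit_mod A (J k) a"
proof (cases "k = 0")
  case True
  then show ?thesis using u filtrationD(2)[OF J] is_subringD[OF filtrationD(1)[OF J]] by (auto simp: unit_mod_def)
next
  case False
  then have "k \<ge> 1" by simp
  then show ?thesis
  proof (induction k rule: dec_induct)
    case base show ?case by (rule u)
  next
    case (step k)
    note A = is_subringD[OF filtrationD(1)[OF J]]
    obtain b e where b: "a \<in> A" "b \<in> A" "a * b - 1 \<in> J 1" "e \<in> A" "a * e - 1 \<in> J k"
      using u step.IH by (auto simp: unit_mod_def)
    have "a * (e + b - a * b * e) - 1 = - ((a * e - 1) * (a * b - 1))" by (simp add: algebra_simps)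
    moreover have "- ((a * e - 1) * (a * b - 1)) \<in> J (k + 1)"
      using filtrationD(6)[OF J b(5) b(3)] is_idealD(6)[OF filtrationD(3)[OF J]] by blast
    moreover have "e + b - a * b * e \<in> A" using b A by simp
    ultimately have "e + b - a * b * e \<in> A" "a * (e + b - a * b * e) - 1 \<in> J (Suc k)" by simp_all
    then show ?case using b(1) unfolding unit_mod_def by blast
  qed
qed

lemma unit_mod_cancel:
  assumes J: "filtration A J" and u: "unit_mod A (J 1) a" and y: "y \<in> A" and ay: "a * y \<in> J k"
  shows "y \<in> J k"
proof -
  obtain b where b: "b \<in> A" "a * b - 1 \<in> J k" using unit_mod_filtration[OF J u, of k] by (auto simp: unit_mod_def)
  have "b * (a * y) - (a * b - 1) * y \<in> J k"
    by (intro is_idealD(3,4,5)[OF filtrationD(3)[OF J]] b y ay)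
  moreover have "b * (a * y) - (a * b - 1) * y = y" by (simp add: algebra_simps)
  ultimately show ?thesis by simp
qed

lemma unit_mod_power_cancel:
  assumes J: "filtration A J" and u: "unit_mod A (J 1) a" and y: "y \<in> A" and ay: "a ^ n * y \<in> J k"
  shows "y \<in> J k"
  using ay
proof (induction n)
  case (Suc n)
  have "a \<in> A" using u by (simp add: unit_mod_def)
  then have "a ^ n * y \<in> A" by (intro is_subringD(4,7)[OF filtrationD(1)[OF J]] y)
  then show ?case using unit_mod_cancel[OF J u] Suc by (simp add: mult.assoc)
qed simp

lemma unit_mod_mult:
  assumes "is_subring A" "unit_mod A I (a * b)" "a \<in> A" "b \<in> A"
  shows "unit_mod A I a"
proof -
  obtain e where "e \<in> A" "a * b * e - 1 \<in> I" using assms(2) by (auto simp: unit_mod_def)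
  then have "b * e \<in> A" "a * (b * e) - 1 \<in> I" using is_subringD(4)[OF assms(1,4)] by (simp_all add: mult.assoc)
  then show ?thesis using assms(3) unfolding unit_mod_def by blast
qed

section \<open>Polynomials over a subring and simple ring extensions\<close>

definition polys_over :: "'a::field set \<Rightarrow> 'a poly set" where
  "polys_over A = {f. \<forall>i. Polynomial.coeff f i \<in> A}"

definition adjoin :: "'a::field set \<Rightarrow> 'a \<Rightarrow> 'a set" where
  "adjoin A t = (\<lambda>f. poly f t) ` polys_over A"

lemma polys_overI: "(\<And>i. Polynomial.coeff f i \<in> A) \<Longrightarrow> f \<in> polys_over A"
  by (simp add: polys_over_def)

lemma polys_overD: "f \<in> polys_over A \<Longrightarrow> Polynomial.coeff f i \<in> A"
  by (simp add: polys_over_def)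

lemma polys_over_ideal:
  assumes "is_ideal A I" and "is_subring A"
  shows "0 \<in> polys_over I" "f \<in> polys_over I \<Longrightarrow> g \<in> polys_over I \<Longrightarrow> f + g \<in> polys_over I"
    "f \<in> polys_over I \<Longrightarrow> g \<in> polys_over I \<Longrightarrow> f - g \<in> polys_over I"
    "a \<in> A \<Longrightarrow> f \<in> polys_over I \<Longrightarrow> smult a f \<in> polys_over I"
    "x \<in> I \<Longrightarrow> Polynomial.monom x n \<in> polys_over I"
    "x \<in> I \<Longrightarrow> [:x:] \<in> polys_over I"
  using is_idealD[OF assms(1)] by (auto simp: polys_over_def coeff_pCons split: nat.splits)

lemma polys_over_mult_gen:
  assumes "\<And>x y. x \<in> I \<Longrightarrow> y \<in> I' \<Longrightarrow> x * y \<in> I''" and "is_ideal A I''"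
  shows "f \<in> polys_over I \<Longrightarrow> g \<in> polys_over I' \<Longrightarrow> f * g \<in> polys_over I''"
  by (auto simp: polys_over_def coeff_mult intro!: is_ideal_sum[OF assms(2)] assms(1))

lemma polys_over_mult:
  assumes "is_ideal A I"
  shows "f \<in> polys_over I \<Longrightarrow> g \<in> polys_over A \<Longrightarrow> f * g \<in> polys_over I"
  by (rule polys_over_mult_gen[OF _ assms]) (rule is_idealD(5)[OF assms])

lemma polys_over_pcompose:
  assumes A: "is_subring A" and g: "g \<in> polys_over A"
  shows "f \<in> polys_over A \<Longrightarrow> pcompose f g \<in> polys_over A"
proof (induction f)
  case 0
  then show ?case by simp
next
  case (pCons a p)
  have a: "a \<in> A" using polys_overD[OF pCons.prems, of 0] by simp
  have p: "p \<in> polys_over A"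
    using polys_overD[OF pCons.prems, of "Suc i" for i] by (intro polys_overI) simp
  note I = is_subring_is_ideal[OF A]
  show ?case unfolding pcompose_pCons
    by (intro polys_over_ideal(2)[OF I A] polys_over_ideal(6)[OF I A] polys_over_mult[OF I] a g pCons.IH p)
qed

lemma adjoinE:
  assumes "x \<in> adjoin A t" obtains f where "f \<in> polys_over A" "x = poly f t"
  using assms by (auto simp: adjoin_def)

lemma adjoinI: "f \<in> polys_over A \<Longrightarrow> poly f t \<in> adjoin A t"
  by (auto simp: adjoin_def)

lemma is_subring_adjoin:
  assumes A: "is_subring A"
  shows "is_subring (adjoin A t)"
  unfolding is_subring_def
proof (intro conjI ballI)
  note I = is_subring_is_ideal[OF A]
  have "poly [:1:] t \<in> adjoin A t" by (intro adjoinI polys_over_ideal(6)[OF I A] is_subringD(2)[OF A])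
  then show "1 \<in> adjoin A t" by simp
  fix x y assume x: "x \<in> adjoin A t" and y: "y \<in> adjoin A t"
  obtain f where f: "f \<in> polys_over A" "x = poly f t" using x by (rule adjoinE)
  obtain g where g: "g \<in> polys_over A" "y = poly g t" using y by (rule adjoinE)
  show "x - y \<in> adjoin A t" using adjoinI[OF polys_over_ideal(3)[OF I A f(1) g(1)], of t] f g by simp
  show "x * y \<in> adjoin A t" using adjoinI[OF polys_over_mult[OF I f(1) g(1)], of t] f g by simp
qed

lemma adjoin_incl:
  assumes A: "is_subring A"
  shows "A \<subseteq> adjoin A t" "t \<in> adjoin A t"
proof -
  show "A \<subseteq> adjoin A t"
  proof
    fix x assume x: "x \<in> A"
    have "poly [:x:] t \<in> adjoin A t" by (intro adjoinI polys_over_ideal(6)[OF is_subring_is_ideal[OF A] A] x)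
    then show "x \<in> adjoin A t" by simp
  qed
  have "poly (Polynomial.monom 1 1) t \<in> adjoin A t"
    by (intro adjoinI polys_over_ideal(5)[OF is_subring_is_ideal[OF A] A] is_subringD(2)[OF A])
  then show "t \<in> adjoin A t" by (simp add: poly_monom)
qed

text \<open>Multiplying by powers of the leading coefficient replaces division, so coefficients stay
  in the ring. When \<open>p\<close> has coefficients in an ideal \<open>I\<close>, so have quotient
  and remainder; this is what lets an ideal of \<open>A\<close> be followed into A[t].\<close>

lemma pseudo_division:
  assumes A: "is_subring A" and I: "is_ideal A I" and g: "g \<in> polys_over A" "g \<noteq> 0"
    and p: "p \<in> polys_over I"
  shows "\<exists>N. \<exists>q\<in>polys_over I. \<exists>r\<in>polys_over I.
    smult (lead_coeff g ^ N) p = q * g + r \<and> (r = 0 \<or> Polynomial.degree r < Polynomial.degree g)"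
  using p
proof (induction "Polynomial.degree p" arbitrary: p rule: less_induct)
  case less
  show ?case
  proof (cases "p = 0 \<or> Polynomial.degree p < Polynomial.degree g")
    case True
    then show ?thesis using less.prems polys_over_ideal(1)[OF I A]
      by (intro exI[of _ 0] bexI[of _ 0] bexI[of _ p]) auto
  next
    case False
    let ?m = "Polynomial.monom (lead_coeff p) (Polynomial.degree p - Polynomial.degree g)"
    let ?p = "smult (lead_coeff g) p - ?m * g"
    have la: "lead_coeff g \<in> A" using polys_overD[OF g(1)] .
    have m: "?m \<in> polys_over I" by (rule polys_over_ideal(5)[OF I A polys_overD[OF less.prems]])
    have mg: "?m * g \<in> polys_over I" by (rule polys_over_mult[OF I m g(1)])
    have p': "?p \<in> polys_over I"
      by (intro polys_over_ideal(3)[OF I A] polys_over_ideal(4)[OF I A] la less.prems mg)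
    have dmg: "Polynomial.degree (?m * g) \<le> Polynomial.degree p"
      using False g(2) by (simp add: degree_mult_eq degree_monom_eq)
    have c0: "Polynomial.coeff ?p (Polynomial.degree p) = 0"
    proof -
      have "Polynomial.coeff (?m * g) (Polynomial.degree p) = lead_coeff p * lead_coeff g"
        using False by (simp add: coeff_monom_mult)
      then show ?thesis by (simp add: mult.commute[of "lead_coeff g"])
    qed
    have dp: "Polynomial.degree ?p \<le> Polynomial.degree p"
      by (rule degree_diff_le) (use dmg in auto)
    have "?p = 0 \<or> Polynomial.degree ?p < Polynomial.degree p"
    proof (cases "Polynomial.degree ?p = Polynomial.degree p")
      case True
      then have "lead_coeff ?p = 0" using c0 by simp
      then show ?thesis by (simp only: leading_coeff_0_iff) simp
    qed (use dp in linarith)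
    then have "\<exists>N. \<exists>q\<in>polys_over I. \<exists>r\<in>polys_over I.
      smult (lead_coeff g ^ N) ?p = q * g + r \<and> (r = 0 \<or> Polynomial.degree r < Polynomial.degree g)"
    proof
      assume "?p = 0"
      then show ?thesis using polys_over_ideal(1)[OF I A]
        by (intro exI[of _ 0] bexI[of _ 0]) auto
    next
      assume "Polynomial.degree ?p < Polynomial.degree p"
      then show ?thesis using less.hyps p' by blast
    qed
    then obtain N q r where *: "q \<in> polys_over I" "r \<in> polys_over I"
      "smult (lead_coeff g ^ N) ?p = q * g + r" "r = 0 \<or> Polynomial.degree r < Polynomial.degree g" by blast
    let ?q = "q + smult (lead_coeff g ^ N) ?m"
    have "smult (lead_coeff g ^ Suc N) p = ?q * g + r"
    proof -
      have "smult (lead_coeff g ^ Suc N) p = smult (lead_coeff g ^ N) ?p + smult (lead_coeff g ^ N) (?m * g)"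
        by (simp add: smult_diff_right mult.commute)
      also have "\<dots> = ?q * g + r" unfolding *(3) by (simp add: algebra_simps)
      finally show ?thesis .
    qed
    moreover have "?q \<in> polys_over I"
      by (intro polys_over_ideal(2)[OF I A] polys_over_ideal(4)[OF I A] *(1) m is_subringD(7)[OF A la])
    ultimately show ?thesis using *(2,4) by blast
  qed
qed

text \<open>With t - a as generator, evaluation at \<open>a\<close> becomes taking the constant
  coefficient.\<close>

lemma adjoin_shift:
  assumes A: "is_subring A" and a: "a \<in> A"
  shows "adjoin A (t - a) = adjoin A t"
proof -
  have "adjoin A (s - b) \<subseteq> adjoin A s" if b: "b \<in> A" for s b
  proof
    fix x assume "x \<in> adjoin A (s - b)"
    then obtain f where f: "f \<in> polys_over A" "x = poly f (s - b)" by (rule adjoinE)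
    have s: "is_subring (adjoin A s)" by (rule is_subring_adjoin[OF A])
    have sb: "s - b \<in> adjoin A s"
      by (rule is_subringD(3)[OF s adjoin_incl(2)[OF A] subsetD[OF adjoin_incl(1)[OF A] b]])
    have "Polynomial.coeff f i * (s - b) ^ i \<in> adjoin A s" for i
      by (rule is_subringD(4)[OF s subsetD[OF adjoin_incl(1)[OF A] polys_overD[OF f(1)]] is_subringD(7)[OF s sb]])
    then show "x \<in> adjoin A s" unfolding f(2) poly_altdef by (intro is_subring_sum[OF s])
  qed
  from this[OF a, of t] this[OF is_subringD(5)[OF A a], of "t - a"] show ?thesis by simp
qed

text \<open>Since \<open>A\<close> is infinite, the polynomial that represents \<open>h\<close> is
  nonzero at some \<open>a\<close> in \<open>A\<close>. Specialising t to \<open>a\<close> turns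
  \<open>h\<close> into this value \<open>c\<close>, so \<open>h\<close> is a unit modulo the new
  \<open>J' 1\<close> when \<open>c\<close> is one modulo \<open>J 1\<close>.\<close>

lemma filtration_extend_transcendental:
  assumes A: "is_subring A" and inf: "infinite A"
    and tr: "\<And>f. f \<in> polys_over A \<Longrightarrow> poly f t = 0 \<Longrightarrow> f = 0"
    and h: "h \<in> adjoin A t" "h \<noteq> 0"
  shows "\<exists>c\<in>A - {0}. \<forall>J. filtration A J \<and> unit_mod A (J 1) c \<longrightarrow>
    (\<exists>J'. filtration (adjoin A t) J' \<and> unit_mod (adjoin A t) (J' 1) h \<and> J 1 \<subseteq> J' 1)"
proof -
  obtain f where f: "f \<in> polys_over A" "h = poly f t" using h(1) by (rule adjoinE)
  have "f \<noteq> 0" using f h by auto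
  then have "finite {x. poly f x = 0}" by (rule poly_roots_finite)
  then have "\<not> A \<subseteq> {x. poly f x = 0}" using inf finite_subset by blast
  then obtain a where a: "a \<in> A" "poly f a \<noteq> 0" by blast
  define s where "s = t - a"
  define B where "B = adjoin A t"
  have B: "B = adjoin A s" unfolding B_def s_def by (rule adjoin_shift[OF A a(1), symmetric])
  have subB: "is_subring B" unfolding B_def by (rule is_subring_adjoin[OF A])
  note I = is_subring_is_ideal[OF A]
  have trs: "g = 0" if g: "g \<in> polys_over A" "poly g s = 0" for g
  proof -
    have "[:- a, 1:] \<in> polys_over A" using a is_subringD[OF A]
      by (auto simp: polys_over_def coeff_pCons split: nat.splits)
    then have "pcompose g [:- a, 1:] \<in> polys_over A" by (rule polys_over_pcompose[OF A _ g(1)])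
    moreover have "poly (pcompose g [:- a, 1:]) t = 0" using g(2) by (simp add: poly_pcompose s_def)
    ultimately have "pcompose g [:- a, 1:] = 0" by (rule tr)
    then show "g = 0" by (simp add: pcompose_eq_0_iff)
  qed
  have hB: "h \<in> adjoin A s" using h(1) B B_def by simp
  then obtain h' where h': "h' \<in> polys_over A" "h = poly h' s" by (rule adjoinE)
  define c where "c = poly f a"
  have cA: "c \<in> A" unfolding c_def poly_altdef
    by (intro is_subring_sum[OF A] is_subringD(4)[OF A] is_subringD(7)[OF A] polys_overD[OF f(1)] a(1))
  have c0: "Polynomial.coeff h' 0 = c"
  proof -
    have "[:a, 1:] \<in> polys_over A" using a is_subringD[OF A]
      by (auto simp: polys_over_def coeff_pCons split: nat.splits)
    then have "pcompose f [:a, 1:] \<in> polys_over A" by (rule polys_over_pcompose[OF A _ f(1)])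
    then have "h' - pcompose f [:a, 1:] \<in> polys_over A"
      by (rule polys_over_ideal(3)[OF I A h'(1)])
    moreover have "poly (h' - pcompose f [:a, 1:]) s = 0"
      using h'(2) f(2) by (simp add: poly_pcompose s_def)
    ultimately have "h' = pcompose f [:a, 1:]" using trs by fastforce
    then show ?thesis by (simp add: poly_0_coeff_0[symmetric] poly_pcompose c_def)
  qed
  have "\<exists>J'. filtration B J' \<and> unit_mod B (J' 1) h \<and> J 1 \<subseteq> J' 1"
    if J: "filtration A J" and u: "unit_mod A (J 1) c" for J
  proof -
    \<comment> \<open>Modelled on the \<open>k\<close>-th power of the ideal generated by
      \<open>J 1\<close> and \<open>s\<close>: the coefficient of \<open>s ^ i\<close> has to lie in
      \<open>J (k - i)\<close>. From degree \<open>k\<close> on the truncated difference gives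
      \<open>J 0\<close>, which is all of \<open>A\<close>.\<close>
    define Q where "Q k = {g. \<forall>i. Polynomial.coeff g i \<in> J (k - i)}" for k
    have JA: "J k \<subseteq> A" for k using is_idealD(2)[OF filtrationD(3)[OF J]] .
    have QA: "g \<in> polys_over A" if "g \<in> Q k" for g k
      using that JA by (auto simp: Q_def polys_over_def)
    note JI = filtrationD(3)[OF J]
    define J' where "J' k = (\<lambda>g. poly g s) ` Q k" for k
    have mult: "f * g \<in> Q (i + j)" if "f \<in> Q i" "g \<in> Q j" for f g i j
      unfolding Q_def mem_Collect_eq coeff_mult
    proof (rule allI, rule is_ideal_sum[OF JI])
      fix n l :: nat assume l: "l \<in> {..n}"
      have "Polynomial.coeff f l * Polynomial.coeff g (n - l) \<in> J ((i - l) + (j - (n - l)))"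
        using that by (intro filtrationD(6)[OF J]) (auto simp: Q_def)
      moreover have "i + j - n \<le> (i - l) + (j - (n - l))" using l by auto
      ultimately show "Polynomial.coeff f l * Polynomial.coeff g (n - l) \<in> J (i + j - n)"
        using filtrationD(8)[OF J] by blast
    qed
    have J'I: "x * y \<in> J' (i + j)" if "x \<in> J' i" "y \<in> J' j" for x y i j
      using that mult by (force simp: J'_def)
    have J'0: "J' 0 = B" using filtrationD(2)[OF J] by (auto simp: J'_def B adjoin_def Q_def polys_over_def)
    have diff: "x - y \<in> J' k" if "x \<in> J' k" "y \<in> J' k" for x y k
    proof -
      obtain f g where fg: "f \<in> Q k" "x = poly f s" "g \<in> Q k" "y = poly g s" using \<open>x \<in> J' k\<close> \<open>y \<in> J' k\<close> by (auto simp: J'_def)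
      have "f - g \<in> Q k" using fg is_idealD(3)[OF JI] by (auto simp: Q_def)
      then show ?thesis using fg unfolding J'_def by (intro image_eqI[of _ _ "f - g"]) auto
    qed
    have "is_ideal B (J' k)" for k
      unfolding is_ideal_def
    proof (intro conjI ballI)
      show "J' k \<subseteq> B" using QA by (auto simp: J'_def B adjoin_def)
      have "0 \<in> Q k" using is_idealD(1)[OF JI] by (simp add: Q_def)
      then show "0 \<in> J' k" unfolding J'_def by (intro image_eqI[of _ _ 0]) auto
      show "\<And>x y. x \<in> J' k \<Longrightarrow> y \<in> J' k \<Longrightarrow> x - y \<in> J' k" by (rule diff)
      show "\<And>a x. a \<in> B \<Longrightarrow> x \<in> J' k \<Longrightarrow> a * x \<in> J' k" using J'I[of _ 0 _ k] J'0 by simp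
    qed
    moreover have "cofinite_in B (J' k)" for k
    proof -
      have "\<exists>T. finite T \<and> T \<subseteq> A \<and> (\<forall>a\<in>A. \<exists>t\<in>T. a - t \<in> J (k - i))" for i
        using filtrationD(4)[OF J] by (auto simp: cofinite_in_def)
      then obtain T where T: "\<And>i. finite (T i)" "\<And>i. T i \<subseteq> A" "\<And>i a. a \<in> A \<Longrightarrow> \<exists>t\<in>T i. a - t \<in> J (k - i)"
        by metis
      \<comment> \<open>Only coefficients of degree below \<open>k\<close> are constrained, so lists
        of \<open>k\<close> representatives suffice.\<close>
      define U where "U = (\<lambda>l. poly (Poly l) s) ` {l. set l \<subseteq> (\<Union>i<k. T i) \<and> length l = k}"
      have "finite U" unfolding U_def by (intro finite_imageI finite_lists_length_eq) (use T in auto)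
      moreover have UB: "U \<subseteq> B"
      proof -
        have "Poly l \<in> polys_over A" if "set l \<subseteq> (\<Union>i<k. T i)" for l
          using that T(2) is_subringD(1)[OF A] by (force simp: polys_over_def coeff_Poly_eq nth_default_def set_conv_nth)
        then show ?thesis by (auto simp: U_def B adjoin_def)
      qed
      moreover have "\<exists>u\<in>U. b - u \<in> J' k" if b: "b \<in> B" for b
      proof -
        obtain g where g: "g \<in> polys_over A" "b = poly g s" using b unfolding B by (rule adjoinE)
        have "\<forall>i. \<exists>t\<in>T i. Polynomial.coeff g i - t \<in> J (k - i)" using T(3) polys_overD[OF g(1)] by blast
        then obtain \<tau> where \<tau>: "\<And>i. \<tau> i \<in> T i" "\<And>i. Polynomial.coeff g i - \<tau> i \<in> J (k - i)" by metis
        let ?l = "map \<tau> [0..<k]"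
        have "poly (Poly ?l) s \<in> U" unfolding U_def by (intro image_eqI[of _ _ ?l]) (use \<tau> in auto)
        moreover have "g - Poly ?l \<in> Q k"
          using \<tau>(2) polys_overD[OF g(1)] filtrationD(2)[OF J]
          by (auto simp: Q_def coeff_Poly_eq nth_default_def)
        then have "b - poly (Poly ?l) s \<in> J' k" using g by (auto simp: J'_def intro!: image_eqI[of _ _ "g - Poly ?l"])
        ultimately show ?thesis by blast
      qed
      ultimately show ?thesis unfolding cofinite_in_def by blast
    qed
    moreover have "J' (Suc k) \<subseteq> J' k" for k
    proof -
      have "J (Suc k - i) \<subseteq> J (k - i)" for i by (rule filtrationD(8)[OF J]) simp
      then have "Q (Suc k) \<subseteq> Q k" unfolding Q_def by blast
      then show ?thesis by (auto simp: J'_def)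
    qed
    moreover have "(\<Inter>k. J' k) \<subseteq> {0}"
    proof
      fix x assume x: "x \<in> (\<Inter>k. J' k)"
      then have "x \<in> J' 0" by blast
      then obtain g where g: "g \<in> Q 0" "x = poly g s" by (auto simp: J'_def)
      have "Polynomial.coeff g i \<in> J k" for i k
      proof -
        \<comment> \<open>Index \<open>k + i\<close> brings the coefficient of degree
          \<open>i\<close> into \<open>J k\<close>; by transcendence the polynomial of
          \<open>x\<close> is the same for all \<open>k\<close>.\<close>
        have "x \<in> J' (k + i)" using x by blast
        then obtain g' where g': "g' \<in> Q (k + i)" "x = poly g' s" by (auto simp: J'_def)
        have "g - g' \<in> polys_over A" using polys_over_ideal(3)[OF I A] QA g g' by blast
        then have "g - g' = 0" using trs[of "g - g'"] g g' by simp
        then have "Polynomial.coeff g i = Polynomial.coeff g' i" by simp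
        moreover have "Polynomial.coeff g' i \<in> J (k + i - i)" using g'(1) unfolding Q_def by blast
        ultimately show ?thesis by simp
      qed
      then have "Polynomial.coeff g i = 0" for i using filtrationD(7)[OF J] by blast
      then have "g = 0" by (simp add: poly_eq_iff)
      then show "x \<in> {0}" using g by simp
    qed
    ultimately have "filtration B J'"
      unfolding filtration_def using subB J'0 J'I by simp
    moreover have "unit_mod B (J' 1) h"
    proof -
      obtain b where b: "b \<in> A" "c * b - 1 \<in> J 1" using u by (auto simp: unit_mod_def)
      have "smult b h' - 1 \<in> Q 1"
      proof -
        have "smult b h' - 1 \<in> polys_over A"
          using polys_over_ideal(3)[OF I A polys_over_ideal(4)[OF I A b(1) h'(1)], of "[:1:]"]
            polys_over_ideal(6)[OF I A is_subringD(2)[OF A]] by (simp add: one_pCons)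
        then have "Polynomial.coeff (smult b h' - 1) i \<in> J (1 - i)" for i
          using b c0 filtrationD(2)[OF J] polys_overD[of "smult b h' - 1" A i]
          by (cases i) (auto simp: mult.commute)
        then show ?thesis by (simp add: Q_def)
      qed
      then have "h * b - 1 \<in> J' 1" using h' by (auto simp: J'_def mult.commute intro!: image_eqI[of _ _ "smult b h' - 1"])
      then show ?thesis using h(1) b(1) adjoin_incl(1)[OF A] by (auto simp: unit_mod_def B_def)
    qed
    moreover have "J 1 \<subseteq> J' 1"
    proof
      fix x assume "x \<in> J 1"
      then have "[:x:] \<in> Q 1" using filtrationD(2)[OF J] is_subringD(1)[OF A] is_idealD(1)[OF JI]
        by (auto simp: Q_def coeff_pCons split: nat.splits)
      then show "x \<in> J' 1" by (auto simp: J'_def intro!: image_eqI[of _ _ "[:x:]"])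
    qed
    ultimately show ?thesis by blast
  qed
  moreover have "c \<in> A - {0}" using cA a(2) by (simp add: c_def)
  ultimately show ?thesis unfolding B_def by blast
qed

text \<open>Let \<open>a0\<close> be the leading coefficient of an annihilating polynomial of least
  degree \<open>d\<close>. Once \<open>a0\<close> is inverted, the ring generated by t is free over
  the base on the powers of t below \<open>d\<close>. The new ideals are the intersections of A[t]
  with the extensions of \<open>J k\<close> to this localisation, expressed by multiplying with
  powers of \<open>a0\<close>. Some multiple of \<open>h\<close> is a nonzero element
  \<open>c'\<close> of \<open>A\<close>, and \<open>c = a0 * c'\<close> makes both factors
  units.\<close>

lemma filtration_extend_algebraic:
  assumes A: "is_subring A"
    and alg: "f0 \<in> polys_over A" "poly f0 t = 0" "f0 \<noteq> 0"
    and h: "h \<in> adjoin A t" "h \<noteq> 0"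
  shows "\<exists>c\<in>A - {0}. \<forall>J. filtration A J \<and> unit_mod A (J 1) c \<longrightarrow>
    (\<exists>J'. filtration (adjoin A t) J' \<and> unit_mod (adjoin A t) (J' 1) h \<and> J 1 \<subseteq> J' 1)"
proof -
  define B where "B = adjoin A t"
  have subB: "is_subring B" unfolding B_def by (rule is_subring_adjoin[OF A])
  note I = is_subring_is_ideal[OF A]
  define P where "P f \<longleftrightarrow> f \<in> polys_over A \<and> poly f t = 0 \<and> f \<noteq> 0" for f
  define f where "f = arg_min Polynomial.degree P"
  have "P f0" using alg by (simp add: P_def)
  then have Pf: "P f" unfolding f_def by (rule arg_min_natI)
  have minf: "Polynomial.degree f \<le> Polynomial.degree g" if "P g" for g
    unfolding f_def using that by (rule arg_min_nat_le)
  have f: "f \<in> polys_over A" "poly f t = 0" "f \<noteq> 0" using Pf by (auto simp: P_def)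
  define d where "d = Polynomial.degree f"
  define a0 where "a0 = lead_coeff f"
  have a0: "a0 \<in> A" "a0 \<noteq> 0" using polys_overD[OF f(1)] f(3) by (auto simp: a0_def)
  have indep: "g = 0" if "g \<in> polys_over A" "poly g t = 0" "Polynomial.degree g < d" for g
  proof (rule ccontr)
    assume "g \<noteq> 0"
    then have "P g" using that by (simp add: P_def)
    from minf[OF this] that(3) show False by (simp add: d_def)
  qed
  have d0: "d > 0"
  proof (rule ccontr)
    assume "\<not> d > 0"
    then have "Polynomial.degree f = 0" by (simp add: d_def)
    then obtain c where c: "f = [:c:]" by (rule degree_eq_zeroE)
    then show False using f by auto
  qed
  have reduce: "\<exists>N. \<exists>g'\<in>polys_over II. Polynomial.degree g' < d \<and> a0 ^ N * poly g t = poly g' t"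
    if II: "is_ideal A II" and g: "g \<in> polys_over II" for II g
  proof -
    obtain N q r where r: "r \<in> polys_over II" "smult (a0 ^ N) g = q * f + r" "r = 0 \<or> Polynomial.degree r < d"
      using pseudo_division[OF A II f(1,3) g] unfolding a0_def d_def by blast
    have "a0 ^ N * poly g t = poly (smult (a0 ^ N) g) t" by simp
    also have "\<dots> = poly r t" unfolding r(2) using f(2) by simp
    finally have "a0 ^ N * poly g t = poly r t" .
    moreover have "Polynomial.degree r < d" using r(3) d0 by auto
    ultimately show ?thesis using r(1) by blast
  qed
  \<comment> \<open>The Euclidean algorithm: dividing \<open>f\<close> by \<open>g\<close> leaves a
    remainder of smaller degree whose value at t is a multiple of the value of
    \<open>g\<close>.\<close>
  have inverse: "\<exists>u\<in>polys_over A. \<exists>c'\<in>A. c' \<noteq> 0 \<and> poly g t * poly u t = c'"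
    if "g \<in> polys_over A" "g \<noteq> 0" "Polynomial.degree g < d" for g
    using that
  proof (induction "Polynomial.degree g" arbitrary: g rule: less_induct)
    case less
    have one: "[:1:] \<in> polys_over A" by (rule polys_over_ideal(6)[OF I A is_subringD(2)[OF A]])
    show ?case
    proof (cases "Polynomial.degree g = 0")
      case True
      then obtain c where c: "g = [:c:]" by (rule degree_eq_zeroE)
      then have "c \<in> A" "c \<noteq> 0" using polys_overD[OF less.prems(1), of 0] less.prems(2) by auto
      then show ?thesis using c one by (intro bexI[of _ "[:1:]"] bexI[of _ c]) auto
    next
      case False
      obtain N q r where r: "q \<in> polys_over A" "r \<in> polys_over A"
        "smult (lead_coeff g ^ N) f = q * g + r" "r = 0 \<or> Polynomial.degree r < Polynomial.degree g"
        using pseudo_division[OF A I less.prems(1,2) f(1)] by blast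
      have "poly (smult (lead_coeff g ^ N) f) t = 0" using f(2) by simp
      then have qr: "poly q t * poly g t = - poly r t" unfolding r(3) by (simp add: eq_neg_iff_add_eq_0)
      \<comment> \<open>A zero remainder would make \<open>q\<close> a nonzero polynomial of degree
        below \<open>d\<close> that vanishes at t.\<close>
      have "r \<noteq> 0"
      proof
        assume r0: "r = 0"
        have "q \<noteq> 0" using r(3) r0 f(3) less.prems(2) by auto
        have "poly g t \<noteq> 0" using indep less.prems by blast
        then have "poly q t = 0" using qr r0 by simp
        moreover have "Polynomial.degree q < d"
        proof -
          have "d = Polynomial.degree (smult (lead_coeff g ^ N) f)" using less.prems(2) by (simp add: d_def)
          also have "\<dots> = Polynomial.degree q + Polynomial.degree g"
            unfolding r(3) using r0 \<open>q \<noteq> 0\<close> less.prems(2) by (simp add: degree_mult_eq)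
          finally show ?thesis using False by simp
        qed
        ultimately have "q = 0" using indep r(1) by blast
        then show False using \<open>q \<noteq> 0\<close> by simp
      qed
      then have dr: "Polynomial.degree r < Polynomial.degree g" using r(4) by simp
      then have "Polynomial.degree r < d" using less.prems(3) by simp
      from less.hyps[OF dr r(2) \<open>r \<noteq> 0\<close> this]
      obtain u c' where u: "u \<in> polys_over A" "c' \<in> A" "c' \<noteq> 0" "poly r t * poly u t = c'" by blast
      have "poly g t * poly (- (q * u)) t = c'"
      proof -
        have "poly g t * poly (- (q * u)) t = - (poly q t * poly g t) * poly u t" by simp
        also have "\<dots> = c'" unfolding qr using u(4) by simp
        finally show ?thesis .
      qed
      moreover have "- (q * u) \<in> polys_over A"
        using polys_over_ideal(3)[OF I A polys_over_ideal(1)[OF I A] polys_over_mult[OF I r(1) u(1)]] by simp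
      ultimately show ?thesis using u(2,3) by blast
    qed
  qed
  obtain hp where hp: "hp \<in> polys_over A" "h = poly hp t" using h(1) by (rule adjoinE)
  obtain N g where g: "g \<in> polys_over A" "Polynomial.degree g < d" "a0 ^ N * h = poly g t"
    using reduce[OF I hp(1)] hp(2) by blast
  have "g \<noteq> 0" using g(3) a0 h(2) by auto
  then obtain u0 c' where u0: "u0 \<in> polys_over A" "c' \<in> A" "c' \<noteq> 0" "poly g t * poly u0 t = c'"
    using inverse g by blast
  define u where "u = a0 ^ N * poly u0 t"
  have uB: "u \<in> B" unfolding u_def
    using is_subringD(4,7)[OF subB] subsetD[OF adjoin_incl(1)[OF A] a0(1), of t] adjoinI[OF u0(1), of t]
    by (simp add: B_def)
  have hu: "h * u = c'" 
  proof -
    have "h * u = (a0 ^ N * h) * poly u0 t" by (simp add: u_def mult_ac)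
    then show ?thesis unfolding g(3) u0(4) .
  qed
  define c where "c = a0 * c'"
  have c: "c \<in> A - {0}" using a0 u0 is_subringD(4)[OF A] by (simp add: c_def)
  have "\<exists>J'. filtration B J' \<and> unit_mod B (J' 1) h \<and> J 1 \<subseteq> J' 1"
    if J: "filtration A J" and uc: "unit_mod A (J 1) c" for J
  proof -
    note JI = filtrationD(3)[OF J]
    have ua: "unit_mod A (J 1) a0" by (rule unit_mod_mult[OF A uc[unfolded c_def] a0(1) u0(2)])
    have uc': "unit_mod A (J 1) c'"
      by (rule unit_mod_mult[OF A uc[unfolded c_def mult.commute[of a0]] u0(2) a0(1)])
    have JA: "J k \<subseteq> A" for k using is_idealD(2)[OF JI] .
    have JPA: "g \<in> polys_over A" if "g \<in> polys_over (J k)" for g k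
      using that JA by (auto simp: polys_over_def)
    define J' where "J' k = {x \<in> B. \<exists>m. \<exists>g\<in>polys_over (J k). a0 ^ m * x = poly g t}" for k
    have J'0: "J' 0 = B"
    proof -
      have "\<exists>m. \<exists>g\<in>polys_over A. a0 ^ m * x = poly g t" if "x \<in> B" for x
        using that unfolding B_def adjoin_def by (intro exI[of _ 0]) auto
      then show ?thesis using filtrationD(2)[OF J] by (auto simp: J'_def)
    qed
    have J'I: "x * y \<in> J' (i + j)" if x: "x \<in> J' i" and y: "y \<in> J' j" for x y i j
    proof -
      obtain m g where g: "x \<in> B" "g \<in> polys_over (J i)" "a0 ^ m * x = poly g t" using x by (auto simp: J'_def)
      obtain n g' where g': "y \<in> B" "g' \<in> polys_over (J j)" "a0 ^ n * y = poly g' t" using y by (auto simp: J'_def)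
      have "g * g' \<in> polys_over (J (i + j))"
        by (rule polys_over_mult_gen[OF _ JI g(2) g'(2)]) (rule filtrationD(6)[OF J])
      moreover have "a0 ^ (m + n) * (x * y) = (a0 ^ m * x) * (a0 ^ n * y)" by (simp add: power_add mult_ac)
      then have "a0 ^ (m + n) * (x * y) = poly (g * g') t" unfolding g(3) g'(3) by simp
      moreover have "x * y \<in> B" by (rule is_subringD(4)[OF subB g(1) g'(1)])
      ultimately show ?thesis unfolding J'_def by blast
    qed
    have diff: "x - y \<in> J' k" if x: "x \<in> J' k" and y: "y \<in> J' k" for x y k
    proof -
      obtain m g where g: "x \<in> B" "g \<in> polys_over (J k)" "a0 ^ m * x = poly g t" using x by (auto simp: J'_def)
      obtain n g' where g': "y \<in> B" "g' \<in> polys_over (J k)" "a0 ^ n * y = poly g' t" using y by (auto simp: J'_def)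
      have "smult (a0 ^ n) g - smult (a0 ^ m) g' \<in> polys_over (J k)"
        by (intro polys_over_ideal(3,4)[OF JI A] g g' is_subringD(7)[OF A] a0)
      moreover have "a0 ^ (m + n) * (x - y) = a0 ^ n * (a0 ^ m * x) - a0 ^ m * (a0 ^ n * y)"
        by (simp add: power_add algebra_simps)
      then have "a0 ^ (m + n) * (x - y) = poly (smult (a0 ^ n) g - smult (a0 ^ m) g') t"
        unfolding g(3) g'(3) by simp
      moreover have "x - y \<in> B" by (rule is_subringD(3)[OF subB g(1) g'(1)])
      ultimately show ?thesis unfolding J'_def by blast
    qed
    have zero: "0 \<in> J' k" for k
      using is_subringD(1)[OF subB] polys_over_ideal(1)[OF JI A] by (auto simp: J'_def intro!: bexI[of _ 0])
    have "is_ideal B (J' k)" for k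
      unfolding is_ideal_def
    proof (intro conjI ballI)
      show "J' k \<subseteq> B" by (auto simp: J'_def)
      show "0 \<in> J' k" by (rule zero)
      show "\<And>x y. x \<in> J' k \<Longrightarrow> y \<in> J' k \<Longrightarrow> x - y \<in> J' k" by (rule diff)
      show "\<And>a x. a \<in> B \<Longrightarrow> x \<in> J' k \<Longrightarrow> a * x \<in> J' k" using J'I[of _ 0 _ k] J'0 by simp
    qed
    moreover have "cofinite_in B (J' k)" for k
    proof -
      obtain T where T: "finite T" "T \<subseteq> A" "\<And>a. a \<in> A \<Longrightarrow> \<exists>t\<in>T. a - t \<in> J k"
        using filtrationD(4)[OF J, of k] unfolding cofinite_in_def by blast
      obtain e where e: "e \<in> A" "a0 * e - 1 \<in> J k"
        using unit_mod_filtration[OF J ua, of k] by (auto simp: unit_mod_def)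
      have epow: "1 - (a0 * e) ^ m \<in> J k" for m
      proof (induction m)
        case 0 show ?case using is_idealD(1)[OF JI] by simp
      next
        case (Suc m)
        have "1 - (a0 * e) ^ Suc m = (1 - (a0 * e) ^ m) - (a0 * e) ^ m * (a0 * e - 1)" by (simp add: algebra_simps)
        also have "\<dots> \<in> J k"
          by (intro is_idealD(3,4)[OF JI] Suc e is_subringD(4,7)[OF A] a0)
        finally show ?case .
      qed
      \<comment> \<open>Since \<open>a0\<close> has an inverse \<open>e\<close> modulo
        \<open>J k\<close>, every element is congruent to a combination of the powers of t below
        \<open>d\<close> with coefficients in \<open>T\<close>.\<close>
      define U where "U = (\<lambda>l. poly (Poly l) t) ` {l. set l \<subseteq> T \<and> length l = d}"
      have "finite U" unfolding U_def by (intro finite_imageI finite_lists_length_eq T)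
      moreover have "U \<subseteq> B"
      proof -
        have "Poly l \<in> polys_over A" if "set l \<subseteq> T" for l
          using that T(2) is_subringD(1)[OF A] by (force simp: polys_over_def coeff_Poly_eq nth_default_def set_conv_nth)
        then show ?thesis by (auto simp: U_def B_def adjoin_def)
      qed
      moreover have "\<exists>u\<in>U. x - u \<in> J' k" if x: "x \<in> B" for x
      proof -
        obtain gx where gx: "gx \<in> polys_over A" "x = poly gx t" using x unfolding B_def by (rule adjoinE)
        obtain m g where g: "g \<in> polys_over A" "Polynomial.degree g < d" "a0 ^ m * x = poly g t"
          using reduce[OF I gx(1)] gx(2) by blast
        have "\<forall>i. \<exists>t\<in>T. e ^ m * Polynomial.coeff g i - t \<in> J k"
          by (intro allI T(3) is_subringD(4)[OF A is_subringD(7)[OF A e(1)] polys_overD[OF g(1)]])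
        then obtain \<tau> where \<tau>: "\<And>i. \<tau> i \<in> T" "\<And>i. e ^ m * Polynomial.coeff g i - \<tau> i \<in> J k" by metis
        let ?l = "map \<tau> [0..<d]"
        have U: "poly (Poly ?l) t \<in> U" unfolding U_def by (intro image_eqI[of _ _ ?l]) (use \<tau> in auto)
        have cl: "nth_default 0 ?l i = (if i < d then \<tau> i else 0)" for i
          by (auto simp: nth_default_def)
        have "g - smult (a0 ^ m) (Poly ?l) \<in> polys_over (J k)"
        proof (rule polys_overI)
          fix i
          show "Polynomial.coeff (g - smult (a0 ^ m) (Poly ?l)) i \<in> J k"
          proof (cases "i < d")
            case True
            have "Polynomial.coeff (g - smult (a0 ^ m) (Poly ?l)) i = 
              Polynomial.coeff g i * (1 - (a0 * e) ^ m) + a0 ^ m * (e ^ m * Polynomial.coeff g i - \<tau> i)"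
              using True by (simp add: cl algebra_simps power_mult_distrib)
            also have "\<dots> \<in> J k"
              by (intro is_idealD(4,7)[OF JI] epow \<tau> polys_overD[OF g(1)] is_subringD(7)[OF A] a0)
            finally show ?thesis .
          next
            case False
            then have "Polynomial.coeff g i = 0" using g(2) by (intro coeff_eq_0) simp
            then show ?thesis using False is_idealD(1)[OF JI] by (simp add: cl)
          qed
        qed
        moreover have "a0 ^ m * (x - poly (Poly ?l) t) = poly (g - smult (a0 ^ m) (Poly ?l)) t"
          using g(3) by (simp add: algebra_simps)
        moreover have "x - poly (Poly ?l) t \<in> B" by (rule is_subringD(3)[OF subB x subsetD[OF \<open>U \<subseteq> B\<close> U]])
        ultimately have "x - poly (Poly ?l) t \<in> J' k" unfolding J'_def by blast
        then show ?thesis using U by blast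
      qed
      ultimately show ?thesis unfolding cofinite_in_def by blast
    qed
    moreover have "J' (Suc k) \<subseteq> J' k" for k
    proof -
      have "polys_over (J (Suc k)) \<subseteq> polys_over (J k)" using filtrationD(5)[OF J, of k] by (auto simp: polys_over_def)
      then show ?thesis unfolding J'_def by blast
    qed
    moreover have "(\<Inter>k. J' k) \<subseteq> {0}"
    proof
      fix x assume x: "x \<in> (\<Inter>k. J' k)"
      then have "x \<in> B" using J'0 by blast
      then obtain gx where gx: "gx \<in> polys_over A" "x = poly gx t" unfolding B_def by (rule adjoinE)
      obtain m g where g: "g \<in> polys_over A" "Polynomial.degree g < d" "a0 ^ m * x = poly g t"
        using reduce[OF I gx(1)] gx(2) by blast
      have "Polynomial.coeff g i \<in> J k" for i k
      proof -
        have "x \<in> J' k" using x by blast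
        then obtain m1 g1 where g1: "g1 \<in> polys_over (J k)" "a0 ^ m1 * x = poly g1 t" by (auto simp: J'_def)
        obtain m2 g2 where g2: "g2 \<in> polys_over (J k)" "Polynomial.degree g2 < d" "a0 ^ m2 * poly g1 t = poly g2 t"
          using reduce[OF JI g1(1)] by blast
        let ?n = "m2 + m1"
        \<comment> \<open>\<open>g\<close> and \<open>g2\<close> both represent multiples of
          \<open>x\<close> by powers of \<open>a0\<close>, in degrees below \<open>d\<close>. By
          \<open>indep\<close> their coefficients agree up to powers of \<open>a0\<close>, which
          cancel modulo \<open>J k\<close>.\<close>
        let ?z = "smult (a0 ^ ?n) g - smult (a0 ^ m) g2"
        have e: "a0 ^ ?n * x = poly g2 t" using g2(3) by (simp add: g1(2)[symmetric] power_add mult.assoc)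
        have "poly ?z t = a0 ^ ?n * (a0 ^ m * x) - a0 ^ m * (a0 ^ ?n * x)" unfolding e g(3) by simp
        then have "poly ?z t = 0" by (simp add: mult.left_commute)
        moreover have "?z \<in> polys_over A"
          by (intro polys_over_ideal(3,4)[OF I A] g JPA[OF g2(1)] is_subringD(7)[OF A] a0)
        moreover have "Polynomial.degree ?z < d"
          using g(2) g2(2) by (intro degree_diff_less) (auto intro: le_less_trans[OF degree_smult_le])
        ultimately have "?z = 0" using indep by blast
        then have "Polynomial.coeff ?z i = 0" by simp
        then have "a0 ^ ?n * Polynomial.coeff g i = a0 ^ m * Polynomial.coeff g2 i" by simp
        also have "\<dots> \<in> J k" by (intro is_idealD(4)[OF JI] polys_overD[OF g2(1)] is_subringD(7)[OF A] a0)
        finally show ?thesis by (rule unit_mod_power_cancel[OF J ua polys_overD[OF g(1)]])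
      qed
      then have "Polynomial.coeff g i = 0" for i using filtrationD(7)[OF J] by blast
      then have "g = 0" by (simp add: poly_eq_iff)
      then show "x \<in> {0}" using g(3) a0(2) by simp
    qed
    ultimately have "filtration B J'"
      unfolding filtration_def using subB J'0 J'I by simp
    moreover have JJ': "J k \<subseteq> J' k" for k
    proof
      fix x assume x: "x \<in> J k"
      then have "[:x:] \<in> polys_over (J k)" by (rule polys_over_ideal(6)[OF JI A])
      moreover have "a0 ^ 0 * x = poly [:x:] t" by simp
      moreover have "x \<in> B" using x JA adjoin_incl(1)[OF A] unfolding B_def by blast
      ultimately show "x \<in> J' k" unfolding J'_def by blast
    qed
    moreover have "unit_mod B (J' 1) h"
    proof -
      obtain b where b: "b \<in> A" "c' * b - 1 \<in> J 1" using uc' by (auto simp: unit_mod_def)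
      have "u * b \<in> B" by (rule is_subringD(4)[OF subB uB]) (use b(1) adjoin_incl(1)[OF A] in \<open>auto simp: B_def\<close>)
      moreover have "h * (u * b) - 1 \<in> J' 1" using b(2) JJ' hu by (auto simp: mult.assoc[symmetric])
      ultimately show ?thesis using h(1) unfolding unit_mod_def B_def by blast
    qed
    ultimately show ?thesis by blast
  qed
  then show ?thesis using c unfolding B_def by blast
qed

lemma filtration_extend:
  assumes A: "is_subring A" "infinite A" and h: "h \<in> adjoin A t" "h \<noteq> 0"
  shows "\<exists>c\<in>A - {0}. \<forall>J. filtration A J \<and> unit_mod A (J 1) c \<longrightarrow>
    (\<exists>J'. filtration (adjoin A t) J' \<and> unit_mod (adjoin A t) (J' 1) h \<and> J 1 \<subseteq> J' 1)"
proof (cases "\<exists>f\<in>polys_over A. poly f t = 0 \<and> f \<noteq> 0")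
  case True
  then obtain f where "f \<in> polys_over A" "poly f t = 0" "f \<noteq> 0" by blast
  from filtration_extend_algebraic[OF A(1) this h] show ?thesis .
next
  case False
  show ?thesis by (rule filtration_extend_transcendental[OF A _ h]) (use False in blast)
qed

definition adjoin_list :: "'a::field set \<Rightarrow> 'a list \<Rightarrow> 'a set" where
  "adjoin_list A ts = foldr (\<lambda>t B. adjoin B t) ts A"

lemma is_subring_adjoin_list: "is_subring A \<Longrightarrow> is_subring (adjoin_list A ts)"
  by (induction ts) (auto simp: adjoin_list_def is_subring_adjoin)

lemma adjoin_list_incl:
  assumes "is_subring A"
  shows "A \<subseteq> adjoin_list A ts" "set ts \<subseteq> adjoin_list A ts"
proof -
  have "A \<subseteq> adjoin_list A ts \<and> set ts \<subseteq> adjoin_list A ts"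
  proof (induction ts)
    case Nil then show ?case by (simp add: adjoin_list_def)
  next
    case (Cons t ts)
    have e: "adjoin_list A (t # ts) = adjoin (adjoin_list A ts) t" by (simp add: adjoin_list_def)
    show ?case unfolding e
      using Cons adjoin_incl[OF is_subring_adjoin_list[OF assms, of ts], of t] by auto
  qed
  then show "A \<subseteq> adjoin_list A ts" "set ts \<subseteq> adjoin_list A ts" by auto
qed

text \<open>The requirement to invert \<open>h\<close> travels down the tower of adjunctions and
  becomes a requirement on a single \<open>c\<close> in \<open>A\<close>; a filtration of
  \<open>A\<close> then travels up.\<close>

lemma filtration_extend_list:
  assumes A: "is_subring A" "infinite A" and h: "h \<in> adjoin_list A ts" "h \<noteq> 0"
  shows "\<exists>c\<in>A - {0}. \<forall>J. filtration A J \<and> unit_mod A (J 1) c \<longrightarrow>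
    (\<exists>J'. filtration (adjoin_list A ts) J' \<and> unit_mod (adjoin_list A ts) (J' 1) h \<and> J 1 \<subseteq> J' 1)"
  using h
proof (induction ts arbitrary: h)
  case Nil
  then show ?case by (intro bexI[of _ h]) (auto simp: adjoin_list_def)
next
  case (Cons t ts)
  let ?B = "adjoin_list A ts"
  have e: "adjoin_list A (t # ts) = adjoin ?B t" by (simp add: adjoin_list_def)
  have B: "is_subring ?B" by (rule is_subring_adjoin_list[OF A(1)])
  have infB: "infinite ?B" using adjoin_list_incl(1)[OF A(1), of ts] A(2) finite_subset by blast
  obtain b where b: "b \<in> ?B" "b \<noteq> 0" and bJ: "\<And>J. filtration ?B J \<Longrightarrow> unit_mod ?B (J 1) b \<Longrightarrow>
    \<exists>J'. filtration (adjoin ?B t) J' \<and> unit_mod (adjoin ?B t) (J' 1) h \<and> J 1 \<subseteq> J' 1"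
    using filtration_extend[OF B infB Cons.prems(1)[unfolded e] Cons.prems(2)] by blast
  obtain c where c: "c \<in> A - {0}" and cJ: "\<And>J. filtration A J \<Longrightarrow> unit_mod A (J 1) c \<Longrightarrow>
    \<exists>J'. filtration ?B J' \<and> unit_mod ?B (J' 1) b \<and> J 1 \<subseteq> J' 1"
    using Cons.IH[OF b] by blast
  have "\<exists>J'. filtration (adjoin ?B t) J' \<and> unit_mod (adjoin ?B t) (J' 1) h \<and> J 1 \<subseteq> J' 1"
    if J: "filtration A J" "unit_mod A (J 1) c" for J
  proof -
    obtain J1 where J1: "filtration ?B J1" "unit_mod ?B (J1 1) b" "J 1 \<subseteq> J1 1" using cJ[OF J] by blast
    obtain J2 where "filtration (adjoin ?B t) J2" "unit_mod (adjoin ?B t) (J2 1) h" "J1 1 \<subseteq> J2 1"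
      using bJ[OF J1(1,2)] by blast
    then show ?thesis using J1(3) by blast
  qed
  then show ?case unfolding e using c by blast
qed

section \<open>Filtrations in characteristic zero\<close>

lemma is_subring_of_int: "is_subring (range of_int :: 'a::field set)"
  unfolding is_subring_def
proof (intro conjI ballI)
  show "1 \<in> (range of_int :: 'a set)" by (intro image_eqI[of _ _ 1]) auto
  fix x y :: 'a assume "x \<in> range of_int" "y \<in> range of_int"
  then obtain a b where ab: "x = of_int a" "y = of_int b" by blast
  show "x - y \<in> range of_int" by (intro image_eqI[of _ _ "a - b"]) (auto simp: ab)
  show "x * y \<in> range of_int" by (intro image_eqI[of _ _ "a * b"]) (auto simp: ab)
qed

lemma of_int_eq_iff_char_0:
  assumes "CHAR('a::field) = 0"
  shows "(of_int z :: 'a) = of_int w \<longleftrightarrow> z = w"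
proof -
  have "(of_int y :: 'a) = 0 \<longleftrightarrow> y = 0" for y
    using assms by (cases y rule: int_cases2) (simp_all add: of_nat_eq_0_iff_char_dvd)
  from this[of "z - w"] show ?thesis by simp
qed

text \<open>The \<open>l\<close>-adic filtration of the integers, embedded in the field.\<close>

lemma filtration_int:
  assumes char: "CHAR('a::field) = 0" and l: "prime (l::nat)"
  shows "filtration (range of_int :: 'a set) (\<lambda>k. range (\<lambda>z. of_int (int l ^ k * z)))"
    "\<not> int l dvd c \<Longrightarrow> unit_mod (range of_int :: 'a set) (range (\<lambda>z. of_int (int l ^ 1 * z))) (of_int c)"
proof -
  let ?A = "range of_int :: 'a set"
  let ?J = "\<lambda>k. range (\<lambda>z. of_int (int l ^ k * z)) :: 'a set"
  note inj = of_int_eq_iff_char_0[OF char]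
  have "is_ideal ?A (?J k)" for k
    unfolding is_ideal_def
  proof (intro conjI ballI)
    show "?J k \<subseteq> ?A" by blast
    show "0 \<in> ?J k" by (intro image_eqI[of _ _ 0]) auto
    fix x y assume "x \<in> ?J k" "y \<in> ?J k"
    then obtain a b where ab: "x = of_int (int l ^ k * a)" "y = of_int (int l ^ k * b)" by blast
    show "x - y \<in> ?J k" by (intro image_eqI[of _ _ "a - b"]) (auto simp: ab algebra_simps)
  next
    fix x y assume "x \<in> ?A" "y \<in> ?J k"
    then obtain a b where ab: "x = of_int a" "y = of_int (int l ^ k * b)" by blast
    show "x * y \<in> ?J k" by (intro image_eqI[of _ _ "a * b"]) (auto simp: ab algebra_simps)
  qed
  moreover have "cofinite_in ?A (?J k)" for k
    unfolding cofinite_in_def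
  proof (intro exI[of _ "of_int ` {0..<int l ^ k}"] conjI ballI)
    fix a :: 'a assume "a \<in> range of_int"
    then obtain z where z: "a = of_int z" by blast
    have pos: "int l ^ k > 0" using l by (simp add: prime_gt_0_nat)
    have "z - z mod int l ^ k = int l ^ k * (z div int l ^ k)" by (simp add: minus_mod_eq_mult_div)
    then have "a - of_int (z mod int l ^ k) = of_int (int l ^ k * (z div int l ^ k))"
      unfolding z by (metis of_int_diff)
    moreover have "z mod int l ^ k \<in> {0..<int l ^ k}" using pos by simp
    ultimately show "\<exists>t\<in>of_int ` {0..<int l ^ k}. a - t \<in> ?J k" by blast
  qed auto
  moreover have "?J (Suc k) \<subseteq> ?J k" for k
  proof
    fix x assume "x \<in> ?J (Suc k)"
    then obtain z where "x = of_int (int l ^ Suc k * z)" by blast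
    then show "x \<in> ?J k" by (intro image_eqI[of _ _ "int l * z"]) (auto simp: algebra_simps)
  qed
  moreover have "x * y \<in> ?J (i + j)" if "x \<in> ?J i" "y \<in> ?J j" for x y i j
  proof -
    obtain a b where ab: "x = of_int (int l ^ i * a)" "y = of_int (int l ^ j * b)" using \<open>x \<in> ?J i\<close> \<open>y \<in> ?J j\<close> by blast
    show ?thesis by (intro image_eqI[of _ _ "a * b"]) (auto simp: ab power_add algebra_simps)
  qed
  moreover have "(\<Inter>k. ?J k) \<subseteq> {0}"
  proof
    fix x assume x: "x \<in> (\<Inter>k. ?J k)"
    then have "x \<in> ?J 0" by blast
    then obtain z where z: "x = of_int z" by auto
    have "int l ^ k dvd z" for k
    proof -
      have "x \<in> ?J k" using x by blast
      then obtain w where "x = of_int (int l ^ k * w)" by blast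
      then have "z = int l ^ k * w" using z inj by metis
      then show ?thesis by simp
    qed
    moreover have "\<not> int l ^ (nat \<bar>z\<bar>) dvd z" if "z \<noteq> 0"
    proof
      assume "int l ^ (nat \<bar>z\<bar>) dvd z"
      then have "\<bar>int l ^ (nat \<bar>z\<bar>)\<bar> \<le> \<bar>z\<bar>" using that dvd_imp_le_int by blast
      then have "int (l ^ nat \<bar>z\<bar>) \<le> int (nat \<bar>z\<bar>)" by simp
      then have "l ^ nat \<bar>z\<bar> \<le> nat \<bar>z\<bar>" by linarith
      moreover have "nat \<bar>z\<bar> < l ^ nat \<bar>z\<bar>" using prime_gt_1_nat[OF l] by (intro power_gt_expt) simp
      ultimately show False by simp
    qed
    ultimately have "z = 0" by blast
    then show "x \<in> {0}" using z by simp
  qed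
  ultimately show "filtration ?A ?J" unfolding filtration_def using is_subring_of_int by simp
  assume "\<not> int l dvd c"
  then have "coprime (int l) c" using l by (intro prime_imp_coprime) auto
  then obtain u v where uv: "u * int l + v * c = 1" using bezout_int[of "int l" c] by (auto simp: coprime_iff_gcd_eq_1)
  have "of_int c * of_int v - 1 = (of_int (int l ^ 1 * (- u)) :: 'a)"
  proof -
    have "c * v - 1 = int l ^ 1 * (- u)" using uv by (simp add: algebra_simps)
    then show ?thesis by (metis of_int_diff of_int_mult of_int_1)
  qed
  then show "unit_mod ?A (?J 1) (of_int c)" unfolding unit_mod_def by blast
qed

lemma filtration_char_0:
  fixes ts :: "'a::field list"
  assumes char: "CHAR('a) = 0"
  shows "\<exists>b. \<forall>l>b. prime (l::nat) \<longrightarrow> (\<exists>J. filtration (adjoin_list (range of_int) ts) J \<and> of_nat l \<in> J 1)"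
proof -
  let ?Z = "range of_int :: 'a set"
  have inj: "inj (of_nat :: nat \<Rightarrow> 'a)"
  proof (rule injI)
    fix m n :: nat assume "(of_nat m :: 'a) = of_nat n"
    then have "(of_int (int m) :: 'a) = of_int (int n)" by simp
    then show "m = n" unfolding of_int_eq_iff_char_0[OF char] by simp
  qed
  have inf: "infinite ?Z"
  proof
    assume "finite ?Z"
    moreover have "range (of_nat :: nat \<Rightarrow> 'a) \<subseteq> ?Z" by (metis image_subsetI of_int_of_nat_eq rangeI)
    ultimately have "finite (range (of_nat :: nat \<Rightarrow> 'a))" using finite_subset by blast
    then show False using finite_imageD[OF _ inj] by simp
  qed
  have "1 \<in> adjoin_list ?Z ts"
    by (rule is_subringD(2)[OF is_subring_adjoin_list[OF is_subring_of_int]])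
  \<comment> \<open>Nothing needs to be inverted in the large ring, so \<open>h\<close> is 1; the
    integer \<open>c\<close> only excludes finitely many primes.\<close>
  from filtration_extend_list[OF is_subring_of_int inf this one_neq_zero] obtain c where c: "c \<in> ?Z - {0}"
    and cJ: "\<forall>J. filtration ?Z J \<and> unit_mod ?Z (J 1) c \<longrightarrow>
      (\<exists>J'. filtration (adjoin_list ?Z ts) J' \<and> unit_mod (adjoin_list ?Z ts) (J' 1) 1 \<and> J 1 \<subseteq> J' 1)"
    by (rule bexE)
  have "c \<in> ?Z" using c by simp
  then obtain z where z: "c = of_int z" by (rule rangeE)
  have "z \<noteq> 0" using c unfolding z by auto
  have "\<exists>J. filtration (adjoin_list ?Z ts) J \<and> of_nat l \<in> J 1" if l: "l > nat \<bar>z\<bar>" "prime l" for l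
  proof -
    have "\<not> int l dvd z" using l(1) \<open>z \<noteq> 0\<close> dvd_imp_le_int[of z "int l"] by auto
    then obtain J' where J': "filtration (adjoin_list ?Z ts) J'" "range (\<lambda>z. of_int (int l ^ 1 * z)) \<subseteq> J' 1"
      using cJ[unfolded z] filtration_int(1)[OF char l(2)] filtration_int(2)[OF char l(2)] by blast
    have "of_nat l \<in> range (\<lambda>z. of_int (int l ^ 1 * z) :: 'a)" by (intro image_eqI[of _ _ 1]) auto
    then show ?thesis using J' by blast
  qed
  then show ?thesis by blast
qed

section \<open>Filtrations over a finite prime field\<close>

lemma finite_polys_over:
  assumes "finite Z"
  shows "finite {f \<in> polys_over Z. Polynomial.degree f \<le> d}"
proof -
  have "{f \<in> polys_over Z. Polynomial.degree f \<le> d} \<subseteq> Poly ` {l. set l \<subseteq> Z \<and> length l = Suc d}"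
  proof
    fix f assume f: "f \<in> {f \<in> polys_over Z. Polynomial.degree f \<le> d}"
    let ?l = "map (Polynomial.coeff f) [0..<Suc d]"
    have "Polynomial.coeff f i = nth_default 0 ?l i" for i
    proof (cases "i < Suc d")
      case True then show ?thesis by (simp add: nth_default_def del: upt_Suc)
    next
      case False then show ?thesis using f by (simp add: nth_default_def coeff_eq_0 del: upt_Suc)
    qed
    then have "f = Poly ?l" by (intro poly_eqI) (simp add: coeff_Poly_eq del: upt_Suc)
    moreover have "set ?l \<subseteq> Z" using f by (auto simp: polys_over_def)
    ultimately show "f \<in> Poly ` {l. set l \<subseteq> Z \<and> length l = Suc d}" by (intro image_eqI[of _ _ ?l]) auto
  qed
  then show ?thesis using finite_subset finite_lists_length_eq[OF assms] by blast
qed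

lemma finite_range_of_int:
  assumes "CHAR('a::field) > 0"
  shows "finite (range of_int :: 'a set)"
proof -
  let ?p = "int CHAR('a)"
  have "of_int z = (of_int (z mod ?p) :: 'a)" for z
  proof -
    have "(of_int z :: 'a) = of_int (?p * (z div ?p) + z mod ?p)" by simp
    also have "\<dots> = of_nat CHAR('a) * of_int (z div ?p) + of_int (z mod ?p)" by (simp only: of_int_add of_int_mult of_int_of_nat_eq)
    also have "\<dots> = of_int (z mod ?p)" by simp
    finally show ?thesis .
  qed
  moreover have "z mod ?p \<in> {0..<?p}" for z using assms by simp
  ultimately have "(range of_int :: 'a set) \<subseteq> of_int ` {0..<?p}" by blast
  then show ?thesis using finite_subset by blast
qed

text \<open>Pseudo-division by \<open>f\<close> writes every power of \<open>x\<close> as the value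
  of a polynomial of bounded degree over \<open>Z\<close>, divided by an element of
  \<open>Z\<close>. There are finitely many such quotients, so two powers agree.\<close>

lemma algebraic_imp_root_of_unity:
  assumes Z: "is_subring Z" "finite Z" and f: "f \<in> polys_over Z" "poly f x = 0" "f \<noteq> 0" and x: "x \<noteq> 0"
  shows "\<exists>m>0. x ^ m = 1"
proof -
  let ?R = "{r \<in> polys_over Z. Polynomial.degree r \<le> Polynomial.degree f}"
  note I = is_subring_is_ideal[OF Z(1)]
  have "x ^ i \<in> (\<lambda>(r, a). poly r x / a) ` (?R \<times> Z)" for i
  proof -
    have "Polynomial.monom 1 i \<in> polys_over Z"
      by (rule polys_over_ideal(5)[OF I Z(1) is_subringD(2)[OF Z(1)]])
    from pseudo_division[OF Z(1) I f(1,3) this] obtain N q r where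
      r: "r \<in> polys_over Z" "smult (lead_coeff f ^ N) (Polynomial.monom 1 i) = q * f + r"
        "r = 0 \<or> Polynomial.degree r < Polynomial.degree f" by blast
    have "lead_coeff f ^ N * x ^ i = poly (smult (lead_coeff f ^ N) (Polynomial.monom 1 i)) x" by (simp add: poly_monom)
    also have "\<dots> = poly r x" unfolding r(2) using f(2) by simp
    finally have "x ^ i = poly r x / lead_coeff f ^ N" using f(3) by (simp add: field_simps)
    moreover have "lead_coeff f ^ N \<in> Z" by (rule is_subringD(7)[OF Z(1) polys_overD[OF f(1)]])
    moreover have "r \<in> ?R" using r(1,3) by auto
    ultimately show ?thesis by (intro image_eqI[of _ _ "(r, lead_coeff f ^ N)"]) auto
  qed
  then have "range (\<lambda>i. x ^ i) \<subseteq> (\<lambda>(r, a). poly r x / a) ` (?R \<times> Z)" by blast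
  moreover have "finite ((\<lambda>(r, a). poly r x / a) ` (?R \<times> Z))"
    using finite_polys_over[OF Z(2)] Z(2) by (intro finite_imageI finite_cartesian_product) auto
  ultimately have fin: "finite (range (\<lambda>i. x ^ i))" by (rule finite_subset)
  then have "\<not> inj (\<lambda>i::nat. x ^ i)" using finite_imageD by fastforce
  then obtain i j :: nat where "x ^ i = x ^ j" "i \<noteq> j" unfolding inj_def by blast
  then obtain i j where ij: "x ^ i = x ^ j" "i < j" by (metis nat_neq_iff)
  have "x ^ j = x ^ i * x ^ (j - i)" using ij(2) by (simp flip: power_add)
  then have "x ^ (j - i) = 1" using ij(1) x by simp
  then show ?thesis using ij(2) by (intro exI[of _ "j - i"]) auto
qed

text \<open>Over an algebraically closed field, absence of common roots is coprimality. The roots of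
  \<open>P\<close> are split off one at a time; each must be a root of \<open>y\<close>.\<close>

lemma no_common_root_dvd:
  fixes P f y :: "'a::alg_closed_field poly"
  assumes "P \<noteq> 0" "\<And>z. poly P z = 0 \<Longrightarrow> poly f z \<noteq> 0" "P dvd f * y"
  shows "P dvd y"
  using assms
proof (induction "Polynomial.degree P" arbitrary: P y)
  case 0
  then obtain c where "P = [:c:]" using degree_eq_zeroE by metis
  then show ?case using 0 by (auto simp: const_poly_dvd_iff dvd_field_iff)
next
  case (Suc d)
  have "Polynomial.degree P > 0" using Suc.hyps(2) by simp
  then obtain z where z: "poly P z = 0" using alg_closed_imp_poly_has_root by blast
  then have "[:- z, 1:] dvd P" using poly_eq_0_iff_dvd by blast
  then obtain P' where P': "P = [:- z, 1:] * P'" by (rule dvdE)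
  have P'0: "P' \<noteq> 0" using P' Suc.prems(1) by auto
  have "poly f z * poly y z = 0" using Suc.prems(3) z by (metis dvd_trans poly_eq_0_iff_dvd poly_mult)
  then have "poly y z = 0" using Suc.prems(2)[OF z] by simp
  then have "[:- z, 1:] dvd y" using poly_eq_0_iff_dvd by blast
  then obtain y' where y': "y = [:- z, 1:] * y'" by (rule dvdE)
  have "[:- z, 1:] * P' dvd [:- z, 1:] * (f * y')"
    using Suc.prems(3) unfolding P' y' by (simp only: mult.left_commute)
  then have "P' dvd f * y'" by (subst (asm) dvd_mult_cancel_left) auto
  moreover have "Polynomial.degree P = Suc (Polynomial.degree P')"
    unfolding P' using P'0 by (subst degree_mult_eq) auto
  then have "d = Polynomial.degree P'" using Suc.hyps(2) by simp
  moreover have "\<And>z. poly P' z = 0 \<Longrightarrow> poly f z \<noteq> 0" using Suc.prems(2) by (simp add: P')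
  ultimately have "P' dvd y'" using Suc.hyps(1) P'0 by blast
  then show ?case unfolding P' y' by (rule mult_dvd_mono[OF dvd_refl])
qed

context
  fixes Z :: "'a::field set" and x :: 'a and P :: "'a poly"
  assumes Z: "is_subring Z" "finite Z"
    and tr: "\<And>f. f \<in> polys_over Z \<Longrightarrow> poly f x = 0 \<Longrightarrow> f = 0"
    and P: "P \<in> polys_over Z" "lead_coeff P = 1" "Polynomial.degree P > 0"
begin

lemma principal_division:
  assumes D: "D \<in> polys_over Z" "lead_coeff D = 1" and f: "f \<in> polys_over Z"
  shows "\<exists>q\<in>polys_over Z. \<exists>r\<in>polys_over Z. f = q * D + r \<and> (r = 0 \<or> Polynomial.degree r < Polynomial.degree D)"
proof -
  have "D \<noteq> 0" using D(2) by auto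
  from pseudo_division[OF Z(1) is_subring_is_ideal[OF Z(1)] D(1) this f] D(2) show ?thesis by simp
qed

lemma principal_powers: "P ^ k \<in> polys_over Z" "lead_coeff (P ^ k) = 1"
proof -
  have one: "[:1:] \<in> polys_over Z"
    by (rule polys_over_ideal(6)[OF is_subring_is_ideal[OF Z(1)] Z(1) is_subringD(2)[OF Z(1)]])
  show "P ^ k \<in> polys_over Z"
  proof (induction k)
    case 0 then show ?case using one by (simp add: one_pCons)
  next
    case (Suc k) then show ?case using polys_over_mult[OF is_subring_is_ideal[OF Z(1)] P(1)] by simp
  qed
  show "lead_coeff (P ^ k) = 1" using P(2) by (simp add: lead_coeff_power)
qed

text \<open>By \<open>tr\<close> the ring Z[x] is a polynomial ring. Remainders modulo the monic
  power \<open>P ^ k\<close> have bounded degree and coefficients in a finite ring, which makes the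
  quotients finite.\<close>

lemma filtration_principal:
  "filtration (adjoin Z x) (\<lambda>k. (\<lambda>b. poly P x ^ k * b) ` adjoin Z x)"
proof -
  let ?B = "adjoin Z x" and ?\<phi> = "poly P x"
  let ?J = "\<lambda>k. (\<lambda>b. ?\<phi> ^ k * b) ` ?B"
  note I = is_subring_is_ideal[OF Z(1)]
  have B: "is_subring ?B" by (rule is_subring_adjoin[OF Z(1)])
  have \<phi>: "?\<phi> \<in> ?B" by (rule adjoinI[OF P(1)])
  have "is_ideal ?B (?J k)" for k
    unfolding is_ideal_def
  proof (intro conjI ballI)
    show "?J k \<subseteq> ?B" by (intro image_subsetI is_subringD(4)[OF B is_subringD(7)[OF B \<phi>]])
    show "0 \<in> ?J k" by (intro image_eqI[of _ _ 0] is_subringD(1)[OF B]) simp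
    fix u v assume "u \<in> ?J k" "v \<in> ?J k"
    then obtain a b where ab: "u = ?\<phi> ^ k * a" "v = ?\<phi> ^ k * b" "a \<in> ?B" "b \<in> ?B" by blast
    show "u - v \<in> ?J k" by (intro image_eqI[of _ _ "a - b"] is_subringD(3)[OF B] ab) (simp add: ab algebra_simps)
  next
    fix u v assume "u \<in> ?B" "v \<in> ?J k"
    then obtain b where ab: "v = ?\<phi> ^ k * b" "u \<in> ?B" "b \<in> ?B" by blast
    show "u * v \<in> ?J k" by (intro image_eqI[of _ _ "u * b"] is_subringD(4)[OF B] ab) (simp add: ab algebra_simps)
  qed
  moreover have "cofinite_in ?B (?J k)" for k
    unfolding cofinite_in_def
  proof (intro exI[of _ "(\<lambda>r. poly r x) ` {r \<in> polys_over Z. Polynomial.degree r \<le> Polynomial.degree (P ^ k)}"] conjI ballI)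
    show "finite ((\<lambda>r. poly r x) ` {r \<in> polys_over Z. Polynomial.degree r \<le> Polynomial.degree (P ^ k)})"
      by (intro finite_imageI finite_polys_over Z)
    show "(\<lambda>r. poly r x) ` {r \<in> polys_over Z. Polynomial.degree r \<le> Polynomial.degree (P ^ k)} \<subseteq> ?B"
      by (auto intro: adjoinI)
    fix a assume "a \<in> ?B"
    then obtain f where f: "f \<in> polys_over Z" "a = poly f x" by (rule adjoinE)
    obtain q r where qr: "q \<in> polys_over Z" "r \<in> polys_over Z" "f = q * P ^ k + r"
      "r = 0 \<or> Polynomial.degree r < Polynomial.degree (P ^ k)"
      using principal_division[OF principal_powers f(1)] by blast
    have "a - poly r x = ?\<phi> ^ k * poly q x" unfolding f(2) qr(3) by simp
    then have "a - poly r x \<in> ?J k" using adjoinI[OF qr(1), of x] by blast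
    moreover have "poly r x \<in> (\<lambda>r. poly r x) ` {r \<in> polys_over Z. Polynomial.degree r \<le> Polynomial.degree (P ^ k)}"
      using qr(2,4) by auto
    ultimately show "\<exists>t\<in>(\<lambda>r. poly r x) ` {r \<in> polys_over Z. Polynomial.degree r \<le> Polynomial.degree (P ^ k)}. a - t \<in> ?J k"
      by blast
  qed
  moreover have "?J (Suc k) \<subseteq> ?J k" for k
  proof
    fix u assume "u \<in> ?J (Suc k)"
    then obtain b where b: "b \<in> ?B" "u = ?\<phi> ^ Suc k * b" by blast
    show "u \<in> ?J k" by (intro image_eqI[of _ _ "?\<phi> * b"] is_subringD(4)[OF B \<phi> b(1)]) (simp add: b)
  qed
  moreover have "u * v \<in> ?J (i + j)" if uv: "u \<in> ?J i" "v \<in> ?J j" for u v i j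
  proof -
    obtain a b where ab: "u = ?\<phi> ^ i * a" "v = ?\<phi> ^ j * b" "a \<in> ?B" "b \<in> ?B" using uv by blast
    show ?thesis by (intro image_eqI[of _ _ "a * b"] is_subringD(4)[OF B] ab) (simp add: ab power_add algebra_simps)
  qed
  moreover have "(\<Inter>k. ?J k) \<subseteq> {0}"
  proof
    fix u assume u: "u \<in> (\<Inter>k. ?J k)"
    then have "u \<in> ?J 0" by blast
    then have "u \<in> ?B" by auto
    then obtain f where f: "f \<in> polys_over Z" "u = poly f x" by (rule adjoinE)
    \<comment> \<open>A nonzero multiple of \<open>P ^ ?k\<close> has degree at least
      \<open>?k\<close>, more than the degree of \<open>f\<close>.\<close>
    let ?k = "Suc (Polynomial.degree f)"
    have "u \<in> ?J ?k" using u by blast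
    then obtain b where b: "b \<in> ?B" "u = ?\<phi> ^ ?k * b" by blast
    obtain g where g: "g \<in> polys_over Z" "b = poly g x" using b(1) by (rule adjoinE)
    have "poly (f - P ^ ?k * g) x = 0" using f(2) b(2) g(2) by simp
    moreover have "f - P ^ ?k * g \<in> polys_over Z"
      by (intro polys_over_ideal(3)[OF I Z(1)] f polys_over_mult[OF I] principal_powers g)
    ultimately have "f - P ^ ?k * g = 0" using tr by blast
    then have fP: "f = P ^ ?k * g" by simp
    have "g = 0"
    proof (rule ccontr)
      assume "g \<noteq> 0"
      have "P \<noteq> 0" using P(3) by auto
      then have "Polynomial.degree (P ^ ?k * g) = ?k * Polynomial.degree P + Polynomial.degree g"
        using \<open>g \<noteq> 0\<close> by (simp add: degree_mult_eq degree_power_eq)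
      then have "Polynomial.degree f \<ge> ?k * 1" using P(3) fP by (metis Suc_leI One_nat_def le_add1 le_trans mult_le_mono2)
      then show False by simp
    qed
    then show "u \<in> {0}" using f(2) fP by simp
  qed
  ultimately show ?thesis unfolding filtration_def using B by simp
qed

end

text \<open>Having no root in common with \<open>P\<close>, \<open>f\<close> is not a zero divisor
  modulo \<open>P\<close>. In the finite quotient two powers of its value coincide, and cancelling
  shows that a positive power is 1.\<close>

lemma unit_mod_principal:
  fixes P :: "'a::alg_closed_field poly"
  assumes Z: "is_subring Z" "finite Z"
    and tr: "\<And>f. f \<in> polys_over Z \<Longrightarrow> poly f x = 0 \<Longrightarrow> f = 0"
    and P: "P \<in> polys_over Z" "lead_coeff P = 1" "Polynomial.degree P > 0"
    and f: "f \<in> polys_over Z" and roots: "\<And>z. poly P z = 0 \<Longrightarrow> poly f z \<noteq> 0"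
  shows "unit_mod (adjoin Z x) ((\<lambda>b. poly P x ^ 1 * b) ` adjoin Z x) (poly f x)"
proof -
  let ?B = "adjoin Z x" and ?\<phi> = "poly P x" and ?c = "poly f x"
  let ?I = "(\<lambda>b. ?\<phi> ^ 1 * b) ` ?B"
  note I = is_subring_is_ideal[OF Z(1)]
  have fil: "filtration ?B (\<lambda>k. (\<lambda>b. ?\<phi> ^ k * b) ` ?B)" by (rule filtration_principal[OF Z tr P])
  have B: "is_subring ?B" by (rule is_subring_adjoin[OF Z(1)])
  have idl: "is_ideal ?B ?I" using filtrationD(3)[OF fil, of 1] .
  have cB: "?c \<in> ?B" by (rule adjoinI[OF f])
  have P0: "P \<noteq> 0" using P(3) by auto
  have cancel: "b \<in> ?I" if b: "b \<in> ?B" and cb: "?c * b \<in> ?I" for b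
  proof -
    obtain y where y: "y \<in> polys_over Z" "b = poly y x" using b by (rule adjoinE)
    obtain d where d: "d \<in> ?B" "?c * b = ?\<phi> ^ 1 * d" using cb by blast
    obtain q where q: "q \<in> polys_over Z" "d = poly q x" using d(1) by (rule adjoinE)
    have "poly (f * y - P * q) x = 0" using d(2) y q by simp
    moreover have "f * y - P * q \<in> polys_over Z"
      by (intro polys_over_ideal(3)[OF I Z(1)] polys_over_mult[OF I] f y P q)
    ultimately have "f * y - P * q = 0" using tr by blast
    then have "P dvd f * y" by simp
    then have Py: "P dvd y" using no_common_root_dvd[OF P0, of f y] roots by blast
    obtain q' r where qr: "q' \<in> polys_over Z" "r \<in> polys_over Z" "y = q' * P + r"
      "r = 0 \<or> Polynomial.degree r < Polynomial.degree P"
      using principal_division[OF Z tr P P(1,2) y(1)] by blast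
    have "P dvd r" using Py qr(3) by (simp add: dvd_add_right_iff)
    have "r = 0"
    proof (rule ccontr)
      assume "r \<noteq> 0"
      then have "Polynomial.degree P \<le> Polynomial.degree r" using dvd_imp_degree_le[OF \<open>P dvd r\<close>] by blast
      then show False using qr(4) \<open>r \<noteq> 0\<close> by simp
    qed
    then have "b = ?\<phi> ^ 1 * poly q' x" using y(2) qr(3) by simp
    then show ?thesis using adjoinI[OF qr(1), of x] by blast
  qed
  have cancel': "b \<in> ?I" if "b \<in> ?B" "?c ^ i * b \<in> ?I" for b i
    using that(2)
  proof (induction i)
    case (Suc i)
    have "?c * (?c ^ i * b) \<in> ?I" using Suc.prems by (simp only: power_Suc mult.assoc)
    then have "?c ^ i * b \<in> ?I" by (rule cancel[OF is_subringD(4)[OF B is_subringD(7)[OF B cB] that(1)]])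
    then show ?case by (rule Suc.IH)
  qed simp
  obtain T where T: "finite T" "T \<subseteq> ?B" "\<And>a. a \<in> ?B \<Longrightarrow> \<exists>t\<in>T. a - t \<in> ?I"
    using filtrationD(4)[OF fil, of 1] unfolding cofinite_in_def by blast
  have "\<forall>i. \<exists>t\<in>T. ?c ^ i - t \<in> ?I" by (intro allI T(3) is_subringD(7)[OF B cB])
  then obtain \<tau> where \<tau>: "\<And>i. \<tau> i \<in> T" "\<And>i. ?c ^ i - \<tau> i \<in> ?I" by metis
  have "range \<tau> \<subseteq> T" using \<tau>(1) by blast
  then have "finite (range \<tau>)" using T(1) finite_subset by blast
  then have "\<not> inj (\<tau> :: nat \<Rightarrow> 'a)" using finite_imageD by fastforce
  then obtain i' j' :: nat where ij': "\<tau> i' = \<tau> j'" "i' \<noteq> j'" unfolding inj_def by blast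
  define i where "i = min i' j'"
  define j where "j = max i' j'"
  have ij: "\<tau> i = \<tau> j" "i < j" using ij' by (auto simp: i_def j_def min_def max_def)
  have "(?c ^ j - \<tau> j) - (?c ^ i - \<tau> i) \<in> ?I" by (rule is_idealD(3)[OF idl \<tau>(2) \<tau>(2)])
  moreover have "(?c ^ j - \<tau> j) - (?c ^ i - \<tau> i) = ?c ^ i * (?c ^ (j - i) - 1)"
    using ij by (simp add: algebra_simps flip: power_add)
  ultimately have "?c ^ i * (?c ^ (j - i) - 1) \<in> ?I" by simp
  then have "?c ^ (j - i) - 1 \<in> ?I"
    by (rule cancel'[rotated]) (intro is_subringD(2,3)[OF B] is_subringD(7)[OF B cB])
  moreover have "?c ^ (j - i) = ?c * ?c ^ (j - i - 1)" using ij(2) by (metis power_minus_mult mult.commute zero_less_diff)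
  ultimately have "?c * ?c ^ (j - i - 1) - 1 \<in> ?I" by simp
  then show ?thesis unfolding unit_mod_def using cB is_subringD(7)[OF B cB, of "j - i - 1"] by blast
qed

text \<open>Take P = 1 + X + ... + X^(l-1). Modulo \<open>poly P x\<close> one has
  \<open>x ^ l = 1\<close>. For large \<open>l\<close> the polynomial \<open>P\<close> has no root
  in common with \<open>f\<close>, where \<open>c = poly f x\<close>; so \<open>c\<close> is a unit,
  and the \<open>P\<close>-adic filtration extends from Z[x] to \<open>A\<close>.\<close>

lemma filtration_char_pos:
  fixes x :: "'a::alg_closed_field"
  assumes char: "CHAR('a) > 0" and x: "x \<noteq> 0" and nr: "\<And>m. m > 0 \<Longrightarrow> x ^ m \<noteq> 1"
    and A: "A = adjoin_list (adjoin (range of_int) x) ts" and h: "h \<in> A" "h \<noteq> 0"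
  shows "\<exists>b. \<forall>l>b. prime (l::nat) \<longrightarrow>
    (\<exists>J. filtration A J \<and> unit_mod A (J 1) h \<and> x ^ l - 1 \<in> J 1 \<and> x - 1 \<notin> J 1)"
proof -
  let ?Z = "range of_int :: 'a set"
  let ?B = "adjoin ?Z x"
  note Z = is_subring_of_int[where 'a = 'a] finite_range_of_int[OF char]
  have tr: "f = 0" if "f \<in> polys_over ?Z" "poly f x = 0" for f
    using algebraic_imp_root_of_unity[OF Z that _ x] nr by blast
  have B: "is_subring ?B" by (rule is_subring_adjoin[OF Z(1)])
  have xB: "x \<in> ?B" by (rule adjoin_incl(2)[OF Z(1)])
  have infB: "infinite ?B"
  proof
    assume fin: "finite ?B"
    have "range (\<lambda>i. x ^ i) \<subseteq> ?B" using is_subringD(7)[OF B xB] by blast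
    then have "finite (range (\<lambda>i::nat. x ^ i))" using fin finite_subset by blast
    then have "\<not> inj (\<lambda>i::nat. x ^ i)" using finite_imageD by fastforce
    then obtain i j :: nat where "x ^ i = x ^ j" "i \<noteq> j" unfolding inj_def by blast
    then obtain i j where ij: "x ^ i = x ^ j" "i < j" by (metis nat_neq_iff)
    have "x ^ j = x ^ i * x ^ (j - i)" using ij(2) by (simp flip: power_add)
    then have "x ^ (j - i) = 1" using ij(1) x by simp
    then show False using nr[of "j - i"] ij(2) by simp
  qed
  obtain c where c: "c \<in> ?B - {0}" and cJ: "\<forall>J. filtration ?B J \<and> unit_mod ?B (J 1) c \<longrightarrow>
      (\<exists>J'. filtration A J' \<and> unit_mod A (J' 1) h \<and> J 1 \<subseteq> J' 1)"
    using filtration_extend_list[OF B infB h(1)[unfolded A] h(2)] unfolding A by (rule bexE)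
  have "c \<in> ?B" using c by simp
  then obtain f where f: "f \<in> polys_over ?Z" "c = poly f x" by (rule adjoinE)
  have "f \<noteq> 0" using c f by auto
  then have finroots: "finite {z. poly f z = 0}" by (rule poly_roots_finite)
  \<comment> \<open>A root z of \<open>f\<close> is a root of \<open>P\<close> for one prime
    \<open>l\<close> at most: two prime exponents would force z = 1, where \<open>P\<close> takes
    the value \<open>l\<close>, nonzero for \<open>l\<close> above the characteristic. If z has no
    prime exponent, \<open>bad z\<close> is some unspecified number, which does not harm the
    bound.\<close>
  define bad where "bad z = (LEAST l::nat. prime l \<and> z ^ l = 1)" for z :: 'a
  obtain b where b: "\<And>z. poly f z = 0 \<Longrightarrow> bad z \<le> b" "CHAR('a) \<le> b"
  proof
    let ?S = "insert CHAR('a) (bad ` {z. poly f z = 0})"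
    have "finite ?S" using finroots by simp
    then show "\<And>z. poly f z = 0 \<Longrightarrow> bad z \<le> Max ?S" "CHAR('a) \<le> Max ?S" by (auto intro: Max_ge)
  qed
  have "\<exists>J. filtration A J \<and> unit_mod A (J 1) h \<and> x ^ l - 1 \<in> J 1 \<and> x - 1 \<notin> J 1" if l: "l > b" "prime l" for l
  proof -
    define P :: "'a poly" where "P = (\<Sum>i<l. Polynomial.monom 1 i)"
    have l1: "l > 1" using prime_gt_1_nat[OF l(2)] .
    have coeffP: "Polynomial.coeff P i = (if i < l then 1 else 0)" for i
      by (simp add: P_def coeff_sum)
    have degP: "Polynomial.degree P = l - 1"
    proof (rule antisym)
      show "Polynomial.degree P \<le> l - 1" by (rule degree_le) (use l1 in \<open>auto simp: coeffP\<close>)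
      show "l - 1 \<le> Polynomial.degree P" by (rule le_degree) (use l1 in \<open>auto simp: coeffP\<close>)
    qed
    have P: "P \<in> polys_over ?Z" "lead_coeff P = 1" "Polynomial.degree P > 0"
      using l1 is_subringD(1,2)[OF Z(1)] by (auto simp: polys_over_def coeffP degP)
    have polyP: "(z - 1) * poly P z = z ^ l - 1" for z
      by (simp add: P_def poly_sum poly_monom power_diff_1_eq)
    have l0: "(of_nat l :: 'a) \<noteq> 0"
    proof
      assume "(of_nat l :: 'a) = 0"
      then have "CHAR('a) dvd l" by (simp add: of_nat_eq_0_iff_char_dvd)
      then have "CHAR('a) = 1 \<or> CHAR('a) = l" using l(2) by (auto simp: prime_nat_iff)
      then show False using l(1) b(2) by auto
    qed
    have roots: "poly f z \<noteq> 0" if z: "poly P z = 0" for z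
    proof
      assume "poly f z = 0"
      then have "bad z < l" using b(1) l(1) by fastforce
      have zl: "z ^ l = 1" using polyP[of z] z by simp
      have "prime (bad z) \<and> z ^ bad z = 1" unfolding bad_def by (rule LeastI[of _ l]) (use l zl in simp)
      then have bz: "prime (bad z)" "z ^ bad z = 1" by auto
      have "coprime (bad z) l" using bz(1) l(2) \<open>bad z < l\<close> by (simp add: primes_coprime)
      moreover have "bad z \<noteq> 0" using bz(1) by auto
      ultimately obtain u v where uv: "bad z * u = l * v + 1" using bezout_nat[of "bad z" l] by auto
      have "z ^ (bad z * u) = 1" using bz(2) by (simp add: power_mult)
      moreover have "z ^ (l * v + 1) = z" using zl by (simp add: power_mult)
      ultimately have "z = 1" using uv by simp
      then have "poly P z = of_nat l" by (simp add: P_def poly_sum poly_monom)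
      then show False using z l0 by simp
    qed
    have fil: "filtration ?B (\<lambda>k. (\<lambda>b. poly P x ^ k * b) ` ?B)" by (rule filtration_principal[OF Z tr P])
    have unit: "unit_mod ?B ((\<lambda>b. poly P x ^ 1 * b) ` ?B) c"
      unfolding f(2) by (rule unit_mod_principal[OF Z tr P f(1) roots])
    from cJ fil unit obtain J where J: "filtration A J" "unit_mod A (J 1) h" "(\<lambda>b. poly P x ^ 1 * b) ` ?B \<subseteq> J 1"
      by blast
    have "x - 1 \<in> ?B" by (rule is_subringD(3)[OF B xB is_subringD(2)[OF B]])
    then have "poly P x ^ 1 * (x - 1) \<in> J 1" using J(3) by blast
    then have 1: "x ^ l - 1 \<in> J 1" using polyP[of x] by (simp add: mult.commute)
    have "poly P x ^ 1 * 1 \<in> J 1" using J(3) is_subringD(2)[OF B] by blast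
    then have PJ: "poly P x \<in> J 1" by simp
    have subA: "is_subring A" by (rule filtrationD(1)[OF J(1)])
    note J1 = filtrationD(3)[OF J(1), of 1]
    have BA: "?B \<subseteq> A" unfolding A by (rule adjoin_list_incl(1)[OF B])
    have "x - 1 \<notin> J 1"
    proof
      \<comment> \<open>Then all powers of \<open>x\<close> are 1 modulo \<open>J 1\<close>, so
        \<open>poly P x\<close>, which vanishes there, is also \<open>l\<close>. As \<open>l\<close>
        is prime to the characteristic, 1 would lie in \<open>J 1\<close>.\<close>
      assume x1: "x - 1 \<in> J 1"
      have xA: "x \<in> A" using xB BA by blast
      have "x ^ i - 1 \<in> J 1" for i
        unfolding power_diff_1_eq
        by (rule is_idealD(5)[OF J1 _ x1]) (intro is_subring_sum[OF subA] is_subringD(7)[OF subA xA])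
      then have sJ: "(\<Sum>i<l. x ^ i - 1) \<in> J 1" by (intro is_ideal_sum[OF J1])
      have sP: "(\<Sum>i<l. x ^ i - 1) = poly P x - of_nat l"
        by (simp add: P_def poly_sum poly_monom sum_subtractf)
      have "poly P x - (poly P x - of_nat l) \<in> J 1" by (rule is_idealD(3)[OF J1 PJ sJ[unfolded sP]])
      then have lJ: "of_nat l \<in> J 1" by (simp only: diff_diff_eq2 add_diff_cancel_left')
      have "coprime (int l) (int CHAR('a))"
      proof -
        have "\<not> l dvd CHAR('a)" using l(1) b(2) char by (auto dest: dvd_imp_le)
        then show ?thesis using l(2) by (simp add: prime_imp_coprime)
      qed
      then obtain u v where uv: "u * int l + v * int CHAR('a) = 1"
        using bezout_int[of "int l" "int CHAR('a)"] by (auto simp: coprime_iff_gcd_eq_1)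
      have "(of_int (u * int l + v * int CHAR('a)) :: 'a) = of_int u * of_nat l" by simp
      then have "of_int u * of_nat l = (1::'a)" unfolding uv by simp
      moreover have "of_int u \<in> A" using BA adjoin_incl(1)[OF Z(1), of x] by blast
      ultimately have "1 \<in> J 1" using is_idealD(4)[OF J1 _ lJ, of "of_int u"] by simp
      then show False using filtration_proper[OF J(1)] by simp
    qed
    then show ?thesis using J 1 by blast
  qed
  then show ?thesis by blast
qed

section \<open>Congruence subgroups of matrix groups\<close>

lemma finite_image_factor:
  assumes "finite (f ` S)" "\<And>x y. x \<in> S \<Longrightarrow> y \<in> S \<Longrightarrow> f x = f y \<Longrightarrow> g x = g y"
  shows "finite (g ` S)"
proof -
  have "g ` S \<subseteq> (\<lambda>z. g (SOME x. x \<in> S \<and> f x = z)) ` f ` S"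
  proof
    fix y assume "y \<in> g ` S"
    then obtain x where x: "x \<in> S" "y = g x" by blast
    let ?x = "SOME x'. x' \<in> S \<and> f x' = f x"
    have "?x \<in> S \<and> f ?x = f x" by (rule someI[of _ x]) (use x in simp)
    then have "y = g ?x" using assms(2)[of x ?x] x by simp
    then show "y \<in> (\<lambda>z. g (SOME x. x \<in> S \<and> f x = z)) ` f ` S" using x(1) by blast
  qed
  then show ?thesis using assms(1) finite_subset by blast
qed

lemma (in group) rcosets_image: "rcosets M = (\<lambda>x. M #> x) ` carrier G"
  by (auto simp: RCOSETS_def)

lemma (in group) finite_index_inter:
  assumes K: "K \<lhd> G" "finite (rcosets K)" and M: "M \<lhd> G" "finite (rcosets M)"
  shows "K \<inter> M \<lhd> G" "finite (rcosets (K \<inter> M))"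
proof -
  show N: "K \<inter> M \<lhd> G" by (rule normal_subgroup_intersect[OF K(1) M(1)])
  note sub = normal_imp_subgroup[OF K(1)] normal_imp_subgroup[OF M(1)] normal_imp_subgroup[OF N]
  show "finite (rcosets (K \<inter> M))"
    unfolding rcosets_image
  proof (rule finite_image_factor[where f = "\<lambda>x. (K #> x, M #> x)"])
    have "(\<lambda>x. (K #> x, M #> x)) ` carrier G \<subseteq> (rcosets K) \<times> (rcosets M)" by (auto simp: rcosets_image)
    then show "finite ((\<lambda>x. (K #> x, M #> x)) ` carrier G)" using K(2) M(2) finite_subset by blast
    fix x y assume xy: "x \<in> carrier G" "y \<in> carrier G" "(K #> x, M #> x) = (K #> y, M #> y)"
    then have "x \<otimes> inv y \<in> K" "x \<otimes> inv y \<in> M"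
      using coset_eq_iff[OF sub(1) xy(1,2)] coset_eq_iff[OF sub(2) xy(1,2)] by auto
    then show "(K \<inter> M) #> x = (K \<inter> M) #> y" using coset_eq_iff[OF sub(3) xy(1,2)] by simp
  qed
qed

text \<open>Lagrange's theorem in the image of \<open>K\<close> in G/M, whose order is
  \<open>coset_index G K M\<close>.\<close>

lemma (in group) power_coset_index:
  assumes M: "M \<lhd> G" "finite (rcosets M)" and K: "subgroup K G" and g: "g \<in> K"
  shows "g [^] coset_index G K M \<in> M"
proof -
  interpret M: normal M G by (rule M(1))
  define Q where "Q = G Mod M"
  interpret Q: group Q unfolding Q_def by (rule M.factorgroup_is_group)
  have q: "group_hom G Q (\<lambda>x. M #> x)"
    unfolding group_hom_def group_hom_axioms_def
    using is_group Q.is_group M.r_coset_hom_Mod by (simp add: Q_def)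
  let ?K = "(\<lambda>x. M #> x) ` K"
  have subK: "subgroup ?K Q" by (rule group_hom.subgroup_img_is_subgroup[OF q K])
  have gK: "group (Q\<lparr>carrier := ?K\<rparr>)" by (rule subgroup.subgroup_is_group[OF subK Q.is_group])
  have gc: "g \<in> carrier G" by (rule subgroup.mem_carrier[OF K g])
  have "(M #> g) [^]\<^bsub>Q\<lparr>carrier := ?K\<rparr>\<^esub> Coset.order (Q\<lparr>carrier := ?K\<rparr>) = \<one>\<^bsub>Q\<lparr>carrier := ?K\<rparr>\<^esub>"
    by (rule group.pow_order_eq_1[OF gK]) (use g in auto)
  then have "(M #> g) [^]\<^bsub>Q\<^esub> coset_index G K M = M"
    by (simp add: Coset.order_def coset_index_def nat_pow_def Q_def)
  moreover have "(M #> g) [^]\<^bsub>Q\<^esub> (m::nat) = M #> (g [^] m)" for m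
    using group_hom.hom_nat_pow[OF q gc] by simp
  ultimately have "M #> (g [^] coset_index G K M) = M" by simp
  then show ?thesis using rcos_self[OF nat_pow_closed[OF gc] M.subgroup_axioms] by metis
qed

text \<open>A faithful representation. Entries as plain functions let the field be enlarged
  entrywise and the same \<rho> be used for a subgroup.\<close>

locale matrix_group = group G for G :: "('g, 'b) monoid_scheme" (structure) +
  fixes n :: nat and \<rho> :: "'g \<Rightarrow> nat \<Rightarrow> nat \<Rightarrow> 'a::field"
  assumes \<rho>_mult: "\<And>g h i j. g \<in> carrier G \<Longrightarrow> h \<in> carrier G \<Longrightarrow> i < n \<Longrightarrow> j < n \<Longrightarrow>
      \<rho> (g \<otimes> h) i j = (\<Sum>k<n. \<rho> g i k * \<rho> h k j)"
    and \<rho>_one: "\<And>i j. i < n \<Longrightarrow> j < n \<Longrightarrow> \<rho> \<one> i j = (if i = j then 1 else 0)"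
    and \<rho>_inj: "\<And>g. g \<in> carrier G \<Longrightarrow> (\<And>i j. i < n \<Longrightarrow> j < n \<Longrightarrow> \<rho> g i j = (if i = j then 1 else 0)) \<Longrightarrow> g = \<one>"
begin

definition congruent :: "'a set \<Rightarrow> 'g \<Rightarrow> 'g \<Rightarrow> bool" where
  "congruent I g h \<longleftrightarrow> (\<forall>i<n. \<forall>j<n. \<rho> g i j - \<rho> h i j \<in> I)"

text \<open>The kernel of reduction modulo \<open>I\<close>, written without a quotient
  ring.\<close>

definition congruence_subgroup :: "'a set \<Rightarrow> 'g set" where
  "congruence_subgroup I = {g \<in> carrier G. congruent I g \<one>}"

definition entries_in :: "'a set \<Rightarrow> 'g set \<Rightarrow> bool" where
  "entries_in A S \<longleftrightarrow> (\<forall>g\<in>S. \<forall>i<n. \<forall>j<n. \<rho> g i j \<in> A)"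

text \<open>The inverses of the generators are covered separately, because the inverse of a matrix
  over \<open>A\<close> may have entries outside \<open>A\<close>.\<close>

lemma entries_in_generate:
  assumes A: "is_subring A" and S: "S \<subseteq> carrier G" "entries_in A S" "entries_in A (m_inv G ` S)"
  shows "entries_in A (generate G S)"
proof -
  have "\<forall>i<n. \<forall>j<n. \<rho> g i j \<in> A" if "g \<in> generate G S" for g
    using that
  proof (induction rule: generate.induct)
    case one
    then show ?case using is_subringD(1,2)[OF A] by (simp add: \<rho>_one)
  next
    case (incl h) then show ?case using S(2) by (simp add: entries_in_def)
  next
    case (inv h) then show ?case using S(3) by (simp add: entries_in_def)
  next
    case (eng h1 h2)
    have c: "h1 \<in> carrier G" "h2 \<in> carrier G" using eng.hyps generate_in_carrier[OF S(1)] by auto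
    show ?case
    proof (intro allI impI)
      fix i j assume ij: "i < n" "j < n"
      show "\<rho> (h1 \<otimes> h2) i j \<in> A" unfolding \<rho>_mult[OF c ij]
        by (rule is_subring_sum[OF A]) (use eng.IH ij is_subringD(4)[OF A] in auto)
    qed
  qed
  then show ?thesis by (simp add: entries_in_def)
qed

context
  fixes A I
  assumes A: "is_subring A" and I: "is_ideal A I" and ent: "entries_in A (carrier G)"
begin

lemma congruent_refl: "congruent I g g"
  using is_idealD(1)[OF I] by (simp add: congruent_def)

lemma congruent_sym: "congruent I g h \<Longrightarrow> congruent I h g"
  unfolding congruent_def
proof (intro allI impI)
  fix i j assume h: "\<forall>i<n. \<forall>j<n. \<rho> g i j - \<rho> h i j \<in> I" and ij: "i < n" "j < n"
  have "- (\<rho> g i j - \<rho> h i j) \<in> I" by (rule is_idealD(6)[OF I]) (use h ij in blast)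
  then show "\<rho> h i j - \<rho> g i j \<in> I" by simp
qed

lemma congruent_trans: "congruent I g h \<Longrightarrow> congruent I h k \<Longrightarrow> congruent I g k"
  unfolding congruent_def
proof (intro allI impI)
  fix i j assume h: "\<forall>i<n. \<forall>j<n. \<rho> g i j - \<rho> h i j \<in> I" "\<forall>i<n. \<forall>j<n. \<rho> h i j - \<rho> k i j \<in> I" and ij: "i < n" "j < n"
  have "(\<rho> g i j - \<rho> h i j) + (\<rho> h i j - \<rho> k i j) \<in> I" by (rule is_idealD(7)[OF I]) (use h ij in auto)
  then show "\<rho> g i j - \<rho> k i j \<in> I" by simp
qed

lemma congruent_mult_left:
  assumes "x \<in> carrier G" "g \<in> carrier G" "h \<in> carrier G" "congruent I g h"
  shows "congruent I (x \<otimes> g) (x \<otimes> h)"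
  unfolding congruent_def
proof (intro allI impI)
  fix i j assume ij: "i < n" "j < n"
  have "\<rho> (x \<otimes> g) i j - \<rho> (x \<otimes> h) i j = (\<Sum>k<n. \<rho> x i k * (\<rho> g k j - \<rho> h k j))"
    using assms ij by (simp add: \<rho>_mult sum_subtractf algebra_simps)
  also have "\<dots> \<in> I"
    by (rule is_ideal_sum[OF I], rule is_idealD(4)[OF I])
      (use assms ij ent in \<open>auto simp: congruent_def entries_in_def\<close>)
  finally show "\<rho> (x \<otimes> g) i j - \<rho> (x \<otimes> h) i j \<in> I" .
qed

lemma congruent_mult_right:
  assumes "x \<in> carrier G" "g \<in> carrier G" "h \<in> carrier G" "congruent I g h"
  shows "congruent I (g \<otimes> x) (h \<otimes> x)"
  unfolding congruent_def
proof (intro allI impI)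
  fix i j assume ij: "i < n" "j < n"
  have "\<rho> (g \<otimes> x) i j - \<rho> (h \<otimes> x) i j = (\<Sum>k<n. (\<rho> g i k - \<rho> h i k) * \<rho> x k j)"
    using assms ij by (simp add: \<rho>_mult sum_subtractf algebra_simps)
  also have "\<dots> \<in> I"
    by (rule is_ideal_sum[OF I], rule is_idealD(5)[OF I])
      (use assms ij ent in \<open>auto simp: congruent_def entries_in_def\<close>)
  finally show "\<rho> (g \<otimes> x) i j - \<rho> (h \<otimes> x) i j \<in> I" .
qed

lemma congruence_subgroup_normal: "congruence_subgroup I \<lhd> G"
  unfolding normal_inv_iff
proof (intro conjI ballI)
  show "subgroup (congruence_subgroup I) G"
  proof (rule subgroupI)
    show "congruence_subgroup I \<subseteq> carrier G" by (auto simp: congruence_subgroup_def)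
    have "\<one> \<in> congruence_subgroup I" by (simp add: congruence_subgroup_def congruent_refl)
    then show "congruence_subgroup I \<noteq> {}" by blast
    fix g assume g: "g \<in> congruence_subgroup I"
    then have gc: "g \<in> carrier G" "congruent I g \<one>" by (auto simp: congruence_subgroup_def)
    have "congruent I (inv g \<otimes> g) (inv g \<otimes> \<one>)" by (rule congruent_mult_left) (use gc in auto)
    then have "congruent I (inv g) \<one>" using gc congruent_sym by simp
    then show "inv g \<in> congruence_subgroup I" using gc by (simp add: congruence_subgroup_def)
    fix h assume h: "h \<in> congruence_subgroup I"
    then have hc: "h \<in> carrier G" "congruent I h \<one>" by (auto simp: congruence_subgroup_def)
    have "congruent I (g \<otimes> h) (\<one> \<otimes> h)" by (rule congruent_mult_right) (use gc hc in auto)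
    then have "congruent I (g \<otimes> h) \<one>" using hc congruent_trans by simp
    then show "g \<otimes> h \<in> congruence_subgroup I" using gc hc by (simp add: congruence_subgroup_def)
  qed
  fix x g assume x: "x \<in> carrier G" and g: "g \<in> congruence_subgroup I"
  then have gc: "g \<in> carrier G" "congruent I g \<one>" by (auto simp: congruence_subgroup_def)
  have "congruent I (x \<otimes> g) (x \<otimes> \<one>)" by (rule congruent_mult_left) (use gc x in auto)
  then have "congruent I (x \<otimes> g \<otimes> inv x) (x \<otimes> \<one> \<otimes> inv x)" by (intro congruent_mult_right) (use gc x in auto)
  then show "x \<otimes> g \<otimes> inv x \<in> congruence_subgroup I" using x gc by (simp add: congruence_subgroup_def)
qed

text \<open>Replacing entries by representatives modulo \<open>I\<close> leaves finitely many
  patterns, and elements with the same pattern are congruent.\<close>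

lemma congruence_subgroup_finite_index:
  assumes "cofinite_in A I"
  shows "finite (rcosets (congruence_subgroup I))"
proof -
  obtain T where T: "finite T" "\<And>a. a \<in> A \<Longrightarrow> \<exists>t\<in>T. a - t \<in> I" using assms unfolding cofinite_in_def by blast
  then obtain \<tau> where \<tau>: "\<And>a. a \<in> A \<Longrightarrow> \<tau> a \<in> T" "\<And>a. a \<in> A \<Longrightarrow> a - \<tau> a \<in> I" by metis
  define f where "f g = (\<lambda>(i, j) \<in> {..<n} \<times> {..<n}. \<tau> (\<rho> g i j))" for g
  show ?thesis
    unfolding rcosets_image
  proof (rule finite_image_factor[where f = f])
    have "f ` carrier G \<subseteq> ({..<n} \<times> {..<n}) \<rightarrow>\<^sub>E T"
      using \<tau>(1) ent by (auto simp: f_def entries_in_def PiE_def Pi_def)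
    then show "finite (f ` carrier G)" using finite_PiE[of "{..<n} \<times> {..<n}" "\<lambda>_. T"] T(1) finite_subset by blast
    fix g h assume gh: "g \<in> carrier G" "h \<in> carrier G" "f g = f h"
    have "congruent I g h"
      unfolding congruent_def
    proof (intro allI impI)
      fix i j assume ij: "i < n" "j < n"
      have "\<tau> (\<rho> g i j) = \<tau> (\<rho> h i j)" using fun_cong[OF gh(3), of "(i, j)"] ij by (simp add: f_def)
      moreover have "\<rho> g i j \<in> A" "\<rho> h i j \<in> A" using gh ij ent by (auto simp: entries_in_def)
      ultimately have "(\<rho> g i j - \<tau> (\<rho> g i j)) - (\<rho> h i j - \<tau> (\<rho> g i j)) \<in> I"
        using is_idealD(3)[OF I \<tau>(2) \<tau>(2), of "\<rho> g i j" "\<rho> h i j"] by simp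
      then show "\<rho> g i j - \<rho> h i j \<in> I" by simp
    qed
    then have "congruent I (g \<otimes> inv h) (h \<otimes> inv h)" by (intro congruent_mult_right) (use gh in auto)
    then have "g \<otimes> inv h \<in> congruence_subgroup I" using gh by (simp add: congruence_subgroup_def)
    then show "congruence_subgroup I #> g = congruence_subgroup I #> h"
      using coset_eq_iff[OF normal_imp_subgroup[OF congruence_subgroup_normal] gh(1,2)] by simp
  qed
qed

end

text \<open>Write g = 1 + D. Then g^k is 1 + k D up to products of two entries of D, which lie in
  \<open>J (m + m)\<close>, hence in \<open>J (Suc m)\<close> as m \<ge> 1. For k = l the entries of
  l D are in \<open>J (Suc m)\<close> too.\<close>

lemma congruence_power_step:
  assumes J: "filtration A J" and ent: "entries_in A (carrier G)" and l: "of_nat l \<in> J 1"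
    and m: "m \<ge> 1" and g: "g \<in> congruence_subgroup (J m)"
  shows "g [^] l \<in> congruence_subgroup (J (Suc m))"
proof -
  note Jm = filtrationD(3)[OF J, of "Suc m"]
  have gc: "g \<in> carrier G" using g by (simp add: congruence_subgroup_def)
  define D where "D h i j = \<rho> h i j - (if i = j then 1 else 0)" for h i j
  have gD: "D g i j \<in> J m" if "i < n" "j < n" for i j
    using g that by (auto simp: congruence_subgroup_def congruent_def \<rho>_one D_def)
  have prod: "x * y \<in> J (Suc m)" if "x \<in> J m" "y \<in> J m" for x y
  proof -
    have "J (m + m) \<subseteq> J (Suc m)" by (rule filtrationD(8)[OF J]) (use m in simp)
    then show ?thesis using filtrationD(6)[OF J that] by blast
  qed
  have approx: "D (g [^] k) i j - of_nat k * D g i j \<in> J (Suc m)" if ij: "i < n" "j < n" for k i j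
    using ij
  proof (induction k arbitrary: i j)
    case 0
    then show ?case using is_idealD(1)[OF Jm] by (simp add: D_def \<rho>_one)
  next
    case (Suc k)
    have del: "(\<Sum>r<n. a r * (if r = j then 1 else 0)) = a j" for a :: "nat \<Rightarrow> 'a"
      using Suc.prems(2) by (simp add: if_distrib[of "\<lambda>z. _ * z"] cong: if_cong)
    have del': "(\<Sum>r<n. (if i = r then 1 else 0) * a r) = a i" for a :: "nat \<Rightarrow> 'a"
      using Suc.prems(1) by (simp add: if_distrib[of "\<lambda>z. z * _"] cong: if_cong)
    have "\<rho> (g [^] Suc k) i j = (\<Sum>r<n. \<rho> (g [^] k) i r * \<rho> g r j)"
      using \<rho>_mult[OF nat_pow_closed[OF gc] gc Suc.prems] by simp
    also have "\<dots> = (\<Sum>r<n. D (g [^] k) i r * D g r j + D (g [^] k) i r * (if r = j then 1 else 0) + (if i = r then 1 else 0) * \<rho> g r j)"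
      by (rule sum.cong) (auto simp: D_def algebra_simps)
    also have "\<dots> = (\<Sum>r<n. D (g [^] k) i r * D g r j) + D (g [^] k) i j + \<rho> g i j"
      by (simp only: sum.distrib del del')
    finally have e: "D (g [^] Suc k) i j - of_nat (Suc k) * D g i j =
      (\<Sum>r<n. D (g [^] k) i r * D g r j) + (D (g [^] k) i j - of_nat k * D g i j)"
      by (simp add: D_def algebra_simps)
    have "D (g [^] k) i r * D g r j \<in> J (Suc m)" if r: "r < n" for r
    proof -
      have sA: "(D (g [^] k) i r - of_nat k * D g i r) * D g r j \<in> J (Suc m)"
      proof (rule is_idealD(5)[OF Jm])
        show "D g r j \<in> A" using gD[OF r Suc.prems(2)] is_idealD(2)[OF filtrationD(3)[OF J]] by blast
        show "D (g [^] k) i r - of_nat k * D g i r \<in> J (Suc m)" by (rule Suc.IH[OF Suc.prems(1) r])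
      qed
      have kA: "of_nat k \<in> A" 
      proof (induction k)
        case (Suc k) then show ?case using is_subringD(6)[OF filtrationD(1)[OF J]] is_subringD(2)[OF filtrationD(1)[OF J]] by simp
      qed (simp add: is_subringD(1)[OF filtrationD(1)[OF J]])
      have sB: "of_nat k * (D g i r * D g r j) \<in> J (Suc m)"
        by (rule is_idealD(4)[OF Jm kA prod[OF gD gD]]) (use r Suc.prems in auto)
      have "D (g [^] k) i r * D g r j = (D (g [^] k) i r - of_nat k * D g i r) * D g r j + of_nat k * (D g i r * D g r j)"
        by (simp add: algebra_simps)
      then show ?thesis using is_idealD(7)[OF Jm sA sB] by simp
    qed
    then have "(\<Sum>r<n. D (g [^] k) i r * D g r j) \<in> J (Suc m)" by (intro is_ideal_sum[OF Jm]) auto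
    then show ?case unfolding e by (rule is_idealD(7)[OF Jm _ Suc.IH[OF Suc.prems]])
  qed
  have "D (g [^] l) i j \<in> J (Suc m)" if ij: "i < n" "j < n" for i j
  proof -
    have "of_nat l * D g i j \<in> J (Suc m)" using filtrationD(6)[OF J l gD[OF ij]] by simp
    from is_idealD(7)[OF Jm approx[OF ij, of l] this] show ?thesis by simp
  qed
  then show ?thesis using gc by (simp add: congruence_subgroup_def congruent_def \<rho>_one D_def)
qed

text \<open>A prime \<open>l\<close> beyond \<open>card (rcosets K)\<close> does not divide it. A
  nontrivial element of \<open>K\<close> that is 1 modulo \<open>J 1\<close> lies outside some
  deeper congruence subgroup, but its \<open>l ^ k\<close>-th power lies inside. Its image in K/M is
  thus a nontrivial element of \<open>l\<close>-power order.\<close>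

lemma new_prime_char_0:
  assumes char: "CHAR('a) = 0" and S: "finite S" "S \<subseteq> carrier G" "generate G S = carrier G"
    and inf: "infinite (carrier G)" and K: "K \<lhd> G" "finite (rcosets K)"
  shows "\<exists>l M. prime l \<and> \<not> l dvd card (rcosets K) \<and> M \<lhd> G \<and> M \<subseteq> K \<and> finite (rcosets M) \<and> l dvd coset_index G K M"
proof -
  define E where "E = (\<lambda>(g, i, j). \<rho> g i j) ` ((S \<union> m_inv G ` S) \<times> {..<n} \<times> {..<n})"
  have "finite E" unfolding E_def using S(1) by simp
  then obtain ts where ts: "set ts = E" using finite_list by blast
  define A where "A = adjoin_list (range of_int) ts"
  have A: "is_subring A" unfolding A_def by (rule is_subring_adjoin_list[OF is_subring_of_int])
  have EA: "E \<subseteq> A" unfolding A_def ts[symmetric] by (rule adjoin_list_incl(2)[OF is_subring_of_int])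
  have "\<rho> g i j \<in> E" if "g \<in> S \<union> m_inv G ` S" "i < n" "j < n" for g i j
    unfolding E_def using that by (intro image_eqI[of _ _ "(g, i, j)"]) auto
  then have "entries_in A S" "entries_in A (m_inv G ` S)" using EA by (auto simp: entries_in_def)
  from entries_in_generate[OF A S(2) this] have ent: "entries_in A (carrier G)" using S(3) by simp
  obtain b where b: "\<And>l. l > b \<Longrightarrow> prime (l::nat) \<Longrightarrow> \<exists>J. filtration A J \<and> of_nat l \<in> J 1"
    using filtration_char_0[OF char, of ts] unfolding A_def by blast
  obtain l where l: "prime l" "l > max b (card (rcosets K))" using bigger_prime by blast
  have "rcosets K \<noteq> {}" by (auto simp: rcosets_image)
  then have rK: "card (rcosets K) > 0" using K(2) by (simp add: card_gt_0_iff)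
  have nd: "\<not> l dvd card (rcosets K)" using l(2) rK by (auto dest: dvd_imp_le)
  obtain J where J: "filtration A J" "of_nat l \<in> J 1" using b[of l] l by auto
  let ?C = "\<lambda>k. congruence_subgroup (J k)"
  have C: "?C k \<lhd> G" "finite (rcosets (?C k))" for k
    using congruence_subgroup_normal[OF A filtrationD(3)[OF J(1)] ent]
      congruence_subgroup_finite_index[OF A filtrationD(3)[OF J(1)] ent filtrationD(4)[OF J(1)]] by auto
  \<comment> \<open>As \<open>G\<close> is infinite, this subgroup of finite index contains a
    nontrivial element.\<close>
  define L where "L = K \<inter> ?C 1"
  have L: "L \<lhd> G" "finite (rcosets L)" unfolding L_def by (rule finite_index_inter[OF K C])+
  have "L \<noteq> {\<one>}"
  proof
    assume L1: "L = {\<one>}"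
    have "rcosets L = (\<lambda>x. {x}) ` carrier G" unfolding rcosets_image L1 by (auto simp: r_coset_def)
    then have "finite ((\<lambda>x. {x}) ` carrier G)" using L(2) by simp
    then have "finite (carrier G)" by (rule finite_imageD) (auto intro: inj_onI)
    then show False using inf by simp
  qed
  moreover have "\<one> \<in> L" using subgroup.one_closed[OF normal_imp_subgroup[OF L(1)]] .
  ultimately obtain g where g: "g \<in> K" "g \<in> ?C 1" "g \<noteq> \<one>" unfolding L_def by blast
  have gc: "g \<in> carrier G" using g(2) by (simp add: congruence_subgroup_def)
  have "\<exists>k. g \<notin> ?C k"
  proof (rule ccontr)
    assume no: "\<nexists>k. g \<notin> ?C k"
    have "\<rho> g i j = (if i = j then 1 else 0)" if ij: "i < n" "j < n" for i j
    proof -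
      have "\<rho> g i j - \<rho> \<one> i j \<in> J k" for k
      proof -
        have "g \<in> ?C k" using no by blast
        then show ?thesis using ij by (simp add: congruence_subgroup_def congruent_def)
      qed
      then have "\<rho> g i j - \<rho> \<one> i j = 0" by (rule filtrationD(7)[OF J(1)])
      then show ?thesis using \<rho>_one[OF ij] by simp
    qed
    then have "g = \<one>" using \<rho>_inj[OF gc] by simp
    then show False using g(3) by simp
  qed
  then obtain k where k: "g \<notin> ?C k" by blast
  define M where "M = K \<inter> ?C k"
  have M: "M \<lhd> G" "finite (rcosets M)" unfolding M_def by (rule finite_index_inter[OF K C])+
  have pw: "g [^] (l ^ j) \<in> ?C (Suc j)" for j
  proof (induction j)
    case 0 then show ?case using g(2) gc by simp
  next
    case (Suc j)
    have "(g [^] (l ^ j)) [^] l \<in> ?C (Suc (Suc j))"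
      by (rule congruence_power_step[OF J(1) ent J(2) _ Suc]) simp
    then show ?case using gc by (simp add: nat_pow_pow mult.commute)
  qed
  have "g [^] (l ^ k) \<in> ?C k"
  proof -
    have "J (Suc k) \<subseteq> J k" by (rule filtrationD(5)[OF J(1)])
    then show ?thesis using pw[of k] by (auto simp: congruence_subgroup_def congruent_def)
  qed
  moreover have subK: "subgroup K G" by (rule normal_imp_subgroup[OF K(1)])
  have "g [^] (l ^ k) \<in> K" using monoid.nat_pow_closed[OF group.is_monoid[OF subgroup.subgroup_is_group[OF subK is_group]], of g "l ^ k"] g(1)
    by (simp add: nat_pow_def)
  ultimately have lk: "g [^] (l ^ k) \<in> M" by (simp add: M_def)
  have subM: "subgroup M G" by (rule normal_imp_subgroup[OF M(1)])
  have "l dvd coset_index G K M"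
  proof (rule ccontr)
    assume "\<not> l dvd coset_index G K M"
    then have cop: "coprime (l ^ k) (coset_index G K M)" using l(1) by (simp add: prime_imp_coprime)
    have t: "g [^] coset_index G K M \<in> M" by (rule power_coset_index[OF M subK g(1)])
    have "l ^ k \<noteq> 0" using l(1) by auto
    \<comment> \<open>The exponents \<open>l ^ k\<close> and \<open>coset_index G K M\<close> both
      send \<open>g\<close> into \<open>M\<close>; if they were coprime, \<open>g\<close> itself
      would lie in \<open>M\<close>.\<close>
    then obtain u v where uv: "l ^ k * u = coset_index G K M * v + 1"
      using bezout_nat[of "l ^ k" "coset_index G K M"] cop by auto
    have Mpow: "x [^] (m::nat) \<in> M" if "x \<in> M" for x m
      using monoid.nat_pow_closed[OF group.is_monoid[OF subgroup.subgroup_is_group[OF subM is_group]], of x m] that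
      by (simp add: nat_pow_def)
    have "g [^] (l ^ k * u) \<in> M" using Mpow[OF lk, of u] gc by (simp add: nat_pow_pow)
    moreover have "g [^] (coset_index G K M * v) \<in> M" using Mpow[OF t, of v] gc by (simp add: nat_pow_pow)
    moreover have "g [^] (l ^ k * u) = g [^] (coset_index G K M * v) \<otimes> g" unfolding uv using gc by simp
    ultimately have "inv (g [^] (coset_index G K M * v)) \<otimes> (g [^] (coset_index G K M * v) \<otimes> g) \<in> M"
      using subM by (simp add: subgroup.m_closed subgroup.m_inv_closed)
    then have "g \<in> M" using gc by (simp add: inv_mult_cancel)
    then show False using k by (simp add: M_def)
  qed
  then show ?thesis using l(1) nd M by (auto simp: M_def)
qed

end

section \<open>Positive characteristic\<close>

text \<open>\<open>t\<close> is a root of a monic polynomial, X or X^m - 1, so every element of Z[t]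
  is the value of a remainder of bounded degree.\<close>

lemma finite_adjoin:
  assumes Z: "is_subring Z" "finite Z" and t: "t = 0 \<or> (\<exists>m>0. t ^ m = 1)"
  shows "finite (adjoin Z t)"
proof -
  note I = is_subring_is_ideal[OF Z(1)]
  have mon: "Polynomial.monom 1 i \<in> polys_over Z" for i
    by (rule polys_over_ideal(5)[OF I Z(1) is_subringD(2)[OF Z(1)]])
  obtain D where D: "D \<in> polys_over Z" "D \<noteq> 0" "lead_coeff D = 1" "poly D t = 0"
  proof (cases "t = 0")
    case True
    have "Polynomial.monom (1::'a) 1 \<noteq> 0" by simp
    moreover have "lead_coeff (Polynomial.monom (1::'a) 1) = 1" by (simp add: degree_monom_eq)
    moreover have "poly (Polynomial.monom 1 1) t = 0" using True by (simp add: poly_monom)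
    ultimately show ?thesis using that mon by blast
  next
    case False
    then obtain m where m: "m > 0" "t ^ m = 1" using t by blast
    define D where "D = Polynomial.monom 1 m - Polynomial.monom (1::'a) 0"
    have "D \<in> polys_over Z" unfolding D_def by (rule polys_over_ideal(3)[OF I Z(1) mon mon])
    moreover have c: "Polynomial.coeff D i = (if i = m then 1 else 0) - (if i = 0 then 1 else 0)" for i
      by (simp add: D_def)
    have deg: "Polynomial.degree D = m"
    proof (rule antisym)
      show "Polynomial.degree D \<le> m" by (rule degree_le) (simp add: c)
      show "m \<le> Polynomial.degree D" by (rule le_degree) (use m in \<open>simp add: c\<close>)
    qed
    then have "D \<noteq> 0" using m by auto
    moreover have "lead_coeff D = 1" using deg c[of m] m by simp
    moreover have "poly D t = 0" using m by (simp add: poly_monom D_def)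
    ultimately show ?thesis using that by blast
  qed
  have "adjoin Z t \<subseteq> (\<lambda>r. poly r t) ` {r \<in> polys_over Z. Polynomial.degree r \<le> Polynomial.degree D}"
  proof
    fix y assume "y \<in> adjoin Z t"
    then obtain f where f: "f \<in> polys_over Z" "y = poly f t" by (rule adjoinE)
    from pseudo_division[OF Z(1) I D(1,2) f(1)] D(3) obtain q r where
      r: "r \<in> polys_over Z" "f = q * D + r" "r = 0 \<or> Polynomial.degree r < Polynomial.degree D" by auto
    have "y = poly r t" unfolding f(2) r(2) using D(4) by simp
    moreover have "Polynomial.degree r \<le> Polynomial.degree D" using r(3) by auto
    ultimately show "y \<in> (\<lambda>r. poly r t) ` {r \<in> polys_over Z. Polynomial.degree r \<le> Polynomial.degree D}"
      using r(1) by blast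
  qed
  then show ?thesis using finite_polys_over[OF Z(2)] finite_subset by blast
qed

text \<open>A finite domain is a field: a nonzero element has a positive power equal to 1. So the
  filtration \<open>A\<close>, 0, 0, ... serves.\<close>

lemma filtration_trivial:
  assumes A: "is_subring A" "finite A" and h: "h \<in> A" "h \<noteq> 0"
  shows "\<exists>J. filtration A J \<and> unit_mod A (J 1) h"
proof -
  define J where "J k = (if k = 0 then A else {0})" for k :: nat
  have "is_ideal A (J k)" for k
    using is_subring_is_ideal[OF A(1)] is_subringD(1)[OF A(1)] by (auto simp: J_def is_ideal_def)
  moreover have "cofinite_in A (J k)" for k
    unfolding cofinite_in_def using A(2) is_subringD(1)[OF A(1)]
    by (intro exI[of _ A]) (auto simp: J_def intro!: bexI)
  moreover have "J (Suc k) \<subseteq> J k" for k using is_subringD(1)[OF A(1)] by (auto simp: J_def)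
  moreover have "x * y \<in> J (i + j)" if "x \<in> J i" "y \<in> J j" for x y i j
    using that is_subringD(4)[OF A(1)] by (auto simp: J_def split: if_splits)
  moreover have "(\<Inter>k. J k) \<subseteq> {0}"
  proof
    fix x assume "x \<in> (\<Inter>k. J k)"
    then have "x \<in> J 1" by blast
    then show "x \<in> {0}" by (simp add: J_def)
  qed
  ultimately have "filtration A J" unfolding filtration_def using A(1) by (simp add: J_def)
  moreover have "unit_mod A (J 1) h"
  proof -
    have "range (\<lambda>i. h ^ i) \<subseteq> A" using is_subringD(7)[OF A(1) h(1)] by blast
    then have "finite (range (\<lambda>i::nat. h ^ i))" using A(2) finite_subset by blast
    then have "\<not> inj (\<lambda>i::nat. h ^ i)" using finite_imageD by fastforce
    then obtain i j :: nat where "h ^ i = h ^ j" "i \<noteq> j" unfolding inj_def by blast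
    then obtain i j where ij: "h ^ i = h ^ j" "i < j" by (metis nat_neq_iff)
    have "j = i + Suc (j - i - 1)" using ij(2) by simp
    then have "h ^ j = h ^ i * (h * h ^ (j - i - 1))" by (metis power_add power_Suc)
    then have "h * h ^ (j - i - 1) = 1" using ij(1) h(2) by simp
    then have "h * h ^ (j - i - 1) - 1 \<in> J 1" by (simp add: J_def)
    then show ?thesis unfolding unit_mod_def using h(1) is_subringD(7)[OF A(1) h(1)] by blast
  qed
  ultimately show ?thesis by blast
qed

text \<open>The extension lemmas start from an infinite ring, and the prime field is finite. If some
  member of \<open>ts\<close> is nonzero and not a root of unity, it generates an infinite base
  ring; otherwise every adjunction keeps the ring finite.\<close>

lemma exists_filtration:
  fixes ts :: "'a::alg_closed_field list"
  assumes char: "CHAR('a) > 0"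
  shows "\<exists>A. is_subring A \<and> set ts \<subseteq> A \<and> (\<forall>h\<in>A - {0}. \<exists>J. filtration A J \<and> unit_mod A (J 1) h)"
proof (cases "\<exists>x\<in>set ts. x \<noteq> 0 \<and> (\<forall>m>0. x ^ m \<noteq> 1)")
  case True
  then obtain x :: 'a where x: "x \<noteq> 0" "\<And>m. m > 0 \<Longrightarrow> x ^ m \<noteq> 1" by blast
  let ?B = "adjoin (range of_int) x"
  have B: "is_subring ?B" by (rule is_subring_adjoin[OF is_subring_of_int])
  let ?A = "adjoin_list ?B ts"
  have "\<exists>J. filtration ?A J \<and> unit_mod ?A (J 1) h" if h: "h \<in> ?A - {0}" for h
  proof -
    obtain b where b: "\<forall>l>b. prime (l::nat) \<longrightarrow>
      (\<exists>J. filtration ?A J \<and> unit_mod ?A (J 1) h \<and> x ^ l - 1 \<in> J 1 \<and> x - 1 \<notin> J 1)"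
      using filtration_char_pos[OF char x refl, of h ts] h by blast
    obtain l where "l > b" "prime l" using bigger_prime by blast
    then show ?thesis using b by blast
  qed
  then show ?thesis using is_subring_adjoin_list[OF B, of ts] adjoin_list_incl(2)[OF B, of ts] by blast
next
  case False
  let ?A = "adjoin_list (range of_int) ts"
  have "finite (adjoin_list (range of_int) us)" if "set us \<subseteq> set ts" for us
    using that
  proof (induction us)
    case Nil then show ?case by (simp add: adjoin_list_def finite_range_of_int[OF char])
  next
    case (Cons u us)
    have "u = 0 \<or> (\<exists>m>0. u ^ m = 1)" using False Cons.prems by auto
    from finite_adjoin[OF is_subring_adjoin_list[OF is_subring_of_int] _ this] Cons show ?case
      by (simp add: adjoin_list_def)
  qed
  then have fin: "finite ?A" by simp
  have A: "is_subring ?A" by (rule is_subring_adjoin_list[OF is_subring_of_int])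
  have "\<exists>J. filtration ?A J \<and> unit_mod ?A (J 1) h" if "h \<in> ?A - {0}" for h
    using filtration_trivial[OF A fin, of h] that by simp
  then show ?thesis using A adjoin_list_incl(2)[OF is_subring_of_int, of ts] by blast
qed

text \<open>If \<open>1 \<notin> I\<close>, Gaussian elimination succeeds: its pivots are congruent to \<open>1\<close> modulo \<open>I\<close>, hence nonzero.\<close>

lemma eliminate_mod_ideal:
  fixes v :: "nat \<Rightarrow> 'a::field"
  assumes A: "is_subring A" and I: "is_ideal A I"
    and "u - 1 \<in> I" "\<And>i j. i < n \<Longrightarrow> j < n \<Longrightarrow> Y i j \<in> I"
    and "\<And>i. i < n \<Longrightarrow> u * v i = (\<Sum>j<n. Y i j * v j)" "\<exists>i<n. v i \<noteq> 0"
  shows "1 \<in> I"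
  using assms(3-)
proof (induction n arbitrary: u Y)
  case 0
  then show ?case by simp
next
  case (Suc n)
  have IA: "x \<in> A" if "x \<in> I" for x using that is_idealD(2)[OF I] by blast
  have uA: "u \<in> A" using is_subringD(6)[OF A IA[OF Suc.prems(1)] is_subringD(2)[OF A]] by simp
  \<comment> \<open>The pivot of the last equation.\<close>
  define w where "w = u - Y n n"
  have wI: "w - 1 \<in> I"
    using is_idealD(3)[OF I Suc.prems(1) Suc.prems(2)[of n n]] by (simp add: w_def algebra_simps)
  have wA: "w \<in> A" using is_subringD(6)[OF A IA[OF wI] is_subringD(2)[OF A]] by simp
  have wv: "w * v n = (\<Sum>j<n. Y n j * v j)" using Suc.prems(3)[of n] by (simp add: w_def algebra_simps)
  show ?case
  proof (cases "\<exists>i<n. v i \<noteq> 0")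
    case True
    show ?thesis
    \<comment> \<open>Multiplying equation \<open>i\<close> by \<open>w\<close> and substituting the
      last one eliminates \<open>v n\<close>. The new matrix entries stay in \<open>I\<close>, and
      the new factor \<open>u * w\<close> stays 1 modulo \<open>I\<close>.\<close>
    proof (rule Suc.IH[of "u * w" "\<lambda>i j. w * Y i j + Y i n * Y n j"])
      have "u * (w - 1) + (u - 1) \<in> I" by (intro is_idealD(4,7)[OF I] uA wI Suc.prems(1))
      then show "u * w - 1 \<in> I" by (simp add: algebra_simps)
      show "w * Y i j + Y i n * Y n j \<in> I" if "i < n" "j < n" for i j
        by (intro is_idealD(7)[OF I] is_idealD(4)[OF I] wA IA Suc.prems(2)) (use that in auto)
      show "u * w * v i = (\<Sum>j<n. (w * Y i j + Y i n * Y n j) * v j)" if i: "i < n" for i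
      proof -
        have "u * w * v i = w * (u * v i)" by simp
        also have "\<dots> = w * ((\<Sum>j<n. Y i j * v j) + Y i n * v n)" using Suc.prems(3)[of i] i by simp
        also have "\<dots> = w * (\<Sum>j<n. Y i j * v j) + Y i n * (w * v n)" by (simp add: algebra_simps)
        also have "\<dots> = (\<Sum>j<n. (w * Y i j + Y i n * Y n j) * v j)"
          unfolding wv by (simp add: sum_distrib_left sum.distrib algebra_simps)
        finally show ?thesis .
      qed
      show "\<exists>i<n. v i \<noteq> 0" by (rule True)
    qed
  next
    case False
    \<comment> \<open>Only \<open>v n\<close> is nonzero, so the pivot vanishes although it is 1
      modulo \<open>I\<close>.\<close>
    then have "w * v n = 0" using wv by simp
    moreover have "v n \<noteq> 0" using Suc.prems(4) False by (metis less_Suc_eq)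
    ultimately have "w = 0" by simp
    then have "- (w - 1) = 1" by simp
    then show ?thesis using is_idealD(6)[OF I wI] by simp
  qed
qed

locale matrix_group_alg_closed = matrix_group G n \<rho>
  for G :: "('g, 'b) monoid_scheme" (structure) and n and \<rho> :: "'g \<Rightarrow> nat \<Rightarrow> nat \<Rightarrow> 'a::alg_closed_field"
begin

definition eigen :: "'g \<Rightarrow> 'a \<Rightarrow> (nat \<Rightarrow> 'a) \<Rightarrow> bool" where
  "eigen g e v \<longleftrightarrow> (\<exists>i<n. v i \<noteq> 0) \<and> (\<forall>i<n. (\<Sum>j<n. \<rho> g i j * v j) = e * v i)"

lemma sum_delta: "i < n \<Longrightarrow> (\<Sum>j<n. (if i = j then 1 else 0) * v j) = (v i :: 'a)"
  by (simp add: if_distrib[of "\<lambda>z. z * _"] cong: if_cong)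

lemma act_one: "i < n \<Longrightarrow> (\<Sum>j<n. \<rho> \<one> i j * v j) = v i"
proof -
  assume i: "i < n"
  have "(\<Sum>j<n. \<rho> \<one> i j * v j) = (\<Sum>j<n. (if i = j then 1 else 0) * v j)"
    by (rule sum.cong) (simp_all add: \<rho>_one i)
  then show ?thesis using sum_delta[OF i] by simp
qed

lemma act_mult:
  assumes "g \<in> carrier G" "h \<in> carrier G" "i < n"
  shows "(\<Sum>j<n. \<rho> (g \<otimes> h) i j * v j) = (\<Sum>k<n. \<rho> g i k * (\<Sum>j<n. \<rho> h k j * v j))"
proof -
  have "(\<Sum>j<n. \<rho> (g \<otimes> h) i j * v j) = (\<Sum>j<n. \<Sum>k<n. \<rho> g i k * \<rho> h k j * v j)"
    using assms by (simp add: \<rho>_mult sum_distrib_right)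
  also have "\<dots> = (\<Sum>k<n. \<Sum>j<n. \<rho> g i k * \<rho> h k j * v j)" by (rule sum.swap)
  finally show ?thesis by (simp add: sum_distrib_left mult.assoc)
qed

lemma eigen_power:
  assumes g: "g \<in> carrier G" and e: "eigen g e v"
  shows "eigen (g [^] (k::nat)) (e ^ k) v"
proof (induction k)
  case 0
  then show ?case using e act_one by (simp add: eigen_def)
next
  case (Suc k)
  have "(\<Sum>j<n. \<rho> (g [^] k \<otimes> g) i j * v j) = e ^ Suc k * v i" if i: "i < n" for i
  proof -
    have "(\<Sum>j<n. \<rho> (g [^] k \<otimes> g) i j * v j) = (\<Sum>r<n. \<rho> (g [^] k) i r * (\<Sum>j<n. \<rho> g r j * v j))"
      by (rule act_mult) (use g i in auto)
    also have "\<dots> = (\<Sum>r<n. \<rho> (g [^] k) i r * (e * v r))"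
      by (rule sum.cong) (use e in \<open>auto simp: eigen_def\<close>)
    also have "\<dots> = e * (\<Sum>r<n. \<rho> (g [^] k) i r * v r)" by (simp add: sum_distrib_left mult.left_commute)
    also have "\<dots> = e ^ Suc k * v i" using Suc i by (simp add: eigen_def)
    finally show ?thesis .
  qed
  then show ?case using e by (simp add: eigen_def)
qed

lemma eigen_nonzero:
  assumes g: "g \<in> carrier G" and e: "eigen g e v"
  shows "e \<noteq> 0"
proof
  assume 0: "e = 0"
  have "v i = 0" if i: "i < n" for i
  proof -
    have "v i = (\<Sum>j<n. \<rho> (inv g \<otimes> g) i j * v j)"
      using g i sum_delta[of i v] by (simp add: \<rho>_one)
    also have "\<dots> = (\<Sum>k<n. \<rho> (inv g) i k * (\<Sum>j<n. \<rho> g k j * v j))"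
      by (rule act_mult) (use g i in auto)
    also have "\<dots> = 0" using e 0 by (simp add: eigen_def)
    finally show ?thesis .
  qed
  then show False using e by (auto simp: eigen_def)
qed

text \<open>The power h = g^r lies in \<open>K\<close> and has the eigenvalue x = e^r, which is not
  a root of unity. Modulo \<open>J 1\<close> the element x has order exactly \<open>l\<close>. With
  t the index of \<open>M\<close> in \<open>K\<close>, h^t is congruent to 1; comparing actions on
  the eigenvector gives x^t = 1 modulo \<open>J 1\<close>, so \<open>l\<close> divides t.\<close>

lemma new_prime_eigenvalue:
  assumes char: "CHAR('a) > 0" and S: "finite S" "S \<subseteq> carrier G" "generate G S = carrier G"
    and K: "K \<lhd> G" "finite (rcosets K)"
    and g: "g \<in> carrier G" "eigen g e v" and nr: "\<And>m. m > 0 \<Longrightarrow> e ^ m \<noteq> 1"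
  shows "\<exists>l M. prime l \<and> \<not> l dvd card (rcosets K) \<and> M \<lhd> G \<and> M \<subseteq> K \<and> finite (rcosets M) \<and> l dvd coset_index G K M"
proof -
  define r where "r = card (rcosets K)"
  have "rcosets K \<noteq> {}" by (auto simp: rcosets_image)
  then have r0: "r > 0" using K(2) by (simp add: r_def card_gt_0_iff)
  define x where "x = e ^ r"
  have x: "x \<noteq> 0" "\<And>m. m > 0 \<Longrightarrow> x ^ m \<noteq> 1"
    using eigen_nonzero[OF g] nr r0 by (auto simp: x_def simp flip: power_mult)
  define h where "h = g [^] r"
  have hc: "h \<in> carrier G" using g by (simp add: h_def)
  have hx: "eigen h x v" unfolding h_def x_def by (rule eigen_power[OF g])
  have hK: "h \<in> K"
    using power_coset_index[OF K subgroup_self g(1)] by (simp add: coset_index_def h_def r_def rcosets_image)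
  obtain i0 where i0: "i0 < n" "v i0 \<noteq> 0" using g(2) by (auto simp: eigen_def)
  \<comment> \<open>The coordinates of \<open>v\<close> are included so that \<open>v i0\<close> can
    be made a unit modulo \<open>J 1\<close> and cancelled.\<close>
  define E where "E = (\<lambda>(g, i, j). \<rho> g i j) ` ((S \<union> m_inv G ` S) \<times> {..<n} \<times> {..<n}) \<union> v ` {..<n}"
  have "finite E" unfolding E_def using S(1) by simp
  then obtain ts where ts: "set ts = E" using finite_list by blast
  define A where "A = adjoin_list (adjoin (range of_int) x) ts"
  have B: "is_subring (adjoin (range of_int) x)" by (rule is_subring_adjoin[OF is_subring_of_int])
  have A: "is_subring A" unfolding A_def by (rule is_subring_adjoin_list[OF B])
  have EA: "E \<subseteq> A" unfolding A_def ts[symmetric] by (rule adjoin_list_incl(2)[OF B])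
  have "\<rho> g i j \<in> E" if "g \<in> S \<union> m_inv G ` S" "i < n" "j < n" for g i j
    unfolding E_def using that by (intro UnI1 image_eqI[of _ _ "(g, i, j)"]) auto
  then have "entries_in A S" "entries_in A (m_inv G ` S)" using EA by (auto simp: entries_in_def)
  from entries_in_generate[OF A S(2) this] have ent: "entries_in A (carrier G)" using S(3) by simp
  have vA: "v i \<in> A" if "i < n" for i using EA that unfolding E_def by blast
  have xA: "x \<in> A" unfolding A_def
    using adjoin_list_incl(1)[OF B, of ts] adjoin_incl(2)[OF is_subring_of_int, of x] by blast
  obtain b where b: "\<forall>l>b. prime (l::nat) \<longrightarrow>
      (\<exists>J. filtration A J \<and> unit_mod A (J 1) (v i0) \<and> x ^ l - 1 \<in> J 1 \<and> x - 1 \<notin> J 1)"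
    using filtration_char_pos[OF char x A_def vA[OF i0(1)] i0(2)] by blast
  obtain l where l: "prime l" "l > max b r" using bigger_prime by blast
  have nd: "\<not> l dvd r" using l(2) r0 by (auto dest: dvd_imp_le)
  obtain J where J: "filtration A J" "unit_mod A (J 1) (v i0)" "x ^ l - 1 \<in> J 1" "x - 1 \<notin> J 1" using b l by auto
  note J1 = filtrationD(3)[OF J(1), of 1]
  let ?C = "congruence_subgroup (J 1)"
  have C: "?C \<lhd> G" "finite (rcosets ?C)"
    by (rule congruence_subgroup_normal[OF A J1 ent], rule congruence_subgroup_finite_index[OF A J1 ent filtrationD(4)[OF J(1)]])
  define M where "M = K \<inter> ?C"
  have M: "M \<lhd> G" "finite (rcosets M)" unfolding M_def by (rule finite_index_inter[OF K C])+
  define t where "t = coset_index G K M"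
  have ht: "h [^] t \<in> M" unfolding t_def by (rule power_coset_index[OF M normal_imp_subgroup[OF K(1)] hK])
  have xt: "x ^ t - 1 \<in> J 1"
  proof -
    have "(\<Sum>j<n. (\<rho> (h [^] t) i0 j - \<rho> \<one> i0 j) * v j) \<in> J 1"
    proof (rule is_ideal_sum[OF J1])
      fix j assume j: "j \<in> {..<n}"
      have "\<rho> (h [^] t) i0 j - \<rho> \<one> i0 j \<in> J 1"
        using ht j i0(1) by (simp add: M_def congruence_subgroup_def congruent_def)
      then show "(\<rho> (h [^] t) i0 j - \<rho> \<one> i0 j) * v j \<in> J 1" using is_idealD(5)[OF J1 vA] j by simp
    qed
    also have "(\<Sum>j<n. (\<rho> (h [^] t) i0 j - \<rho> \<one> i0 j) * v j) = (\<Sum>j<n. \<rho> (h [^] t) i0 j * v j) - (\<Sum>j<n. \<rho> \<one> i0 j * v j)"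
      by (simp add: left_diff_distrib sum_subtractf)
    also have "\<dots> = v i0 * (x ^ t - 1)"
      using eigen_power[OF hc hx, of t] eigen_power[OF hc hx, of 0] i0(1) by (simp add: eigen_def algebra_simps)
    finally show ?thesis
      by (rule unit_mod_cancel[OF J(1,2), rotated]) (intro is_subringD(2,3)[OF A] is_subringD(7)[OF A xA])
  qed
  have mult: "x ^ (a * c) - 1 \<in> J 1" if "x ^ a - 1 \<in> J 1" for a c
  proof -
    have "(x ^ a) ^ c - 1 = (x ^ a - 1) * (\<Sum>i<c. (x ^ a) ^ i)" by (rule power_diff_1_eq)
    also have "\<dots> \<in> J 1"
      by (rule is_idealD(5)[OF J1 _ that]) (intro is_subring_sum[OF A] is_subringD(7)[OF A] xA)
    finally have "(x ^ a) ^ c - 1 \<in> J 1" .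
    then show ?thesis by (simp add: power_mult)
  qed
  have "l dvd t"
  proof (rule ccontr)
    assume "\<not> l dvd t"
    then have cop: "coprime l t" using l(1) by (simp add: prime_imp_coprime)
    have "l \<noteq> 0" using l(1) by auto
    then obtain u w where uw: "l * u = t * w + 1" using bezout_nat[of l t] cop by auto
    have "(x ^ (l * u) - 1) - x * (x ^ (t * w) - 1) \<in> J 1"
      by (intro is_idealD(3,4)[OF J1] mult J xt xA)
    then have "x - 1 \<in> J 1" unfolding uw by (simp add: algebra_simps)
    then show False using J(4) by simp
  qed
  then show ?thesis using l(1) nd M by (auto simp: M_def t_def r_def)
qed

end

text \<open>Schreier's method. Let \<open>R\<close> be a finite set of coset representatives and
  \<open>U\<close> the subgroup generated by the elements r s r'^-1 that lie in \<open>N\<close>.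
  The set U R is stable under right multiplication by generators, so it is all of
  \<open>G\<close>.\<close>

lemma (in group) finite_index_finitely_generated:
  assumes S: "finite S" "S \<subseteq> carrier G" "generate G S = carrier G"
    and N: "subgroup N G" "finite (rcosets N)"
  shows "\<exists>T. finite T \<and> T \<subseteq> N \<and> generate G T = N"
proof -
  have NG: "N \<subseteq> carrier G" by (rule subgroup.subset[OF N(1)])
  obtain R0 where R0: "R0 \<subseteq> carrier G" "finite R0" "rcosets N = (\<lambda>x. N #> x) ` R0"
    using N(2) unfolding rcosets_image by (metis finite_subset_image order_refl)
  define R where "R = insert \<one> R0"
  have R: "R \<subseteq> carrier G" "finite R" using R0 by (auto simp: R_def)
  have rep: "\<exists>r\<in>R. x \<otimes> inv r \<in> N" if x: "x \<in> carrier G" for x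
  proof -
    have "N #> x \<in> (\<lambda>x. N #> x) ` R0" using x R0(3) rcosets_image by auto
    then obtain r where r: "r \<in> R0" "N #> x = N #> r" by blast
    then have "x \<otimes> inv r \<in> N" using coset_eq_iff[OF N(1) x, of r] R0(1) by blast
    then show ?thesis using r(1) by (auto simp: R_def)
  qed
  define S' where "S' = S \<union> m_inv G ` S"
  have S'G: "S' \<subseteq> carrier G" using S(2) by (auto simp: S'_def)
  \<comment> \<open>\<open>R\<close> may contain elements of \<open>N\<close> other than \<one>.
    They are added to \<open>T\<close>, because an element of \<open>N\<close> written as
    \<open>u \<otimes> r\<close> has its \<open>r\<close> in \<open>N\<close>.\<close>
  define T where "T = N \<inter> ((\<lambda>(r, s, r'). r \<otimes> s \<otimes> inv r') ` (R \<times> S' \<times> R) \<union> R)"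
  have T: "finite T" "T \<subseteq> N" unfolding T_def S'_def using S(1) R(2) by auto
  have TG: "T \<subseteq> carrier G" using T(2) NG by blast
  define U where "U = generate G T"
  have U: "subgroup U G" unfolding U_def by (rule generate_is_subgroup[OF TG])
  have TU: "T \<subseteq> U" unfolding U_def by (auto intro: generate.incl)
  have UN: "U \<subseteq> N" unfolding U_def by (rule generate_subgroup_incl[OF T(2) N(1)])
  define P where "P x \<longleftrightarrow> (\<forall>u\<in>U. \<forall>r\<in>R. \<exists>u'\<in>U. \<exists>r'\<in>R. u \<otimes> r \<otimes> x = u' \<otimes> r')" for x
  have step: "P s" if s: "s \<in> S'" for s
    unfolding P_def
  proof (intro ballI)
    fix u r assume u: "u \<in> U" and r: "r \<in> R"
    have c: "u \<in> carrier G" "r \<in> carrier G" "s \<in> carrier G" using u r s UN NG R(1) S'G by auto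
    obtain r' where r': "r' \<in> R" "r \<otimes> s \<otimes> inv r' \<in> N" using rep[of "r \<otimes> s"] c by auto
    have r'c: "r' \<in> carrier G" using r'(1) R(1) by blast
    have "r \<otimes> s \<otimes> inv r' \<in> T" unfolding T_def using r' r s by (auto intro!: image_eqI[of _ _ "(r, s, r')"])
    then have "u \<otimes> (r \<otimes> s \<otimes> inv r') \<in> U" using TU u subgroup.m_closed[OF U] by blast
    moreover have "u \<otimes> r \<otimes> s = u \<otimes> (r \<otimes> s \<otimes> inv r') \<otimes> r'" using c r'c by (simp add: m_assoc)
    ultimately show "\<exists>u'\<in>U. \<exists>r'\<in>R. u \<otimes> r \<otimes> s = u' \<otimes> r'" using r'(1) by blast
  qed
  have allP: "P x" if "x \<in> generate G S" for x
    using that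
  proof (induction rule: generate.induct)
    case one
    have "u \<otimes> r \<otimes> \<one> = u \<otimes> r" if "u \<in> U" "r \<in> R" for u r using that UN NG R(1) by (simp add: subset_iff)
    then show ?case unfolding P_def by blast
  next
    case (incl h) then show ?case using step by (simp add: S'_def)
  next
    case (inv h) then show ?case using step by (simp add: S'_def)
  next
    case (eng h1 h2)
    have hc: "h1 \<in> carrier G" "h2 \<in> carrier G" using eng.hyps generate_in_carrier[OF S(2)] by auto
    show ?case
      unfolding P_def
    proof (intro ballI)
      fix u r assume u: "u \<in> U" and r: "r \<in> R"
      obtain u1 r1 where 1: "u1 \<in> U" "r1 \<in> R" "u \<otimes> r \<otimes> h1 = u1 \<otimes> r1" using eng.IH(1) u r unfolding P_def by blast
      obtain u2 r2 where 2: "u2 \<in> U" "r2 \<in> R" "u1 \<otimes> r1 \<otimes> h2 = u2 \<otimes> r2" using eng.IH(2) 1 unfolding P_def by blast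
      have "u \<in> carrier G" "r \<in> carrier G" using u r UN NG R(1) by auto
      then have "u \<otimes> r \<otimes> (h1 \<otimes> h2) = (u \<otimes> r \<otimes> h1) \<otimes> h2" using hc by (simp add: m_assoc)
      then have "u \<otimes> r \<otimes> (h1 \<otimes> h2) = u2 \<otimes> r2" unfolding 1(3) 2(3) .
      then show "\<exists>u'\<in>U. \<exists>r'\<in>R. u \<otimes> r \<otimes> (h1 \<otimes> h2) = u' \<otimes> r'" using 2 by blast
    qed
  qed
  have "N \<subseteq> U"
  proof
    fix x assume x: "x \<in> N"
    then have xc: "x \<in> carrier G" using NG by blast
    then have "P x" using allP S(3) by simp
    moreover have "\<one> \<in> U" "\<one> \<in> R" using subgroup.one_closed[OF U] by (auto simp: R_def)
    ultimately obtain u r where ur: "u \<in> U" "r \<in> R" "\<one> \<otimes> \<one> \<otimes> x = u \<otimes> r" unfolding P_def by blast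
    have c: "u \<in> carrier G" "r \<in> carrier G" using ur UN NG R(1) by auto
    have xr: "x = u \<otimes> r" using ur(3) xc by simp
    have "r = inv u \<otimes> x" unfolding xr using c by (simp add: inv_mult_cancel)
    then have "r \<in> N" using x ur(1) UN subgroup.m_closed[OF N(1)] subgroup.m_inv_closed[OF N(1)] by blast
    then have "r \<in> U" using ur(2) TU unfolding T_def by blast
    then show "x \<in> U" unfolding xr by (rule subgroup.m_closed[OF U ur(1)])
  qed
  then show ?thesis using T UN unfolding U_def by blast
qed

section \<open>Linear dependence among functions\<close>

definition fscale :: "'a::field \<Rightarrow> ('x \<Rightarrow> 'a) \<Rightarrow> 'x \<Rightarrow> 'a" where
  "fscale c v = (\<lambda>x. c * v x)"

interpretation FV: vector_space "fscale :: 'a::field \<Rightarrow> ('x \<Rightarrow> 'a) \<Rightarrow> 'x \<Rightarrow> 'a"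
  by unfold_locales (auto simp: fscale_def algebra_simps fun_eq_iff)

lemma fun_sum_apply: "(\<Sum>i\<in>S. f i) x = (\<Sum>i\<in>S. f i x)" for f :: "'i \<Rightarrow> 'x \<Rightarrow> 'a::field"
  by (induction S rule: infinite_finite_induct) auto

lemma supported_in_span:
  fixes v :: "'x \<Rightarrow> 'a::field"
  assumes "finite Y" "\<And>x. x \<notin> Y \<Longrightarrow> v x = 0"
  shows "v \<in> FV.span ((\<lambda>x y. if y = x then 1 else 0) ` Y)"
proof -
  have "v = (\<Sum>x\<in>Y. fscale (v x) (\<lambda>y. if y = x then 1 else 0))"
  proof
    fix y
    have "(\<Sum>x\<in>Y. v x * (if y = x then 1 else 0)) = v y"
      using assms by (cases "y \<in> Y") (auto simp: if_distrib[of "\<lambda>z. _ * z"] sum.delta cong: if_cong)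
    then show "v y = (\<Sum>x\<in>Y. fscale (v x) (\<lambda>y. if y = x then 1 else 0)) y" by (simp add: fun_sum_apply fscale_def)
  qed
  also have "\<dots> \<in> FV.span ((\<lambda>x y. if y = x then 1 else 0) ` Y)"
    by (intro FV.span_sum FV.span_scale FV.span_base) auto
  finally show ?thesis .
qed

text \<open>More than \<open>card Y\<close> functions supported on \<open>Y\<close> are linearly
  dependent. The coefficients are packaged as a polynomial because the sequence to come consists of
  the powers of a matrix.\<close>

lemma linear_dependence:
  fixes w :: "nat \<Rightarrow> 'x \<Rightarrow> 'a::field"
  assumes Y: "finite Y" "\<And>k x. x \<notin> Y \<Longrightarrow> w k x = 0"
  shows "\<exists>f :: 'a poly. f \<noteq> 0 \<and> (\<forall>x. (\<Sum>k\<le>Polynomial.degree f. Polynomial.coeff f k * w k x) = 0)"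
proof -
  have *: "\<exists>f :: 'a poly. f \<noteq> 0 \<and> (\<forall>x. (\<Sum>k\<le>Polynomial.degree f. Polynomial.coeff f k * w k x) = 0)"
    if c: "c k0 \<noteq> 0" "k0 \<le> m" and sum: "\<And>x. (\<Sum>k\<le>m. c k * w k x) = 0" for c :: "nat \<Rightarrow> 'a" and k0 m
  proof -
    define f where "f = (\<Sum>k\<le>m. Polynomial.monom (c k) k)"
    have cf: "Polynomial.coeff f k = (if k \<le> m then c k else 0)" for k
      by (simp add: f_def coeff_sum)
    have "f \<noteq> 0" using cf[of k0] c by auto
    moreover have "Polynomial.degree f \<le> m" by (rule degree_le) (simp add: cf)
    then have "(\<Sum>k\<le>Polynomial.degree f. Polynomial.coeff f k * w k x) = (\<Sum>k\<le>m. Polynomial.coeff f k * w k x)" for x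
      by (intro sum.mono_neutral_left) (auto simp: coeff_eq_0)
    then have "(\<Sum>k\<le>Polynomial.degree f. Polynomial.coeff f k * w k x) = 0" for x
      using sum[of x] by (simp add: cf)
    ultimately show ?thesis by blast
  qed
  let ?m = "card Y"
  show ?thesis
  proof (cases "inj_on w {..?m}")
    \<comment> \<open>Dependence is a notion for sets, so a repetition in the sequence is a separate
      case.\<close>
    case False
    then obtain i j where ij: "i \<le> ?m" "j \<le> ?m" "i \<noteq> j" "w i = w j" unfolding inj_on_def by auto
    let ?c = "\<lambda>k. (if k = i then 1 else 0) - (if k = j then 1 else 0) :: 'a"
    have "(\<Sum>k\<le>?m. ?c k * w k x) = 0" for x
    proof -
      have "(\<Sum>k\<le>?m. ?c k * w k x) = (\<Sum>k\<le>?m. if k = i then w k x else 0) - (\<Sum>k\<le>?m. if k = j then w k x else 0)"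
        unfolding sum_subtractf[symmetric] by (rule sum.cong) auto
      then show ?thesis using ij by (simp add: sum.delta)
    qed
    then show ?thesis using *[of ?c i ?m] ij by simp
  next
    case True
    let ?W = "w ` {..?m}"
    let ?U = "(\<lambda>x y. if y = x then 1 else 0 :: 'a) ` Y"
    have "FV.dependent ?W"
    proof (rule ccontr)
      assume "\<not> FV.dependent ?W"
      moreover have "?W \<subseteq> FV.span ?U" using supported_in_span[OF Y(1)] Y(2) by blast
      ultimately have "card ?W \<le> card ?U"
        using FV.independent_span_bound[of ?U ?W] Y(1) by blast
      also have "\<dots> \<le> ?m" by (rule card_image_le[OF Y(1)])
      finally show False using card_image[OF True] by simp
    qed
    then obtain u v where u: "v \<in> ?W" "u v \<noteq> 0" "(\<Sum>v\<in>?W. fscale (u v) v) = 0"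
      using FV.dependent_finite[of ?W] by auto
    obtain k0 where k0: "k0 \<le> ?m" "v = w k0" using u(1) by blast
    have "(\<Sum>k\<le>?m. u (w k) * w k x) = 0" for x
    proof -
      have "(\<Sum>k\<le>?m. fscale (u (w k)) (w k)) = 0" using u(3) by (simp add: sum.reindex[OF True])
      then have "(\<Sum>k\<le>?m. fscale (u (w k)) (w k)) x = 0" by simp
      then show ?thesis by (simp add: fun_sum_apply fscale_def)
    qed
    then show ?thesis using *[of "\<lambda>k. u (w k)" k0 ?m] u(2) k0 by simp
  qed
qed

section \<open>Eigenvalues in congruence subgroups and unipotent elements\<close>

context matrix_group_alg_closed
begin

text \<open>If e were not 1, then e - 1 would be nonzero and algebraic over the prime field, so (e -
  1)^r = 1 for some r > 0. The matrix g - 1 has entries in \<open>I\<close>, and its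
  \<open>r\<close>-th power fixes the eigenvector; elimination then shows that 1 lies in
  \<open>I\<close>.\<close>

lemma eigen_congruence_subgroup:
  assumes char: "CHAR('a) > 0" and A: "is_subring A" and I: "is_ideal A I" "1 \<notin> I"
    and ent: "entries_in A (carrier G)" and g: "g \<in> congruence_subgroup I" and e: "eigen g e v" "m > 0" "e ^ m = 1"
  shows "e = 1"
proof (rule ccontr)
  assume "e \<noteq> 1"
  let ?Z = "range of_int :: 'a set"
  note Z = is_subring_of_int[where 'a = 'a] finite_range_of_int[OF char]
  note IZ = is_subring_is_ideal[OF Z(1)]
  define D where "D = Polynomial.monom 1 m - Polynomial.monom (1::'a) 0"
  have mon: "Polynomial.monom 1 i \<in> polys_over ?Z" for i
    by (rule polys_over_ideal(5)[OF IZ Z(1) is_subringD(2)[OF Z(1)]])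
  have DZ: "D \<in> polys_over ?Z" unfolding D_def by (rule polys_over_ideal(3)[OF IZ Z(1) mon mon])
  have "Polynomial.coeff D m = 1" using e(2) by (simp add: D_def)
  then have D0: "D \<noteq> 0" by auto
  have "[:1, 1:] \<in> polys_over ?Z" using is_subringD(1,2)[OF Z(1)]
    by (auto simp: polys_over_def coeff_pCons split: nat.splits)
  \<comment> \<open>The polynomial (X + 1)^m - 1, which vanishes at e - 1.\<close>
  then have "pcompose D [:1, 1:] \<in> polys_over ?Z" by (rule polys_over_pcompose[OF Z(1) _ DZ])
  moreover have "poly (pcompose D [:1, 1:]) (e - 1) = 0" using e(3) by (simp add: poly_pcompose D_def poly_monom)
  moreover have "pcompose D [:1, 1:] \<noteq> 0" using D0 by (simp add: pcompose_eq_0_iff)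
  ultimately obtain r where r: "r > 0" "(e - 1) ^ r = 1"
    using algebraic_imp_root_of_unity[OF Z] \<open>e \<noteq> 1\<close> by (metis right_minus_eq)
  define x where "x i j = \<rho> g i j - \<rho> \<one> i j" for i j
  have xI: "x i j \<in> I" if "i < n" "j < n" for i j
    using g that by (simp add: x_def congruence_subgroup_def congruent_def)
  have xv: "(\<Sum>j<n. x i j * v j) = (e - 1) * v i" if i: "i < n" for i
    using e(1) act_one[OF i, of v] i by (simp add: x_def eigen_def left_diff_distrib sum_subtractf algebra_simps)
  \<comment> \<open>\<open>Y k\<close> is the \<open>k\<close>-th power of the matrix g - 1.\<close>
  define Y where "Y = rec_nat (\<lambda>i j. if i = j then 1 else 0) (\<lambda>_ y i j. \<Sum>l<n. x i l * y l j)"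
  have Y0: "Y 0 = (\<lambda>i j. if i = j then 1 else 0)" by (simp add: Y_def)
  have YSuc: "Y (Suc k) = (\<lambda>i j. \<Sum>l<n. x i l * Y k l j)" for k by (simp add: Y_def)
  have YA: "Y k i j \<in> A" if "i < n" "j < n" for k i j
    using that
  proof (induction k arbitrary: i j)
    case 0 then show ?case using is_subringD(1,2)[OF A] by (simp add: Y0)
  next
    case (Suc k)
    show ?case unfolding YSuc
    proof (rule is_subring_sum[OF A])
      fix l assume l: "l \<in> {..<n}"
      have "x i l \<in> A" using xI[of i l] is_idealD(2)[OF I(1)] Suc.prems l by auto
      then show "x i l * Y k l j \<in> A" using is_subringD(4)[OF A _ Suc.IH[of l j]] Suc.prems l by simp
    qed
  qed
  have YI: "Y r i j \<in> I" if ij: "i < n" "j < n" for i j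
  proof -
    obtain k where k: "r = Suc k" using r(1) gr0_implies_Suc by blast
    show ?thesis unfolding k YSuc
      by (rule is_ideal_sum[OF I(1)], rule is_idealD(5)[OF I(1)]) (use xI YA ij in auto)
  qed
  have Yv: "(\<Sum>j<n. Y k i j * v j) = (e - 1) ^ k * v i" if "i < n" for k i
    using that
  proof (induction k arbitrary: i)
    case 0 then show ?case using sum_delta[of i v] by (simp add: Y0)
  next
    case (Suc k)
    have "(\<Sum>j<n. Y (Suc k) i j * v j) = (\<Sum>j<n. \<Sum>l<n. x i l * Y k l j * v j)"
      by (simp add: YSuc sum_distrib_right)
    also have "\<dots> = (\<Sum>l<n. \<Sum>j<n. x i l * Y k l j * v j)" by (rule sum.swap)
    also have "\<dots> = (\<Sum>l<n. x i l * (\<Sum>j<n. Y k l j * v j))" by (simp add: sum_distrib_left mult.assoc)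
    also have "\<dots> = (\<Sum>l<n. (e - 1) ^ k * (x i l * v l))" by (rule sum.cong) (use Suc.IH in auto)
    also have "\<dots> = (e - 1) ^ k * ((e - 1) * v i)" using xv[OF Suc.prems] by (simp add: sum_distrib_left[symmetric])
    finally show ?case by simp
  qed
  have "1 \<in> I"
  proof (rule eliminate_mod_ideal[OF A I(1), of 1 n "Y r" v])
    show "1 - 1 \<in> I" using is_idealD(1)[OF I(1)] by simp
    show "\<And>i j. i < n \<Longrightarrow> j < n \<Longrightarrow> Y r i j \<in> I" by (rule YI)
    show "\<And>i. i < n \<Longrightarrow> 1 * v i = (\<Sum>j<n. Y r i j * v j)" using Yv r(2) by simp
    show "\<exists>i<n. v i \<noteq> 0" using e(1) by (simp add: eigen_def)
  qed
  then show False using I(2) by simp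
qed

text \<open>The minimal polynomial of g has no root other than 1, so it divides (X - 1)^d, with d
  its degree, and hence (X - 1)^(p^d). In characteristic \<open>p\<close> the latter is X^(p^d) -
  1.\<close>

lemma unipotent_p_power_order:
  assumes p: "CHAR('a) = p" "p > 0" and g: "g \<in> carrier G" and uni: "\<And>e v. eigen g e v \<Longrightarrow> e = 1"
  shows "\<exists>s. g [^] (p ^ s) = \<one>"
proof -
  \<comment> \<open>The entry of the matrix f(g) at (i, j).\<close>
  define Ev where "Ev f i j = (\<Sum>k\<le>Polynomial.degree f. Polynomial.coeff f k * \<rho> (g [^] k) i j)" for f i j
  have Ev_bound: "Ev f i j = (\<Sum>k\<le>N. Polynomial.coeff f k * \<rho> (g [^] k) i j)" if "Polynomial.degree f \<le> N" for f i j N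
    unfolding Ev_def using that by (intro sum.mono_neutral_left) (auto simp: coeff_eq_0)
  have Ev_add: "Ev (f1 + f2) i j = Ev f1 i j + Ev f2 i j" for f1 f2 i j
  proof -
    let ?N = "max (Polynomial.degree f1) (Polynomial.degree f2)"
    have "Ev (f1 + f2) i j = (\<Sum>k\<le>?N. Polynomial.coeff (f1 + f2) k * \<rho> (g [^] k) i j)"
      by (rule Ev_bound) (rule degree_add_le_max)
    also have "\<dots> = (\<Sum>k\<le>?N. Polynomial.coeff f1 k * \<rho> (g [^] k) i j) + (\<Sum>k\<le>?N. Polynomial.coeff f2 k * \<rho> (g [^] k) i j)"
      by (simp add: sum.distrib algebra_simps)
    finally show ?thesis using Ev_bound[of f1 ?N i j] Ev_bound[of f2 ?N i j] by simp
  qed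
  have Ev_smult: "Ev (Polynomial.smult c f) i j = c * Ev f i j" for c f i j
    using Ev_bound[of "Polynomial.smult c f" "Polynomial.degree f" i j] degree_smult_le[of c f]
    by (simp add: Ev_def sum_distrib_left mult.assoc)
  have Ev_pCons: "Ev (pCons 0 f) i j = (\<Sum>l<n. \<rho> g i l * Ev f l j)" if ij: "i < n" "j < n" for f i j
  proof -
    have "Ev (pCons 0 f) i j = (\<Sum>k\<le>Suc (Polynomial.degree f). Polynomial.coeff (pCons 0 f) k * \<rho> (g [^] k) i j)"
      by (rule Ev_bound) (rule degree_pCons_le)
    also have "\<dots> = (\<Sum>k\<le>Polynomial.degree f. Polynomial.coeff f k * \<rho> (g [^] Suc k) i j)"
      by (subst sum.atMost_Suc_shift) simp
    also have "\<dots> = (\<Sum>k\<le>Polynomial.degree f. \<Sum>l<n. \<rho> g i l * (Polynomial.coeff f k * \<rho> (g [^] k) l j))"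
    proof (rule sum.cong)
      fix k
      have "\<rho> (g [^] Suc k) i j = (\<Sum>l<n. \<rho> g i l * \<rho> (g [^] k) l j)"
        using \<rho>_mult[OF g nat_pow_closed[OF g] ij, of k] nat_pow_Suc2[OF g, of k] by simp
      then show "Polynomial.coeff f k * \<rho> (g [^] Suc k) i j = (\<Sum>l<n. \<rho> g i l * (Polynomial.coeff f k * \<rho> (g [^] k) l j))"
        by (simp add: sum_distrib_left mult.left_commute)
    qed simp
    also have "\<dots> = (\<Sum>l<n. \<Sum>k\<le>Polynomial.degree f. \<rho> g i l * (Polynomial.coeff f k * \<rho> (g [^] k) l j))" by (rule sum.swap)
    finally show ?thesis by (simp add: Ev_def sum_distrib_left)
  qed
  define Ann where "Ann f \<longleftrightarrow> (\<forall>i<n. \<forall>j<n. Ev f i j = 0)" for f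
  have Ann_mult: "Ann (f * h)" if f: "Ann f" for f h
  proof (induction h)
    case 0
    then show ?case by (simp add: Ann_def Ev_def)
  next
    case (pCons a h)
    have "f * pCons a h = Polynomial.smult a f + pCons 0 (f * h)" by simp
    then show ?case using f pCons.IH unfolding Ann_def by (simp add: Ev_add Ev_smult Ev_pCons)
  qed
  define P where "P f \<longleftrightarrow> f \<noteq> 0 \<and> Ann f" for f
  obtain f0 where "P f0"
  proof -
    define w where "w k = (\<lambda>(i, j). if i < n \<and> j < n then \<rho> (g [^] k) i j else 0)" for k :: nat
    have fin: "finite ({..<n} \<times> {..<n})" by simp
    have "w k x = 0" if "x \<notin> {..<n} \<times> {..<n}" for k x using that by (cases x) (auto simp: w_def)
    from linear_dependence[of "{..<n} \<times> {..<n}" w, OF fin this] obtain f :: "'a poly" where f: "f \<noteq> 0"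
      "\<And>x. (\<Sum>k\<le>Polynomial.degree f. Polynomial.coeff f k * w k x) = 0" by blast
    have "Ev f i j = 0" if "i < n" "j < n" for i j
      using f(2)[of "(i, j)"] that by (simp add: Ev_def w_def)
    then have "P f" using f(1) by (simp add: P_def Ann_def)
    then show ?thesis using that by blast
  qed
  define f where "f = arg_min Polynomial.degree P"
  have Pf: "P f" unfolding f_def using \<open>P f0\<close> by (rule arg_min_natI)
  have minf: "Polynomial.degree f \<le> Polynomial.degree h" if "P h" for h
    unfolding f_def using that by (rule arg_min_nat_le)
  have f: "f \<noteq> 0" "Ann f" using Pf by (auto simp: P_def)
  have roots: "z = 1" if z: "poly f z = 0" for z
  proof -
    have "[:- z, 1:] dvd f" using z poly_eq_0_iff_dvd by blast
    then obtain h where h: "f = [:- z, 1:] * h" by (rule dvdE)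
    have h0: "h \<noteq> 0" using h f(1) by auto
    have "Polynomial.degree f = Suc (Polynomial.degree h)" unfolding h using h0 by (subst degree_mult_eq) auto
    then have "\<not> P h" using minf[of h] by auto
    then have "\<not> Ann h" using h0 by (simp add: P_def)
    then obtain i0 j0 where ij: "i0 < n" "j0 < n" "Ev h i0 j0 \<noteq> 0" by (auto simp: Ann_def)
    \<comment> \<open>With f = (X - z) h, a nonzero column of h(g) is an eigenvector of g for
      z.\<close>
    have fh: "f = Polynomial.smult (- z) h + pCons 0 h" unfolding h by simp
    have "(\<Sum>l<n. \<rho> g i l * Ev h l j0) = z * Ev h i j0" if i: "i < n" for i
    proof -
      have "Ev f i j0 = 0" using f(2) i ij by (simp add: Ann_def)
      then show ?thesis unfolding fh Ev_add Ev_smult Ev_pCons[OF i ij(2)] by (simp add: algebra_simps)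
    qed
    then have "eigen g z (\<lambda>i. Ev h i j0)" using ij by (auto simp: eigen_def)
    then show "z = 1" by (rule uni)
  qed
  have dvd: "h dvd [:- 1, 1:] ^ Polynomial.degree h" if "h \<noteq> 0" "\<And>z. poly h z = 0 \<Longrightarrow> z = 1" for h :: "'a poly"
    using that
  proof (induction "Polynomial.degree h" arbitrary: h)
    case 0
    then obtain c where "h = [:c:]" using degree_eq_zeroE by metis
    then show ?case using 0 by (auto simp: const_poly_dvd_iff dvd_field_iff)
  next
    case (Suc d)
    have "Polynomial.degree h > 0" using Suc.hyps(2) by simp
    then obtain z where z: "poly h z = 0" using alg_closed_imp_poly_has_root by blast
    then have z1: "z = 1" by (rule Suc.prems(2))
    have "[:- 1, 1:] dvd h" using z z1 poly_eq_0_iff_dvd by blast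
    then obtain h' where h': "h = [:- 1, 1:] * h'" by (rule dvdE)
    have h'0: "h' \<noteq> 0" using h' Suc.prems(1) by auto
    have deg: "Polynomial.degree h = Suc (Polynomial.degree h')" unfolding h' using h'0 by (subst degree_mult_eq) auto
    have "h' dvd [:- 1, 1:] ^ Polynomial.degree h'"
      by (rule Suc.hyps(1)) (use deg Suc.hyps(2) h'0 Suc.prems(2) h' in auto)
    then show ?case unfolding deg power_Suc by (subst h') (rule mult_dvd_mono[OF dvd_refl])
  qed
  have pp: "prime p" using prime_CHAR_semidom[where 'a = 'a] p by simp
  define d where "d = Polynomial.degree f"
  have "d < p ^ d" using prime_gt_1_nat[OF pp] by (intro power_gt_expt) simp
  then have "f dvd [:- 1, 1:] ^ (p ^ d)"
    using dvd[OF f(1) roots] by (metis d_def dvd_trans le_imp_power_dvd less_imp_le)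
  then obtain h where h: "[:- 1, 1:] ^ (p ^ d) = f * h" by (rule dvdE)
  have char_poly: "CHAR('a poly) = p" using p(1) by simp
  have frob: "[:- 1, 1:] ^ (p ^ d) = Polynomial.monom 1 (p ^ d) - (1 :: 'a poly)"
  proof -
    have "[:- 1, 1:] = Polynomial.monom 1 1 - (1 :: 'a poly)" by (simp add: monom_Suc one_pCons)
    then have "[:- 1, 1:] ^ (p ^ d) = (Polynomial.monom 1 1 - (1 :: 'a poly)) ^ (p ^ d)" by simp
    also have "\<dots> = Polynomial.monom 1 1 ^ (p ^ d) - 1"
    proof -
      have "prime CHAR('a poly)" using char_poly pp by simp
      then have "((Polynomial.monom 1 1 - 1) + 1 :: 'a poly) ^ (p ^ d) = (Polynomial.monom 1 1 - 1) ^ (p ^ d) + 1 ^ (p ^ d)"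
        unfolding char_poly[symmetric] by (rule freshmans_dream'[OF _ refl])
      then show ?thesis by simp
    qed
    finally show ?thesis by (simp add: monom_power)
  qed
  have "Ann (Polynomial.monom 1 (p ^ d) - 1)" using Ann_mult[OF f(2), of h] h frob by simp
  moreover have "Ev (Polynomial.monom 1 (p ^ d) - 1) i j = \<rho> (g [^] (p ^ d)) i j - \<rho> \<one> i j" for i j
  proof -
    have "Ev (Polynomial.monom 1 (p ^ d) - 1) i j =
      (\<Sum>k\<le>p ^ d. Polynomial.coeff (Polynomial.monom 1 (p ^ d) - 1) k * \<rho> (g [^] k) i j)"
      by (rule Ev_bound) (rule degree_diff_le; simp add: degree_monom_eq)
    also have "\<dots> = (\<Sum>k\<le>p ^ d. (if k = p ^ d then \<rho> (g [^] k) i j else 0) - (if k = 0 then \<rho> (g [^] k) i j else 0))"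
      by (rule sum.cong) (use p(2) in auto)
    also have "\<dots> = \<rho> (g [^] (p ^ d)) i j - \<rho> (g [^] (0::nat)) i j"
      using p(2) by (simp add: sum_subtractf sum.delta)
    finally show ?thesis by simp
  qed
  ultimately have "\<rho> (g [^] (p ^ d)) i j = \<rho> \<one> i j" if "i < n" "j < n" for i j
    using that by (simp add: Ann_def)
  then have "g [^] (p ^ d) = \<one>" using \<rho>_inj[OF nat_pow_closed[OF g]] \<rho>_one by simp
  then show ?thesis by blast
qed

end

section \<open>Torsion groups\<close>

context matrix_group_alg_closed
begin

definition act :: "'g \<Rightarrow> (nat \<Rightarrow> 'a) \<Rightarrow> nat \<Rightarrow> 'a" where
  "act g v = (\<lambda>i. if i < n then \<Sum>j<n. \<rho> g i j * v j else 0)"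

text \<open>The module B^n. The zeros from \<open>n\<close> on make vectors with the same
  \<open>n\<close> coordinates equal as functions.\<close>

definition vectors :: "'a set \<Rightarrow> (nat \<Rightarrow> 'a) set" where
  "vectors B = {v. (\<forall>i<n. v i \<in> B) \<and> (\<forall>i\<ge>n. v i = 0)}"

lemma act_act: "g \<in> carrier G \<Longrightarrow> h \<in> carrier G \<Longrightarrow> act (g \<otimes> h) v = act g (act h v)"
  by (auto simp: act_def act_mult fun_eq_iff)

lemma act_id: "v \<in> vectors B \<Longrightarrow> act \<one> v = v"
  by (auto simp: act_def act_one fun_eq_iff vectors_def)

lemma act_add: "act g (v + w) = act g v + act g w"
  by (auto simp: act_def fun_eq_iff algebra_simps sum.distrib)

lemma act_diff: "act g (v - w) = act g v - act g w"
  by (auto simp: act_def fun_eq_iff algebra_simps sum_subtractf)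

lemma act_fscale: "act g (fscale c v) = fscale c (act g v)"
  by (auto simp: act_def fun_eq_iff fscale_def sum_distrib_left mult.left_commute)

lemma act_zero: "act g 0 = 0"
  by (auto simp: act_def fun_eq_iff)

lemma act_in_vectors:
  assumes "is_subring A" "is_ideal A I" "entries_in A (carrier G)" "g \<in> carrier G" "v \<in> vectors I"
  shows "act g v \<in> vectors I"
  using assms(3-5)
  by (auto simp: vectors_def act_def entries_in_def intro!: is_ideal_sum[OF assms(2)] is_idealD(4)[OF assms(2)])

context
  fixes A I :: "'a set" and p :: nat
  assumes A: "is_subring A" and I: "is_ideal A I" and ent: "entries_in A (carrier G)" and cof: "cofinite_in A I"
    and p: "CHAR('a) = p" "p > 0" and tors: "\<forall>g\<in>carrier G. \<exists>s. g [^] (p ^ s) = \<one>"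
begin

text \<open>The \<open>G\<close>-stable \<open>A\<close>-submodules between I^n and A^n. Containing
  I^n makes the quotient of A^n finite.\<close>

definition submod :: "(nat \<Rightarrow> 'a) set \<Rightarrow> bool" where
  "submod U \<longleftrightarrow> U \<subseteq> vectors A \<and> vectors I \<subseteq> U \<and> (\<forall>v\<in>U. \<forall>w\<in>U. v - w \<in> U) \<and>
     (\<forall>c\<in>A. \<forall>v\<in>U. fscale c v \<in> U) \<and> (\<forall>g\<in>carrier G. \<forall>v\<in>U. act g v \<in> U)"

text \<open>Finiteness of A^n/I^n, in the form of a map with finitely many values that separates the
  classes.\<close>

lemma reduction_map: "\<exists>f :: (nat \<Rightarrow> 'a) \<Rightarrow> nat \<Rightarrow> 'a. finite (f ` vectors A) \<and>
    (\<forall>v\<in>vectors A. \<forall>w\<in>vectors A. f v = f w \<longrightarrow> v - w \<in> vectors I)"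
proof -
  obtain T where T: "finite T" "\<And>a. a \<in> A \<Longrightarrow> \<exists>t\<in>T. a - t \<in> I" using cof unfolding cofinite_in_def by blast
  then obtain \<tau> where \<tau>: "\<And>a. a \<in> A \<Longrightarrow> \<tau> a \<in> T" "\<And>a. a \<in> A \<Longrightarrow> a - \<tau> a \<in> I" by metis
  define f where "f v = (\<lambda>i\<in>{..<n}. \<tau> (v i))" for v
  have "f ` vectors A \<subseteq> {..<n} \<rightarrow>\<^sub>E T" using \<tau>(1) by (auto simp: f_def vectors_def PiE_def Pi_def)
  then have "finite (f ` vectors A)" using finite_PiE[of "{..<n}" "\<lambda>_. T"] T(1) finite_subset by blast
  moreover have "v - w \<in> vectors I" if vw: "v \<in> vectors A" "w \<in> vectors A" "f v = f w" for v w
  proof -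
    have "v i - w i \<in> I" if i: "i < n" for i
    proof -
      have "\<tau> (v i) = \<tau> (w i)" using fun_cong[OF vw(3), of i] i by (simp add: f_def)
      moreover have "v i \<in> A" "w i \<in> A" using vw i by (auto simp: vectors_def)
      ultimately have "(v i - \<tau> (v i)) - (w i - \<tau> (v i)) \<in> I" using is_idealD(3)[OF I \<tau>(2) \<tau>(2)] by metis
      then show ?thesis by simp
    qed
    then show ?thesis using vw by (auto simp: vectors_def)
  qed
  ultimately show ?thesis by blast
qed

text \<open>
  The group acts on the finite elementary abelian \<open>p\<close>-group \<open>A\<^sup>n / U\<close> through a finite \<open>p\<close>-group, so
  it fixes a nonzero element.
\<close>

lemma exists_fixed_coset:
  assumes U: "submod U" and ne: "U \<noteq> vectors A"
  shows "\<exists>v\<in>vectors A - U. \<forall>g\<in>carrier G. act g v - v \<in> U"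
proof -
  have UA: "U \<subseteq> vectors A" and IU: "vectors I \<subseteq> U" and Ud: "\<And>v w. v \<in> U \<Longrightarrow> w \<in> U \<Longrightarrow> v - w \<in> U"
    and Uact: "\<And>g v. g \<in> carrier G \<Longrightarrow> v \<in> U \<Longrightarrow> act g v \<in> U"
    using U by (auto simp: submod_def)
  have zI: "0 \<in> vectors I" using is_idealD(1)[OF I] by (simp add: vectors_def)
  then have zU: "0 \<in> U" using IU by blast
  have Um: "- v \<in> U" if "v \<in> U" for v using Ud[OF zU that] by simp
  have Ua: "v + w \<in> U" if "v \<in> U" "w \<in> U" for v w using Ud[OF that(1) Um[OF that(2)]] by simp
  have vA: "v + w \<in> vectors A" "- v \<in> vectors A" if "v \<in> vectors A" "w \<in> vectors A" for v w
    using that is_subringD(5,6)[OF A] by (auto simp: vectors_def)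
  have zA: "0 \<in> vectors A" using zU UA by blast
  have actA: "act g v \<in> vectors A" if "g \<in> carrier G" "v \<in> vectors A" for g v
    by (rule act_in_vectors[OF A is_subring_is_ideal[OF A] ent that])
  \<comment> \<open>The additive group A^n in multiplicative notation, so that the coset lemmas
    apply.\<close>
  define M where "M = \<lparr>carrier = vectors A, monoid.mult = (\<lambda>v w. v + w), one = (0 :: nat \<Rightarrow> 'a)\<rparr>"
  have Ms [simp]: "carrier M = vectors A" "v \<otimes>\<^bsub>M\<^esub> w = v + w" "\<one>\<^bsub>M\<^esub> = 0" for v w
    by (simp_all add: M_def)
  have "comm_group M"
  proof (rule comm_groupI)
    fix v assume "v \<in> carrier M"
    then show "\<exists>w\<in>carrier M. w \<otimes>\<^bsub>M\<^esub> v = \<one>\<^bsub>M\<^esub>" using vA(2) by (intro bexI[of _ "- v"]) auto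
  qed (auto simp: vA zA algebra_simps)
  then interpret M: comm_group M .
  have invM: "inv\<^bsub>M\<^esub> v = - v" if "v \<in> vectors A" for v
    by (rule M.inv_equality) (use that vA in auto)
  have subU: "subgroup U M"
  proof (rule M.subgroupI)
    show "U \<subseteq> carrier M" "U \<noteq> {}" using UA zU by auto
    show "\<And>a. a \<in> U \<Longrightarrow> inv\<^bsub>M\<^esub> a \<in> U" using invM Um UA by auto
    show "\<And>a b. a \<in> U \<Longrightarrow> b \<in> U \<Longrightarrow> a \<otimes>\<^bsub>M\<^esub> b \<in> U" using Ua by simp
  qed
  have normU: "U \<lhd> M" by (rule M.subgroup_imp_normal[OF subU])
  have coset_eq: "U #>\<^bsub>M\<^esub> v = U #>\<^bsub>M\<^esub> w \<longleftrightarrow> v - w \<in> U" if "v \<in> vectors A" "w \<in> vectors A" for v w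
    using M.coset_eq_iff[OF subU, of v w] that invM by simp
  define E where "E = rcosets\<^bsub>M\<^esub> U"
  have Eimg: "E = (\<lambda>v. U #>\<^bsub>M\<^esub> v) ` vectors A" by (simp add: E_def M.rcosets_image)
  have finE: "finite E"
  proof -
    obtain f :: "(nat \<Rightarrow> 'a) \<Rightarrow> nat \<Rightarrow> 'a" where f: "finite (f ` vectors A)"
      "\<And>v w. v \<in> vectors A \<Longrightarrow> w \<in> vectors A \<Longrightarrow> f v = f w \<Longrightarrow> v - w \<in> vectors I" using reduction_map by blast
    show ?thesis unfolding Eimg
      by (rule finite_image_factor[OF f(1)]) (use f(2) coset_eq IU in blast)
  qed
  have U0: "U #>\<^bsub>M\<^esub> 0 = U" using M.coset_mult_one[of U] UA by simp
  have pp: "prime p" using prime_CHAR_semidom[where 'a = 'a] p by simp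
  have pE: "p dvd card E"
  proof -
    interpret U: normal U M by (rule normU)
    interpret Q: group "M Mod U" by (rule U.factorgroup_is_group)
    have cQ: "carrier (M Mod U) = E" by (simp add: FactGroup_def E_def)
    have q: "group_hom M (M Mod U) (\<lambda>v. U #>\<^bsub>M\<^esub> v)"
      unfolding group_hom_def group_hom_axioms_def
      using M.is_group Q.is_group U.r_coset_hom_Mod by simp
    \<comment> \<open>The field has characteristic \<open>p\<close>, so the \<open>p\<close>-fold
      multiple of every vector is 0.\<close>
    have "\<exists>b. C [^]\<^bsub>M Mod U\<^esub> (p ^ b) = \<one>\<^bsub>M Mod U\<^esub>" if C: "C \<in> carrier (M Mod U)" for C
    proof -
      obtain v where v: "v \<in> vectors A" "C = U #>\<^bsub>M\<^esub> v" using C unfolding cQ Eimg by (elim imageE)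
      have "v [^]\<^bsub>M\<^esub> k = fscale (of_nat k) v" for k :: nat
        by (induction k) (auto simp: fscale_def fun_eq_iff algebra_simps)
      then have "v [^]\<^bsub>M\<^esub> p = fscale (of_nat p) v" .
      also have "\<dots> = 0"
        using of_nat_CHAR[where 'a = 'a] unfolding p(1) by (simp add: fscale_def fun_eq_iff)
      finally have "U #>\<^bsub>M\<^esub> (v [^]\<^bsub>M\<^esub> p) = U" using U0 by simp
      then have "C [^]\<^bsub>M Mod U\<^esub> p = U" unfolding v(2)
        using group_hom.hom_nat_pow[OF q, of v p] v(1) by simp
      then show ?thesis by (intro exI[of _ 1]) simp
    qed
    from Q.order_prime_powerI[OF _ pp this] obtain a where a: "Coset.order (M Mod U) = p ^ a"
      using finE cQ by auto
    then have cE: "card E = p ^ a" by (simp add: Coset.order_def cQ)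
    have "a \<noteq> 0"
    proof
      assume "a = 0"
      then have "card E = 1" using cE by simp
      then obtain C where C: "E = {C}" by (rule card_1_singletonE)
      have "vectors A \<subseteq> U"
      proof
        fix v assume v: "v \<in> vectors A"
        have "U #>\<^bsub>M\<^esub> v \<in> E" "U #>\<^bsub>M\<^esub> 0 \<in> E" unfolding Eimg using v zA by blast+
        then have "U #>\<^bsub>M\<^esub> v = U #>\<^bsub>M\<^esub> 0" using C by simp
        then show "v \<in> U" using coset_eq[OF v zA] by simp
      qed
      then show False using ne UA by blast
    qed
    then show ?thesis using cE by (simp add: dvd_power)
  qed
  have actC: "act g ` (U #>\<^bsub>M\<^esub> v) = U #>\<^bsub>M\<^esub> act g v" if g: "g \<in> carrier G" and v: "v \<in> vectors A" for g v
  proof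
    show "act g ` (U #>\<^bsub>M\<^esub> v) \<subseteq> U #>\<^bsub>M\<^esub> act g v"
      using Uact[OF g] by (auto simp: r_coset_def act_add)
    show "U #>\<^bsub>M\<^esub> act g v \<subseteq> act g ` (U #>\<^bsub>M\<^esub> v)"
    proof
      fix w assume "w \<in> U #>\<^bsub>M\<^esub> act g v"
      then obtain u where u: "u \<in> U" "w = u + act g v" by (auto simp: r_coset_def)
      have "act g (act (inv g) u) = u" using act_act[of g "inv g" u] act_id[of u A] u UA g by auto
      then have "w = act g (act (inv g) u + v)" using u by (simp add: act_add)
      moreover have "act (inv g) u + v \<in> U #>\<^bsub>M\<^esub> v" using Uact[of "inv g" u] g u by (auto simp: r_coset_def)
      ultimately show "w \<in> act g ` (U #>\<^bsub>M\<^esub> v)" by blast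
    qed
  qed
  define \<phi> where "\<phi> g = (\<lambda>C\<in>E. act g ` C)" for g
  have ga: "group_action G E \<phi>"
    unfolding \<phi>_def
  proof (rule group_actionI[OF is_group])
    show "act g ` C \<in> E" if "g \<in> carrier G" "C \<in> E" for g C
      using that actC actA unfolding Eimg by auto
    show "act (g \<otimes> h) ` C = act g ` act h ` C" if "g \<in> carrier G" "h \<in> carrier G" for g h C
      using that by (simp add: act_act image_image)
    show "act \<one> ` C = C" if "C \<in> E" for C
    proof -
      obtain v where v: "v \<in> vectors A" "C = U #>\<^bsub>M\<^esub> v" using \<open>C \<in> E\<close> unfolding Eimg by (elim imageE)
      then show ?thesis using actC[OF one_closed v(1)] act_id[OF v(1)] by simp
    qed
  qed
  then have hom: "group_hom G (BijGroup E) \<phi>" by (rule group_action.group_hom)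
  \<comment> \<open>\<open>G\<close> may be infinite; its image in the permutations of the finite
    set \<open>E\<close> is a finite \<open>p\<close>-group by \<open>tors\<close>.\<close>
  define Q where "Q = (BijGroup E)\<lparr>carrier := \<phi> ` carrier G\<rparr>"
  have gQ: "group Q" unfolding Q_def
    by (rule subgroup.subgroup_is_group[OF group_hom.img_is_subgroup[OF hom] group_BijGroup])
  have finQ: "finite (carrier Q)"
  proof -
    have "\<phi> ` carrier G \<subseteq> E \<rightarrow>\<^sub>E E"
    proof
      fix T assume "T \<in> \<phi> ` carrier G"
      then obtain g where g: "g \<in> carrier G" "T = \<phi> g" by (elim imageE)
      have "T \<in> Bij E" using group_hom.hom_closed[OF hom g(1)] g(2) by (simp add: BijGroup_def)
      then have "T ` E = E" "T \<in> extensional E" by (auto simp: Bij_def bij_betw_def)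
      then show "T \<in> E \<rightarrow>\<^sub>E E" by (intro PiE_I) (auto simp: extensional_def)
    qed
    moreover have "finite (E \<rightarrow>\<^sub>E E)" by (rule finite_PiE) (use finE in auto)
    ultimately have "finite (\<phi> ` carrier G)" by (rule finite_subset)
    then show ?thesis unfolding Q_def by simp
  qed
  have "\<exists>b. T [^]\<^bsub>Q\<^esub> (p ^ b) = \<one>\<^bsub>Q\<^esub>" if T: "T \<in> carrier Q" for T
  proof -
    obtain g where g: "g \<in> carrier G" "T = \<phi> g" using T by (auto simp: Q_def)
    obtain s where s: "g [^] (p ^ s) = \<one>" using bspec[OF tors g(1)] by blast
    have "T [^]\<^bsub>Q\<^esub> (p ^ s) = T [^]\<^bsub>BijGroup E\<^esub> (p ^ s)" by (simp add: Q_def nat_pow_def)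
    also have "\<dots> = \<phi> (g [^] (p ^ s))" unfolding g(2) using group_hom.hom_nat_pow[OF hom g(1)] by simp
    also have "\<dots> = \<one>\<^bsub>Q\<^esub>" unfolding s using group_hom.hom_one[OF hom] by (simp add: Q_def)
    finally show ?thesis by blast
  qed
  from group.order_prime_powerI[OF gQ finQ pp this] obtain a where ordQ: "Coset.order Q = p ^ a" by blast
  have "p dvd card {C \<in> E. \<forall>T\<in>carrier Q. T C = C}"
  proof (rule fixed_points_cong'[OF gQ pp ordQ finE, THEN iffD1, OF _ _ _ pE])
    show "T C \<in> E" if "T \<in> carrier Q" "C \<in> E" for T C
      using that actC actA unfolding Q_def \<phi>_def Eimg by auto
    show "(T \<otimes>\<^bsub>Q\<^esub> T') C = T (T' C)" if T: "T \<in> carrier Q" "T' \<in> carrier Q" "C \<in> E" for T T' C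
    proof -
      have "T \<in> carrier (BijGroup E)" "T' \<in> carrier (BijGroup E)"
        using T(1,2) group_hom.hom_closed[OF hom] by (auto simp: Q_def image_def)
      then have "T \<in> Bij E" "T' \<in> Bij E" by (simp_all add: BijGroup_def)
      then show ?thesis using T(3) by (simp add: Q_def BijGroup_def compose_def)
    qed
    show "\<And>C. C \<in> E \<Longrightarrow> \<one>\<^bsub>Q\<^esub> C = C" by (simp add: Q_def BijGroup_def)
  qed
  \<comment> \<open>The zero coset is fixed. Since the number of fixed cosets is divisible by
    \<open>p\<close>, there is another one.\<close>
  moreover have "U \<in> {C \<in> E. \<forall>T\<in>carrier Q. T C = C}"
  proof -
    have "U \<in> E" using U0 zA unfolding Eimg by (metis imageI)
    moreover have "act g ` U = U" if "g \<in> carrier G" for g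
      using actC[OF that zA] act_zero[of g] U0 by simp
    ultimately show ?thesis by (auto simp: Q_def \<phi>_def)
  qed
  ultimately have "\<not> {C \<in> E. \<forall>T\<in>carrier Q. T C = C} \<subseteq> {U}"
  proof -
    assume a: "p dvd card {C \<in> E. \<forall>T\<in>carrier Q. T C = C}" "U \<in> {C \<in> E. \<forall>T\<in>carrier Q. T C = C}"
    show ?thesis
    proof
      assume "{C \<in> E. \<forall>T\<in>carrier Q. T C = C} \<subseteq> {U}"
      then have "{C \<in> E. \<forall>T\<in>carrier Q. T C = C} = {U}" using a(2) by blast
      then have "p dvd 1" using a(1) by (metis card_1_singleton_iff One_nat_def)
      then show False using pp by (simp add: prime_nat_iff)
    qed
  qed
  then obtain C where C0: "C \<in> {C \<in> E. \<forall>T\<in>carrier Q. T C = C}" "C \<notin> {U}"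
    unfolding subset_eq Ball_def not_all not_imp by (elim exE conjE)
  then have C: "C \<in> E" "\<And>T. T \<in> carrier Q \<Longrightarrow> T C = C" "C \<noteq> U" by simp_all
  obtain v where v: "v \<in> vectors A" "C = U #>\<^bsub>M\<^esub> v" using C(1) unfolding Eimg by (elim imageE)
  have "v \<notin> U"
  proof
    assume "v \<in> U"
    then have "U #>\<^bsub>M\<^esub> v = U #>\<^bsub>M\<^esub> 0" using coset_eq[OF v(1) zA] by simp
    then show False using C(3) v(2) U0 by simp
  qed
  moreover have "act g v - v \<in> U" if g: "g \<in> carrier G" for g
  proof -
    have "\<phi> g C = C" using C(2) g by (simp add: Q_def)
    then have "U #>\<^bsub>M\<^esub> act g v = U #>\<^bsub>M\<^esub> v" using C(1) actC[OF g v(1)] v(2) by (simp add: \<phi>_def)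
    then show ?thesis using coset_eq[OF actA[OF g v(1)] v(1)] by simp
  qed
  ultimately show ?thesis using v(1) by blast
qed

text \<open>Each step adds the vectors that are fixed by \<open>G\<close> modulo the previous term,
  as in the upper central series of a group.\<close>

definition fixed_chain :: "nat \<Rightarrow> (nat \<Rightarrow> 'a) set" where
  "fixed_chain = rec_nat (vectors I) (\<lambda>_ U. {v \<in> vectors A. \<forall>g\<in>carrier G. act g v - v \<in> U})"

lemma fixed_chain_simps:
  "fixed_chain 0 = vectors I"
  "fixed_chain (Suc j) = {v \<in> vectors A. \<forall>g\<in>carrier G. act g v - v \<in> fixed_chain j}"
  by (simp_all add: fixed_chain_def)

lemma fixed_chain_submod: "submod (fixed_chain j) \<and> fixed_chain j \<subseteq> fixed_chain (Suc j)"
proof (induction j)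
  case 0
  have IA: "vectors I \<subseteq> vectors A" using is_idealD(2)[OF I] by (auto simp: vectors_def)
  have d: "v - w \<in> vectors I" if "v \<in> vectors I" "w \<in> vectors I" for v w
    using that is_idealD(3)[OF I] by (auto simp: vectors_def)
  have "fscale c v \<in> vectors I" if "c \<in> A" "v \<in> vectors I" for c v
    using that is_idealD(4)[OF I] by (auto simp: vectors_def fscale_def)
  then have "submod (vectors I)" unfolding submod_def using IA d act_in_vectors[OF A I ent] by blast
  moreover have "vectors I \<subseteq> {v \<in> vectors A. \<forall>g\<in>carrier G. act g v - v \<in> vectors I}"
    using IA d act_in_vectors[OF A I ent] by blast
  ultimately show ?case by (simp add: fixed_chain_simps)
next
  case (Suc j)
  then have s: "submod (fixed_chain j)" and inc: "fixed_chain j \<subseteq> fixed_chain (Suc j)" by auto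
  have Ud: "\<And>v w. v \<in> fixed_chain j \<Longrightarrow> w \<in> fixed_chain j \<Longrightarrow> v - w \<in> fixed_chain j"
    and Us: "\<And>c v. c \<in> A \<Longrightarrow> v \<in> fixed_chain j \<Longrightarrow> fscale c v \<in> fixed_chain j"
    and UI: "vectors I \<subseteq> fixed_chain j"
    using s by (auto simp: submod_def)
  let ?F = "fixed_chain (Suc j)"
  have FA: "?F \<subseteq> vectors A" by (auto simp: fixed_chain_simps)
  have F: "act g v - v \<in> fixed_chain j" if "g \<in> carrier G" "v \<in> ?F" for g v
    using that by (simp add: fixed_chain_simps)
  have d: "v - w \<in> ?F" if vw: "v \<in> ?F" "w \<in> ?F" for v w
  proof -
    have "v \<in> vectors A" "w \<in> vectors A" using vw FA by blast+
    then have "v - w \<in> vectors A" using is_subringD(3)[OF A] by (auto simp: vectors_def)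
    moreover have "act g (v - w) - (v - w) \<in> fixed_chain j" if g: "g \<in> carrier G" for g
    proof -
      have "act g (v - w) - (v - w) = (act g v - v) - (act g w - w)" by (simp add: act_diff)
      then show ?thesis using Ud[OF F[OF g vw(1)] F[OF g vw(2)]] by (simp only:)
    qed
    ultimately show ?thesis by (simp add: fixed_chain_simps)
  qed
  have sc: "fscale c v \<in> ?F" if cv: "c \<in> A" "v \<in> ?F" for c v
  proof -
    have "v \<in> vectors A" using cv FA by blast
    then have "fscale c v \<in> vectors A" using cv(1) is_subringD(4)[OF A] by (auto simp: vectors_def fscale_def)
    moreover have "act g (fscale c v) - fscale c v \<in> fixed_chain j" if g: "g \<in> carrier G" for g
    proof -
      have "act g (fscale c v) - fscale c v = fscale c (act g v - v)" by (simp add: act_fscale FV.scale_right_diff_distrib)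
      then show ?thesis using Us[OF cv(1) F[OF g cv(2)]] by (simp only:)
    qed
    ultimately show ?thesis by (simp add: fixed_chain_simps)
  qed
  have ac: "act g v \<in> ?F" if g: "g \<in> carrier G" and v: "v \<in> ?F" for g v
  proof -
    \<comment> \<open>\<open>act g v\<close> differs from \<open>v\<close> by an element of the
      previous term, which \<open>inc\<close> places in the current one.\<close>
    have "v - (v - act g v) \<in> ?F"
    proof (rule d[OF v])
      have "act g v - v \<in> ?F" using F[OF g v] inc by (rule rev_subsetD)
      moreover have "0 \<in> ?F" using d[OF v v] by simp
      ultimately have "0 - (act g v - v) \<in> ?F" by (rule d[rotated])
      then show "v - act g v \<in> ?F" by (simp only: diff_0 minus_diff_eq)
    qed
    then show ?thesis by (simp only: diff_diff_eq2 add_diff_cancel_left')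
  qed
  have "submod ?F"
    unfolding submod_def by (intro conjI ballI FA subset_trans[OF UI inc] d sc ac)
  moreover have "?F \<subseteq> fixed_chain (Suc (Suc j))"
  proof
    fix v assume v: "v \<in> ?F"
    have "act g v - v \<in> ?F" if "g \<in> carrier G" for g using F[OF that v] inc by (rule rev_subsetD)
    moreover have "v \<in> vectors A" using v FA by (rule rev_subsetD)
    ultimately show "v \<in> fixed_chain (Suc (Suc j))" unfolding fixed_chain_simps(2)[of "Suc j"] by simp
  qed
  ultimately show ?case by blast
qed

lemma submod_sum:
  assumes "submod U" "\<And>d. d \<in> D \<Longrightarrow> r d \<in> A \<and> d \<in> U"
  shows "(\<Sum>d\<in>D. fscale (r d) d) \<in> U"
proof -
  have z: "0 \<in> U" using assms(1) is_idealD(1)[OF I] by (auto simp: submod_def vectors_def)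
  have "v + w \<in> U" if "v \<in> U" "w \<in> U" for v w
  proof -
    have "v - (0 - w) \<in> U" using assms(1) that z unfolding submod_def by metis
    then show ?thesis by simp
  qed
  moreover have "fscale (r d) d \<in> U" if "d \<in> D" for d using assms(2)[OF that] assms(1) by (simp add: submod_def)
  ultimately show ?thesis using z by (induction D rule: infinite_finite_induct) auto
qed

text \<open>By \<open>exists_fixed_coset\<close> the chain increases strictly until it reaches A^n,
  and only finitely many classes modulo I^n are available.\<close>

lemma fixed_chain_top: "\<exists>m. fixed_chain m = vectors A"
proof (rule ccontr)
  assume no: "\<nexists>m. fixed_chain m = vectors A"
  have "\<exists>v. v \<in> fixed_chain (Suc j) \<and> v \<notin> fixed_chain j" for j
  proof -
    have "fixed_chain j \<noteq> vectors A" using no by blast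
    then obtain v where "v \<in> vectors A - fixed_chain j" "\<forall>g\<in>carrier G. act g v - v \<in> fixed_chain j"
      using exists_fixed_coset fixed_chain_submod by blast
    then show ?thesis by (auto simp: fixed_chain_simps)
  qed
  then obtain v where v: "\<And>j. v j \<in> fixed_chain (Suc j)" "\<And>j. v j \<notin> fixed_chain j" by metis
  obtain f :: "(nat \<Rightarrow> 'a) \<Rightarrow> nat \<Rightarrow> 'a" where f: "finite (f ` vectors A)"
      "\<And>v w. v \<in> vectors A \<Longrightarrow> w \<in> vectors A \<Longrightarrow> f v = f w \<Longrightarrow> v - w \<in> vectors I" using reduction_map by blast
  have vA: "v j \<in> vectors A" for j using v(1)[of j] by (simp add: fixed_chain_simps)
  have "range (\<lambda>j. f (v j)) \<subseteq> f ` vectors A" using vA by blast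
  then have "finite (range (\<lambda>j. f (v j)))" using f(1) finite_subset by blast
  then have "\<not> inj (\<lambda>j. f (v j))" using finite_imageD by fastforce
  then obtain i' j' where ij': "f (v i') = f (v j')" "i' \<noteq> j'" unfolding inj_def by blast
  define i where "i = min i' j'"
  define j where "j = max i' j'"
  have ij: "f (v i) = f (v j)" "i < j" using ij' by (auto simp: i_def j_def min_def max_def)
  have "v i - v j \<in> vectors I" by (rule f(2)[OF vA vA ij(1)])
  then have d: "v i - v j \<in> fixed_chain j" using fixed_chain_submod[of j] by (auto simp: submod_def)
  have "fixed_chain (Suc i) \<subseteq> fixed_chain j"
    by (rule lift_Suc_mono_le[of fixed_chain]) (use fixed_chain_submod ij(2) in auto)
  then have "v i \<in> fixed_chain j" using v(1) by blast
  then have "v i - (v i - v j) \<in> fixed_chain j" using d fixed_chain_submod[of j] unfolding submod_def by blast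
  then show False using v(2)[of j] by simp
qed

end

end

text \<open>Take \<open>k\<close> with \<open>W k\<close> of least dimension; a vector of
  \<open>W k\<close> outside \<open>W (Suc k)\<close> would make the next dimension smaller
  still.\<close>

lemma (in vector_space) decreasing_subspaces_stabilize:
  assumes "finite E" "\<And>k. subspace (W k)" "W 0 \<subseteq> span E" "\<And>k. W (Suc k) \<subseteq> W k"
  shows "\<exists>k. W (Suc k) = W k"
proof -
  have WE: "W k \<subseteq> span E" for k using assms(3,4) by (induction k) blast+
  define k where "k = arg_min (\<lambda>k. dim (W k)) (\<lambda>_. True)"
  have min: "dim (W k) \<le> dim (W j)" for j unfolding k_def by (rule arg_min_nat_le) simp
  obtain B where B: "B \<subseteq> W k" "independent B" "W k \<subseteq> span B" "card B = dim (W k)" by (rule basis_exists)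
  obtain B' where B': "B' \<subseteq> W (Suc k)" "independent B'" "W (Suc k) \<subseteq> span B'" "card B' = dim (W (Suc k))"
    by (rule basis_exists)
  have "W k \<subseteq> W (Suc k)"
  proof
    fix v assume v: "v \<in> W k"
    show "v \<in> W (Suc k)"
    proof (rule ccontr)
      assume nv: "v \<notin> W (Suc k)"
      have "span B' \<subseteq> W (Suc k)" by (rule span_minimal[OF B'(1) assms(2)])
      then have nv': "v \<notin> span B'" using nv by blast
      then have ind: "independent (insert v B')" by (rule independent_insertI[OF _ B'(2)])
      have "finite B" using independent_span_bound[OF assms(1) B(2)] B(1) WE[of k] by blast
      moreover have "insert v B' \<subseteq> span B" using v B(3) B'(1) assms(4)[of k] by blast
      ultimately have f: "finite (insert v B') \<and> card (insert v B') \<le> card B"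
        by (intro independent_span_bound[OF _ ind])
      have "v \<notin> B'" using nv' span_base by blast
      then have "card (insert v B') = Suc (card B')" using f by (intro card_insert_disjoint) auto
      then have "dim (W (Suc k)) < dim (W k)" using f B(4) B'(4) by linarith
      then show False using min[of "Suc k"] by simp
    qed
  qed
  then show ?thesis using assms(4)[of k] by blast
qed

text \<open>In positive characteristic the prime field is finite, and so is the span of finitely
  many vectors over it.\<close>

lemma finite_additive_closure:
  fixes V :: "('x \<Rightarrow> 'a::field) set"
  assumes char: "CHAR('a) > 0" and V: "finite V"
  shows "\<exists>C. finite C \<and> 0 \<in> C \<and> V \<subseteq> C \<and> (\<forall>x\<in>C. \<forall>y\<in>C. x + y \<in> C)"
  using V
proof (induction V rule: finite_induct)
  case empty
  show ?case by (rule exI[of _ "{0}"]) auto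
next
  case (insert v V)
  then obtain C where C: "finite C" "0 \<in> C" "V \<subseteq> C" "\<And>x y. x \<in> C \<Longrightarrow> y \<in> C \<Longrightarrow> x + y \<in> C" by blast
  define C' where "C' = (\<lambda>(z, y). fscale z v + y) ` (range of_int \<times> C)"
  have C'I: "fscale (of_int z) v + y \<in> C'" if "y \<in> C" for z y
    unfolding C'_def by (rule image_eqI[of _ _ "(of_int z, y)"]) (use that in auto)
  have C'E: "\<exists>z y. y \<in> C \<and> x = fscale (of_int z) v + y" if "x \<in> C'" for x using that by (auto simp: C'_def)
  have "finite C'" unfolding C'_def using C(1) finite_range_of_int[OF char] by simp
  moreover have C': "x \<in> C'" if "x \<in> C" for x using C'I[OF that, of 0] by (simp add: fscale_def zero_fun_def[symmetric])
  moreover have vC: "v \<in> C'" using C'I[OF C(2), of 1] by (simp add: fscale_def)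
  moreover have "x + y \<in> C'" if x: "x \<in> C'" and y: "y \<in> C'" for x y
  proof -
    obtain z1 y1 z2 y2 where *: "y1 \<in> C" "x = fscale (of_int z1) v + y1" "y2 \<in> C" "y = fscale (of_int z2) v + y2"
      using C'E[OF x] C'E[OF y] by (elim exE conjE)
    have "x + y = fscale (of_int (z1 + z2)) v + (y1 + y2)"
      unfolding * by (simp add: fscale_def fun_eq_iff algebra_simps)
    then show ?thesis using C'I[OF C(4)[OF *(1,3)]] by (simp only:)
  qed
  moreover have "0 \<in> C'" by (rule C'[OF C(2)])
  moreover have "insert v V \<subseteq> C'" by (intro insert_subsetI[OF vC] subsetI C' subsetD[OF C(3)])
  ultimately show ?case by (intro exI[of _ C'] conjI ballI)
qed

context matrix_group_alg_closed
begin

text \<open>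
  Iterating the augmentation ideal. If the chain stabilised at \<open>W \<noteq> 0\<close>, a basis of \<open>W\<close> would satisfy
  relations that survive in a finite quotient ring, where a finite \<open>p\<close>-group acts nilpotently.
\<close>

definition augmentation_chain :: "nat \<Rightarrow> (nat \<Rightarrow> 'a) set" where
  "augmentation_chain = rec_nat (vectors UNIV) (\<lambda>_ U. FV.span {act g u - u | g u. g \<in> carrier G \<and> u \<in> U})"

lemma augmentation_chain_simps:
  "augmentation_chain 0 = vectors UNIV"
  "augmentation_chain (Suc k) = FV.span {act g u - u | g u. g \<in> carrier G \<and> u \<in> augmentation_chain k}"
  by (simp_all add: augmentation_chain_def)

lemma augmentation_chain_subspace:
  "FV.subspace (augmentation_chain k) \<and> (\<forall>g\<in>carrier G. \<forall>v\<in>augmentation_chain k. act g v \<in> augmentation_chain k)"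
proof (induction k)
  case 0
  have "FV.subspace (vectors UNIV)" by (rule FV.subspaceI) (auto simp: vectors_def fscale_def)
  then show ?case by (auto simp: augmentation_chain_simps vectors_def act_def)
next
  case (Suc k)
  let ?W = "augmentation_chain k" and ?D = "{act g u - u | g u. g \<in> carrier G \<and> u \<in> augmentation_chain k}"
  have "act h v \<in> FV.span ?D" if h: "h \<in> carrier G" and v: "v \<in> FV.span ?D" for h v
    using v
  proof (induction v rule: FV.span_induct)
    case base
    show ?case by (auto simp: FV.subspace_def act_zero FV.span_zero act_add FV.span_add act_fscale FV.span_scale)
  next
    case (step x)
    then obtain g u where gu: "g \<in> carrier G" "u \<in> ?W" "x = act g u - u" by blast
    \<comment> \<open>Both differences start from the same vector \<open>u\<close>, so they belong
      to the generating set \<open>?D\<close>.\<close>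
    have "act h x = (act (h \<otimes> g) u - u) - (act h u - u)" unfolding gu(3) act_diff using act_act[OF h gu(1)] by simp
    moreover have "act (h \<otimes> g) u - u \<in> ?D" "act h u - u \<in> ?D" using gu h m_closed[OF h gu(1)] by blast+
    ultimately show ?case using FV.span_diff[OF FV.span_base FV.span_base] by (simp only:)
  qed
  then show ?case unfolding augmentation_chain_simps using FV.subspace_span by blast
qed

lemma augmentation_chain_decreasing: "augmentation_chain (Suc k) \<subseteq> augmentation_chain k"
  unfolding augmentation_chain_simps
proof (rule FV.span_minimal)
  show "FV.subspace (augmentation_chain k)" using augmentation_chain_subspace by blast
  then show "{act g u - u |g u. g \<in> carrier G \<and> u \<in> augmentation_chain k} \<subseteq> augmentation_chain k"
    using augmentation_chain_subspace[of k] FV.subspace_diff by blast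
qed

lemma augmentation_chain_stable: "\<exists>k. augmentation_chain (Suc k) = augmentation_chain k"
proof (rule FV.decreasing_subspaces_stabilize)
  let ?E = "(\<lambda>x y. if y = x then 1 else 0 :: 'a) ` {..<n}"
  show "finite ?E" by simp
  show "augmentation_chain 0 \<subseteq> FV.span ?E"
  proof
    fix v assume "v \<in> augmentation_chain 0"
    then have "v x = 0" if "x \<notin> {..<n}" for x using that by (auto simp: augmentation_chain_simps vectors_def)
    then show "v \<in> FV.span ?E" by (intro supported_in_span) auto
  qed
qed (use augmentation_chain_subspace augmentation_chain_decreasing in auto)

text \<open>For a generator t the vector t v - v lies one step deeper in the chain, so its orbit is
  finite by induction. The cocycle identity (g h) v - v = g (h v - v) + (g v - v) then keeps all
  differences in a finite additively closed set, and the orbit of \<open>v\<close> is contained in a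
  translate of it.\<close>

lemma orbits_finite:
  assumes char: "CHAR('a) > 0" and S: "finite S" "S \<subseteq> carrier G" "generate G S = carrier G"
    and k: "augmentation_chain (j + d) = {0}" and v: "v \<in> augmentation_chain j"
  shows "finite ((\<lambda>g. act g v) ` carrier G)"
  using k v
proof (induction d arbitrary: j v)
  case 0
  then have "v = 0" by (simp only: add_0_right singleton_iff)
  then have "(\<lambda>g. act g v) ` carrier G \<subseteq> {0}" using act_zero by blast
  then show ?case using finite_subset by blast
next
  case (Suc d)
  have vv: "v \<in> vectors UNIV"
  proof -
    have "augmentation_chain j \<subseteq> augmentation_chain 0"
      by (rule lift_Suc_antimono_le[of augmentation_chain]) (use augmentation_chain_decreasing in auto)
    then show ?thesis using Suc.prems(2) by (auto simp: augmentation_chain_simps)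
  qed
  let ?T = "S \<union> m_inv G ` S"
  have T: "?T \<subseteq> carrier G" using S(2) by auto
  have diff: "act g v - v \<in> augmentation_chain (Suc j)" if "g \<in> carrier G" for g
    unfolding augmentation_chain_simps by (rule FV.span_base) (use that Suc.prems(2) in blast)
  have "finite ((\<lambda>g. act g (act t v - v)) ` carrier G)" if "t \<in> ?T" for t
    by (rule Suc.IH[OF _ diff]) (use that T Suc.prems(1) in auto)
  then have "finite (\<Union>t\<in>?T. (\<lambda>g. act g (act t v - v)) ` carrier G)" using S(1) by simp
  from finite_additive_closure[OF char this] obtain C where C: "finite C" "0 \<in> C"
    "(\<Union>t\<in>?T. (\<lambda>g. act g (act t v - v)) ` carrier G) \<subseteq> C" "\<forall>x\<in>C. \<forall>y\<in>C. x + y \<in> C" by (elim exE conjE)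
  have tC: "act u (act t v - v) \<in> C" if "u \<in> carrier G" "t \<in> ?T" for u t by (rule subsetD[OF C(3)]) (use that in auto)
  \<comment> \<open>The translate by \<open>u\<close> is part of the claim because the cocycle
    identity applies the first factor to the difference that belongs to the second.\<close>
  have "\<forall>u\<in>carrier G. act u (act g v - v) \<in> C" if "g \<in> generate G S" for g
    using that
  proof (induction rule: generate.induct)
    case one
    show ?case by (simp only: act_id[OF vv] diff_self act_zero C(2)) (intro ballI TrueI)
  next
    case (incl h) then show ?case by (intro ballI tC) simp_all
  next
    case (inv h) then show ?case by (intro ballI tC) simp_all
  next
    case (eng h1 h2)
    have h: "h1 \<in> carrier G" "h2 \<in> carrier G" using eng.hyps S(3) by simp_all
    show ?case
    proof
      fix u assume u: "u \<in> carrier G"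
      have "act u (act (h1 \<otimes> h2) v - v) = act (u \<otimes> h1) (act h2 v - v) + act u (act h1 v - v)"
        using u h by (simp add: act_diff act_act)
      moreover have "act (u \<otimes> h1) (act h2 v - v) \<in> C" using eng.IH(2) m_closed[OF u h(1)] by (rule bspec)
      moreover have "act u (act h1 v - v) \<in> C" using eng.IH(1) u by (rule bspec)
      ultimately show "act u (act (h1 \<otimes> h2) v - v) \<in> C" using C(4) by (simp only:)
    qed
  qed
  then have "act \<one> (act g v - v) \<in> C" if "g \<in> carrier G" for g using that S(3) by simp
  then have orb: "act g v - v \<in> C" if "g \<in> carrier G" for g
    using that act_diff act_act[OF one_closed that] act_id[OF vv] by (metis l_one)
  have "(\<lambda>g. act g v) ` carrier G \<subseteq> (\<lambda>x. x + v) ` C"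
  proof
    fix w assume "w \<in> (\<lambda>g. act g v) ` carrier G"
    then obtain g where g: "g \<in> carrier G" "w = act g v" by (elim imageE)
    show "w \<in> (\<lambda>x. x + v) ` C" by (rule image_eqI[OF _ orb[OF g(1)]]) (simp add: g(2))
  qed
  then show ?case using C(1) finite_subset by blast
qed

text \<open>In a stable term \<open>W\<close> each basis vector is a finite combination of
  differences g b' - b' of basis vectors b'. With all coefficients and coordinates in a ring
  \<open>A\<close>, the fixed chain, which reaches A^n, allows the basis to be pushed down term by
  term into the vectors over \<open>J 1\<close>. This is impossible if a coordinate of a basis
  vector is a unit modulo \<open>J 1\<close>.\<close>

lemma augmentation_chain_vanishes:
  assumes p: "CHAR('a) = p" "p > 0" and tors: "\<forall>g\<in>carrier G. \<exists>s. g [^] (p ^ s) = \<one>"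
    and S: "finite S" "S \<subseteq> carrier G" "generate G S = carrier G"
  shows "\<exists>k. augmentation_chain k = {0}"
proof -
  obtain k where k: "augmentation_chain (Suc k) = augmentation_chain k" using augmentation_chain_stable by blast
  define W where "W = augmentation_chain k"
  have subW: "FV.subspace W" using augmentation_chain_subspace by (simp add: W_def)
  have WV: "W \<subseteq> vectors UNIV"
  proof -
    have "augmentation_chain k \<subseteq> augmentation_chain 0"
      by (rule lift_Suc_antimono_le[of augmentation_chain]) (use augmentation_chain_decreasing in auto)
    then show ?thesis by (simp add: W_def augmentation_chain_simps)
  qed
  obtain B where B: "B \<subseteq> W" "FV.independent B" "W \<subseteq> FV.span B" by (rule FV.basis_exists)
  have finB: "finite B"
  proof -
    let ?E = "(\<lambda>x y. if y = x then 1 else 0 :: 'a) ` {..<n}"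
    have "B \<subseteq> FV.span ?E"
    proof
      fix v assume "v \<in> B"
      then have "v x = 0" if "x \<notin> {..<n}" for x using that B(1) WV by (auto simp: vectors_def)
      then show "v \<in> FV.span ?E" by (intro supported_in_span) auto
    qed
    then show ?thesis using FV.independent_span_bound[OF _ B(2), of ?E] by simp
  qed
  define D where "D = {act g b - b | g b. g \<in> carrier G \<and> b \<in> B}"
  have "act g u - u \<in> FV.span D" if g: "g \<in> carrier G" and u: "u \<in> FV.span B" for g u
    using u
  proof (induction u rule: FV.span_induct)
    case base
    show ?case
    proof (rule FV.subspaceI, unfold mem_Collect_eq)
      show "act g 0 - 0 \<in> FV.span D" unfolding act_zero diff_self by (rule FV.span_zero)
      show "act g (x + y) - (x + y) \<in> FV.span D"
        if "act g x - x \<in> FV.span D" "act g y - y \<in> FV.span D" for x y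
        unfolding act_add add_diff_add by (rule FV.span_add[OF that])
      show "act g (fscale c x) - fscale c x \<in> FV.span D" if "act g x - x \<in> FV.span D" for c x
        unfolding act_fscale FV.scale_right_diff_distrib[symmetric] by (rule FV.span_scale[OF that])
    qed
  next
    case (step x)
    then show ?case using g unfolding D_def by (intro FV.span_base) blast
  qed
  then have "{act g u - u | g u. g \<in> carrier G \<and> u \<in> W} \<subseteq> FV.span D" using B(3) by blast
  then have "augmentation_chain (Suc k) \<subseteq> FV.span D"
    unfolding augmentation_chain_simps W_def[symmetric] by (rule FV.span_minimal) (rule FV.subspace_span)
  then have "B \<subseteq> FV.span D" using B(1) k by (simp add: W_def)
  then have "\<forall>b\<in>B. \<exists>t r. finite t \<and> t \<subseteq> D \<and> b = (\<Sum>d\<in>t. fscale (r d) d)"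
    unfolding FV.span_explicit by blast
  then obtain t r where tr: "\<And>b. b \<in> B \<Longrightarrow> finite (t b)" "\<And>b. b \<in> B \<Longrightarrow> t b \<subseteq> D"
    "\<And>b. b \<in> B \<Longrightarrow> b = (\<Sum>d\<in>t b. fscale (r b d) d)" by metis
  have "B = {}"
  proof (rule ccontr)
    assume "B \<noteq> {}"
    then obtain b0 where b0: "b0 \<in> B" by blast
    have "b0 \<noteq> 0" using b0 B(2) FV.dependent_zero by blast
    moreover have "b0 i = 0" if "i \<ge> n" for i using b0 B(1) WV that by (auto simp: vectors_def)
    ultimately obtain i0 where i0: "i0 < n" "b0 i0 \<noteq> 0" by (metis ext not_le zero_fun_apply)
    define E where "E = (\<lambda>(g, i, j). \<rho> g i j) ` ((S \<union> m_inv G ` S) \<times> {..<n} \<times> {..<n}) \<union>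
      (\<lambda>(b, i). b i) ` (B \<times> {..<n}) \<union> (\<Union>b\<in>B. r b ` t b)"
    have "finite E" unfolding E_def using S(1) finB tr(1) by simp
    then obtain ts where ts: "set ts = E" using finite_list by blast
    obtain A where A: "is_subring A" "E \<subseteq> A" "\<forall>h\<in>A - {0}. \<exists>J. filtration A J \<and> unit_mod A (J 1) h"
      using exists_filtration[of ts, unfolded p(1) ts, OF p(2)] by (elim exE conjE)
    have BE: "b i \<in> A" if "b \<in> B" "i < n" for b i
    proof -
      have "b i \<in> E" unfolding E_def by (intro UnI1 UnI2 image_eqI[of _ _ "(b, i)"]) (use that in auto)
      then show ?thesis using A(2) by blast
    qed
    have rE: "r b d \<in> A" if "b \<in> B" "d \<in> t b" for b d
    proof -
      have "r b d \<in> E" unfolding E_def using that by blast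
      then show ?thesis using A(2) by blast
    qed
    have "\<rho> g i j \<in> E" if "g \<in> S \<union> m_inv G ` S" "i < n" "j < n" for g i j
      unfolding E_def using that by (intro UnI1 image_eqI[of _ _ "(g, i, j)"]) auto
    then have "entries_in A S" "entries_in A (m_inv G ` S)" using A(2) by (auto simp: entries_in_def)
    from entries_in_generate[OF A(1) S(2) this] have ent: "entries_in A (carrier G)" using S(3) by simp
    obtain J where J: "filtration A J" "unit_mod A (J 1) (b0 i0)" using A(3) BE[OF b0 i0(1)] i0(2) by blast
    note I = filtrationD(3)[OF J(1), of 1]
    note cof = filtrationD(4)[OF J(1), of 1]
    note simps = fixed_chain_simps[OF A(1) I ent cof p tors]
    note sub = fixed_chain_submod[OF A(1) I ent cof p tors]
    obtain m where m: "fixed_chain A (J 1) m = vectors A"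
      using fixed_chain_top[OF A(1) I ent cof p tors] by blast
    \<comment> \<open>When \<open>B\<close> lies in one term, the differences in \<open>D\<close>
      lie in the term below, and \<open>B\<close> consists of \<open>A\<close>-combinations of these
      differences.\<close>
    have descend: "B \<subseteq> fixed_chain A (J 1) j" if j: "B \<subseteq> fixed_chain A (J 1) (Suc j)" for j
    proof
      fix b assume b: "b \<in> B"
      have "d \<in> fixed_chain A (J 1) j" if d: "d \<in> t b" for d
      proof -
        obtain g b' where *: "g \<in> carrier G" "b' \<in> B" "d = act g b' - b'" using d tr(2)[OF b] unfolding D_def by blast
        have "\<forall>g\<in>carrier G. act g b' - b' \<in> fixed_chain A (J 1) j"
          using subsetD[OF j *(2)] unfolding simps(2) mem_Collect_eq by (rule conjunct2)
        then show ?thesis unfolding *(3) using *(1) by (rule bspec)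
      qed
      then have "(\<Sum>d\<in>t b. fscale (r b d) d) \<in> fixed_chain A (J 1) j"
        by (intro submod_sum[OF A(1) I ent cof p tors]) (use sub rE[OF b] in auto)
      then show "b \<in> fixed_chain A (J 1) j" using tr(3)[OF b] by simp
    qed
    have "B \<subseteq> fixed_chain A (J 1) m" unfolding m using BE B(1) WV by (auto simp: vectors_def)
    then have "B \<subseteq> fixed_chain A (J 1) 0"
    proof (induction m)
      case (Suc m)
      show ?case by (rule Suc.IH[OF descend[OF Suc.prems]])
    qed
    then have "b0 i0 \<in> J 1" using b0 i0(1) unfolding simps(1) vectors_def by blast
    obtain c where c: "c \<in> A" "b0 i0 * c - 1 \<in> J 1" using J(2) by (auto simp: unit_mod_def)
    have "c * b0 i0 - (b0 i0 * c - 1) \<in> J 1" by (intro is_idealD(3,4)[OF I] c) fact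
    then have "1 \<in> J 1" by (simp add: mult.commute)
    then show False using filtration_proper[OF J(1)] by simp
  qed
  then have "W = {0}" using B(3) FV.subspace_0[OF subW] by auto
  then show ?thesis unfolding W_def by blast
qed

text \<open>A group element is determined by the images of the \<open>n\<close> unit vectors, and
  each of these has a finite orbit.\<close>

lemma finite_p_torsion:
  assumes p: "CHAR('a) = p" "p > 0" and tors: "\<forall>g\<in>carrier G. \<exists>s. g [^] (p ^ s) = \<one>"
    and S: "finite S" "S \<subseteq> carrier G" "generate G S = carrier G"
  shows "finite (carrier G)"
proof -
  obtain k where k: "augmentation_chain (0 + k) = {0}" using augmentation_chain_vanishes[OF assms] by auto
  define e where "e i = (\<lambda>j. if j = i then 1 else 0 :: 'a)" for i :: nat
  have "e i \<in> augmentation_chain 0" if "i < n" for i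
    using that by (auto simp: augmentation_chain_simps vectors_def e_def)
  then have orb: "finite ((\<lambda>g. act g (e i)) ` carrier G)" if "i < n" for i
    using that orbits_finite[OF _ S k] p by simp
  define F where "F g = (\<lambda>i\<in>{..<n}. act g (e i))" for g
  have "F ` carrier G \<subseteq> (\<Pi>\<^sub>E i\<in>{..<n}. (\<lambda>g. act g (e i)) ` carrier G)" by (auto simp: F_def)
  moreover have "finite (\<Pi>\<^sub>E i\<in>{..<n}. (\<lambda>g. act g (e i)) ` carrier G)"
    by (rule finite_PiE) (use orb in auto)
  ultimately have fin: "finite (F ` carrier G)" by (rule finite_subset)
  have "inj_on F (carrier G)"
  proof (rule inj_onI)
    fix g h assume gh: "g \<in> carrier G" "h \<in> carrier G" "F g = F h"
    have ev: "act x (e j) i = \<rho> x i j" if "i < n" "j < n" for x i j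
      using that by (simp add: act_def e_def if_distrib[of "\<lambda>z. _ * z"] cong: if_cong)
    have eq: "\<rho> g i j = \<rho> h i j" if ij: "i < n" "j < n" for i j
    proof -
      have "act g (e j) = act h (e j)" using fun_cong[OF gh(3), of j] ij by (simp add: F_def)
      then show ?thesis using ev[OF ij] by metis
    qed
    have "g \<otimes> inv h = \<one>"
    proof (rule \<rho>_inj)
      fix i j assume ij: "i < n" "j < n"
      have "\<rho> (g \<otimes> inv h) i j = \<rho> (h \<otimes> inv h) i j"
        unfolding \<rho>_mult[OF gh(1) inv_closed[OF gh(2)] ij] \<rho>_mult[OF gh(2) inv_closed[OF gh(2)] ij]
        by (rule sum.cong) (use eq ij in auto)
      then show "\<rho> (g \<otimes> inv h) i j = (if i = j then 1 else 0)" using gh \<rho>_one[OF ij] by simp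
    qed (use gh in simp)
    then show "g = h" using gh by (simp add: inv_solve_right')
  qed
  then show ?thesis using fin finite_imageD by blast
qed

end

section \<open>Conclusion\<close>

context matrix_group_alg_closed
begin

text \<open>If all eigenvalues are roots of unity, the congruence subgroup of a proper ideal has
  only the eigenvalue 1 and is a \<open>p\<close>-torsion group. Having finite index it is finitely
  generated, hence finite, which contradicts \<open>inf\<close>.\<close>

lemma new_prime_char_pos:
  assumes char: "CHAR('a) > 0" and S: "finite S" "S \<subseteq> carrier G" "generate G S = carrier G"
    and inf: "infinite (carrier G)" and K: "K \<lhd> G" "finite (rcosets K)"
  shows "\<exists>l M. prime l \<and> \<not> l dvd card (rcosets K) \<and> M \<lhd> G \<and> M \<subseteq> K \<and> finite (rcosets M) \<and> l dvd coset_index G K M"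
proof (cases "\<exists>g\<in>carrier G. \<exists>e v. eigen g e v \<and> (\<forall>m>0. e ^ m \<noteq> 1)")
  case True
  then obtain g e v where g: "g \<in> carrier G" "eigen g e v" "\<And>m. m > 0 \<Longrightarrow> e ^ m \<noteq> 1" by blast
  show ?thesis by (rule new_prime_eigenvalue[OF char S K g])
next
  case False
  define p where "p = CHAR('a)"
  have p: "CHAR('a) = p" "p > 0" using char by (simp_all add: p_def)
  define E where "E = (\<lambda>(g, i, j). \<rho> g i j) ` ((S \<union> m_inv G ` S) \<times> {..<n} \<times> {..<n})"
  have "finite E" unfolding E_def using S(1) by simp
  then obtain ts where ts: "set ts = E" using finite_list by blast
  obtain A where A: "is_subring A" "E \<subseteq> A" "\<forall>h\<in>A - {0}. \<exists>J. filtration A J \<and> unit_mod A (J 1) h"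
    using exists_filtration[of ts, unfolded p(1) ts, OF p(2)] by (elim exE conjE)
  have "\<rho> g i j \<in> E" if "g \<in> S \<union> m_inv G ` S" "i < n" "j < n" for g i j
    unfolding E_def using that by (intro image_eqI[of _ _ "(g, i, j)"]) auto
  then have "entries_in A S" "entries_in A (m_inv G ` S)" using A(2) by (auto simp: entries_in_def)
  from entries_in_generate[OF A(1) S(2) this] have ent: "entries_in A (carrier G)" using S(3) by simp
  \<comment> \<open>Any filtration will do here, so the element to become a unit is taken to be
    1.\<close>
  have "1 \<in> A - {0}" using is_subringD(2)[OF A(1)] by simp
  with A(3) have "\<exists>J. filtration A J \<and> unit_mod A (J 1) 1" by (rule bspec)
  then obtain J where J: "filtration A J" by (elim exE conjE)
  note I = filtrationD(3)[OF J, of 1]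
  define N where "N = congruence_subgroup (J 1)"
  have N: "N \<lhd> G" "finite (rcosets N)"
    unfolding N_def
    by (rule congruence_subgroup_normal[OF A(1) I ent], rule congruence_subgroup_finite_index[OF A(1) I ent filtrationD(4)[OF J]])
  have subN: "subgroup N G" by (rule normal_imp_subgroup[OF N(1)])
  have tors: "\<exists>s. g [^] (p ^ s) = \<one>" if g: "g \<in> N" for g
  proof (rule unipotent_p_power_order[OF p subgroup.mem_carrier[OF subN g]])
    fix e v assume e: "eigen g e v"
    then obtain m where "m > 0" "e ^ m = 1" using False subgroup.mem_carrier[OF subN g] by metis
    then show "e = 1"
      using eigen_congruence_subgroup[OF char A(1) I filtration_proper[OF J] ent _ e] g by (simp add: N_def)
  qed
  obtain T where T: "finite T" "T \<subseteq> N" "generate G T = N"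
    using finite_index_finitely_generated[OF S subN N(2)] by (elim exE conjE)
  interpret N: group "G\<lparr>carrier := N\<rparr>" by (rule subgroup.subgroup_is_group[OF subN is_group])
  interpret N: matrix_group_alg_closed "G\<lparr>carrier := N\<rparr>" n \<rho>
    by unfold_locales (use \<rho>_mult \<rho>_one \<rho>_inj subgroup.mem_carrier[OF subN] in auto)
  have "finite (carrier (G\<lparr>carrier := N\<rparr>))"
  proof (rule N.finite_p_torsion[OF p])
    show "\<forall>g\<in>carrier (G\<lparr>carrier := N\<rparr>). \<exists>s. g [^]\<^bsub>G\<lparr>carrier := N\<rparr>\<^esub> (p ^ s) = \<one>\<^bsub>G\<lparr>carrier := N\<rparr>\<^esub>"
      using tors by (simp add: nat_pow_def)
    show "generate (G\<lparr>carrier := N\<rparr>) T = carrier (G\<lparr>carrier := N\<rparr>)"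
      using generate_consistent[OF T(2) subN] T(3) by simp
  qed (use T in auto)
  then have "finite N" by simp
  then have "finite C" if "C \<in> rcosets N" for C
    using that unfolding rcosets_image by (auto simp: r_coset_def)
  then have "finite (\<Union>(rcosets N))" using N(2) by simp
  then have "finite (carrier G)" using rcosets_part_G[OF subN] by simp
  then show ?thesis using inf by simp
qed

lemma new_prime:
  assumes "finite S" "S \<subseteq> carrier G" "generate G S = carrier G"
    and "infinite (carrier G)" "K \<lhd> G" "finite (rcosets K)"
  shows "\<exists>l M. prime l \<and> \<not> l dvd card (rcosets K) \<and> M \<lhd> G \<and> M \<subseteq> K \<and> finite (rcosets M) \<and> l dvd coset_index G K M"
  using new_prime_char_0[OF _ assms] new_prime_char_pos[OF _ assms] by (cases "CHAR('a) = 0") simp_all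

end

theorem theorem1p1:
  fixes n :: nat and \<Gamma> :: "'f::field mat set"
  assumes universe: "\<exists>\<iota> :: (nat \<Rightarrow> complex) \<Rightarrow> 'h. inj \<iota>"
    and n: "n \<ge> 1"
    and subgroup: "subgroup \<Gamma> (GL TYPE('f) n)"
    and fg: "finitely_generated ((GL TYPE('f) n)\<lparr>carrier := \<Gamma>\<rparr>)"
    and infinite: "infinite \<Gamma>"
  shows "uniform_kazhdan_const TYPE('h) ((GL TYPE('f) n)\<lparr>carrier := \<Gamma>\<rparr>) = 0"
proof -
  define G where "G = (GL TYPE('f) n)\<lparr>carrier := \<Gamma>\<rparr>"
  \<comment> \<open>The entries are moved to the algebraic closure, where eigenvalues exist;
    \<open>to_ac\<close> is injective, so the representation is faithful.\<close>
  define \<rho> where "\<rho> M i j = to_ac (M $$ (i, j))" for M :: "'f mat" and i j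
  have G: "carrier G = \<Gamma>" "\<And>M N. M \<otimes>\<^bsub>G\<^esub> N = M * N" "\<one>\<^bsub>G\<^esub> = 1\<^sub>m n"
    by (simp_all add: G_def GL_def units_of_def ring_mat_def)
  have dim: "M \<in> carrier_mat n n" if "M \<in> \<Gamma>" for M
    using subgroup.mem_carrier[OF subgroup that] by (simp add: GL_def units_of_def Units_def ring_mat_def)
  interpret group G unfolding G_def by (rule subgroup.subgroup_is_group[OF subgroup group_GL])
  interpret matrix_group_alg_closed G n \<rho>
  proof
    fix M N i j assume "M \<in> carrier G" "N \<in> carrier G" and ij: "i < n" "j < n"
    then have "M \<in> carrier_mat n n" "N \<in> carrier_mat n n" using dim by (simp_all add: G(1))
    then have "(M * N) $$ (i, j) = (\<Sum>k<n. M $$ (i, k) * N $$ (k, j))"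
      using ij by (simp add: scalar_prod_def atLeast0LessThan)
    then show "\<rho> (M \<otimes>\<^bsub>G\<^esub> N) i j = (\<Sum>k<n. \<rho> M i k * \<rho> N k j)"
      by (simp add: G(2) \<rho>_def to_ac_sum to_ac_mult)
  next
    fix i j assume "i < n" "j < n"
    then show "\<rho> \<one>\<^bsub>G\<^esub> i j = (if i = j then 1 else 0)" by (simp add: \<rho>_def G(3))
  next
    fix M assume M: "M \<in> carrier G" and one: "\<And>i j. i < n \<Longrightarrow> j < n \<Longrightarrow> \<rho> M i j = (if i = j then 1 else 0)"
    have "M $$ (i, j) = (if i = j then 1 else 0)" if "i < n" "j < n" for i j
      using one[OF that] by (simp add: \<rho>_def split: if_splits)
    then show "M = \<one>\<^bsub>G\<^esub>" using dim[of M] M G(1) by (intro eq_matI) (auto simp: G(3))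
  qed
  obtain S0 where S0: "finite S0" "S0 \<subseteq> carrier G" "generate G S0 = carrier G"
    using fg by (auto simp: finitely_generated_def finite_generating_sets_def G_def)
  have inf: "infinite (carrier G)" using infinite by (simp add: G(1))
  have step: "\<exists>N H. N \<lhd> G \<and> finite (rcosets\<^bsub>G\<^esub> N) \<and> N \<subseteq> K \<and> subgroup H G \<and> H \<noteq> carrier G \<and> N \<subseteq> H \<and>
      H <#>\<^bsub>G\<^esub> K = carrier G" if K: "K \<lhd> G" "finite (rcosets\<^bsub>G\<^esub> K)" for K
  proof -
    obtain l M where M: "prime l" "\<not> l dvd card (rcosets\<^bsub>G\<^esub> K)" "M \<lhd> G" "M \<subseteq> K" "finite (rcosets\<^bsub>G\<^esub> M)"
      "l dvd coset_index G K M" using new_prime[OF S0 inf K] by (elim exE conjE)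
    show ?thesis by (rule finite_index_supplement[OF K(1) M])
  qed
  have bound: "uniform_kazhdan_const TYPE('h) G \<le> ennreal (2 / sqrt (real k))" if k: "k > 0" for k
  proof -
    have "\<exists>S H K. finite S \<and> S \<subseteq> carrier G \<and> generate G S = carrier G \<and> K \<lhd> G \<and> finite (rcosets\<^bsub>G\<^esub> K) \<and>
        (\<forall>i<k. subgroup (H i) G \<and> H i \<noteq> carrier G \<and> K \<subseteq> H i) \<and> (\<forall>s\<in>S. \<exists>j. \<forall>i<k. i \<noteq> j \<longrightarrow> s \<in> H i)"
      by (rule redundant_generators[OF step S0])
    then obtain S H K where S: "finite S" "S \<subseteq> carrier G" "generate G S = carrier G"
      and K: "K \<lhd> G" "finite (rcosets\<^bsub>G\<^esub> K)"
      and H: "\<forall>i<k. subgroup (H i) G \<and> H i \<noteq> carrier G \<and> K \<subseteq> H i" "\<forall>s\<in>S. \<exists>j. \<forall>i<k. i \<noteq> j \<longrightarrow> s \<in> H i"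
      by (elim exE conjE)
    have "uniform_kazhdan_const TYPE('h) G \<le> kazhdan_const TYPE('h) G S"
      unfolding uniform_kazhdan_const_def by (rule INF_lower) (use S in \<open>simp add: finite_generating_sets_def\<close>)
    also have "\<dots> \<le> ennreal (2 / sqrt (real k))"
      by (rule kazhdan_const_le[where H = H, OF universe is_group K k]) (use S(2) H in auto)
    finally show ?thesis .
  qed
  have "(\<lambda>k. 2 / sqrt (real k)) \<longlonglongrightarrow> 0"
    by (intro tendsto_divide_0[OF tendsto_const] filterlim_at_top_imp_at_infinity
        filterlim_compose[OF sqrt_at_top filterlim_real_sequentially])
  then have "(\<lambda>k. ennreal (2 / sqrt (real k))) \<longlonglongrightarrow> ennreal 0" by (rule tendsto_ennrealI)
  then have "uniform_kazhdan_const TYPE('h) G \<le> ennreal 0"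
    by (rule LIMSEQ_le_const) (use bound in \<open>intro exI[of _ 1]; simp\<close>)
  then show ?thesis by (simp add: G_def)
qed

end
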